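(* Let $A$, $\Lambda$, $\nu$ and the weakly Borel measurable family $\Psi=(\psi_\lambda)_{\lambda\in\Lambda}\subset L^2(A)$ be as in the context. (a) The family $\Psi$ satisfies the Calderón condition $$\int_\Lambda|\widehat\psi_\lambda(\xi)|^2\,d\nu(\lambda)=1\quad\text{for a.e. }\xi\in\widehat A$$ if and only if the operator $W_\Psi:L^2(A)\to L^2(A\times\Lambda)$ is an isometry, and this is equivalent to the weak-sense inversion formula $$f=\int_\Lambda f*\psi_\lambda^**\psi_\lambda\,d\nu(\lambda)$$ holding for all $f\in L^2(A)$. (b) Assume that $\Psi$ satisfies the spectral injectivity condition: for every $\lambda\in\Lambda$ one has $\widehat\psi_\lambda\in L^\infty(\widehat A)$, and the map $$M_\Psi:L^1(\widehat A)\to\mathfrak{B}_\nu(\Lambda),\qquad (M_\Psi F)(\lambda)=\int_{\widehat A}F(\xi)\,|\widehat\psi_\lambda(\xi)|^2\,d\xi,$$ is injective. Let $f,g\in L^2(A)$. Then $|W_\Psi f|=|W_\Psi g|$ holds if and only if the following two properties are satisfied: (i) $|\widehat f|=|\widehat g|$; (ii) for all $\lambda\in\Lambda$: $|f*\psi_\lambda^*|=|g*\psi_\lambda^*|$ and $|\widehat{f*\psi_\lambda^*}|=|\widehat{g*\psi_\lambda^*}|$.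
   Context: $A$ is a second-countable locally compact abelian Hausdorff group with dual group $\widehat A$; Haar measures are normalized so that Plancherel's theorem holds, and $\widehat{\cdot}$ denotes the Fourier transform. $\Lambda$ is a $\sigma$-compact locally compact Hausdorff space with a Radon measure $\nu$. The family $\Psi=(\psi_\lambda)_{\lambda\in\Lambda}\subset L^2(A)$ is weakly Borel measurable: for all $f\in L^2(A)$ the map $\lambda\mapsto\langle f,\psi_\lambda\rangle$ is Borel measurable on $\Lambda$. Write $g^*(x)=\overline{g(-x)}$ and $*$ for convolution. The generalized wavelet transform of $f\in L^2(A)$ is the function $W_\Psi f:A\times\Lambda\to\mathbb{C}$, $W_\Psi f(x,\lambda)=(f*\psi_\lambda^* )(x)=\langle f,T_x\psi_\lambda\rangle$, where $T_x\psi(y)=\psi(y-x)$. $L^2(A\times\Lambda)$ is taken with respect to the product of Haar measure and $\nu$. $\mathfrak{B}_\nu(\Lambda)$ is the set of Borel measurable functions on $\Lambda$, two functions being identified if they agree $\nu$-a.e. The weak-sense inversion formula means $\langle f,g\rangle=\int_\Lambda\langle f*\psi_\lambda^*,g*\psi_\lambda^*\rangle\,d\nu(\lambda)$ for all $g\in L^2(A)$ (formally, pairing the integrand $f*\psi_\lambda^**\psi_\lambda$ with $g$). *)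

theory Defs
  imports "HOL-Analysis.Analysis"
begin

section \<open>Radon and Haar measures\<close>

definition sigma_compact_space :: "'a topology \<Rightarrow> bool" where
  "sigma_compact_space X \<longleftrightarrow>
     (\<exists>\<K>. countable \<K> \<and> (\<forall>K\<in>\<K>. compactin X K) \<and> \<Union>\<K> = topspace X)"

definition radon_measure :: "'a::topological_space measure \<Rightarrow> bool" where
  "radon_measure M \<longleftrightarrow>
     sets M = sets borel \<and>
     (\<forall>K. compact K \<and> closed K \<longrightarrow> emeasure M K < \<infinity>) \<and>
     (\<forall>B\<in>sets borel. emeasure M B = (INF U\<in>{U. open U \<and> B \<subseteq> U}. emeasure M U)) \<and>
     (\<forall>U. open U \<longrightarrow>
        emeasure M U = (SUP K\<in>{K. compact K \<and> closed K \<and> K \<subseteq> U}. emeasure M K))"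

text \<open>In Hausdorff spaces the clause \<open>closed K\<close> is redundant; it only makes the definition
  meaningful (compact sets are Borel) without a separation axiom in the sort of the type.\<close>

definition haar_measure :: "'a::{ab_group_add,topological_space} measure \<Rightarrow> bool" where
  "haar_measure M \<longleftrightarrow>
     radon_measure M \<and> emeasure M UNIV \<noteq> 0 \<and>
     (\<forall>x. \<forall>B\<in>sets borel. emeasure M ((+) x ` B) = emeasure M B)"

section \<open>The dual group\<close>

definition is_character :: "('a::{ab_group_add,topological_space} \<Rightarrow> complex) \<Rightarrow> bool" where
  "is_character \<gamma> \<longleftrightarrow>
     continuous_on UNIV \<gamma> \<and> (\<forall>x. cmod (\<gamma> x) = 1) \<and> (\<forall>x y. \<gamma> (x + y) = \<gamma> x * \<gamma> y)"

typedef (overloaded) 'a dual =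
  "{\<gamma> :: 'a::{ab_group_add,topological_space} \<Rightarrow> complex. is_character \<gamma>}"
  morphisms char_eval Abs_dual
  by (rule exI[of _ "\<lambda>_. 1"]) (simp add: is_character_def)

setup_lifting type_definition_dual

text \<open>The dual group is written additively, so addition is pointwise multiplication of
  characters.\<close>

instantiation dual :: ("{ab_group_add,topological_space}") ab_group_add
begin

lift_definition zero_dual :: "'a dual" is "\<lambda>_. 1"
  by (simp add: is_character_def)

lift_definition plus_dual :: "'a dual \<Rightarrow> 'a dual \<Rightarrow> 'a dual" is "\<lambda>\<gamma> \<eta> x. \<gamma> x * \<eta> x"
  by (auto simp: is_character_def norm_mult intro!: continuous_intros)

lift_definition uminus_dual :: "'a dual \<Rightarrow> 'a dual" is "\<lambda>\<gamma> x. cnj (\<gamma> x)"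
  by (auto simp: is_character_def intro!: continuous_intros)

definition minus_dual :: "'a dual \<Rightarrow> 'a dual \<Rightarrow> 'a dual" where
  "minus_dual \<gamma> \<eta> = \<gamma> + - \<eta>"

instance
proof
  fix a b c :: "'a dual"
  show "a + b + c = a + (b + c)" by transfer (simp add: mult.assoc)
  show "a + b = b + a" by transfer (simp add: mult.commute)
  show "0 + a = a" by transfer simp
  show "- a + a = 0"
  proof transfer
    fix \<gamma> :: "'a \<Rightarrow> complex"
    assume "is_character \<gamma>"
    then have "cmod (\<gamma> x) = 1" for x by (simp add: is_character_def)
    then show "(\<lambda>x. cnj (\<gamma> x) * \<gamma> x) = (\<lambda>_. 1)"
      by (simp add: mult.commute[of "cnj _"] complex_norm_square[symmetric])
  qed
  show "a - b = a + - b" by (rule minus_dual_def)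
qed

end

text \<open>The compact-open topology, i.e. uniform convergence on compact sets.\<close>

instantiation dual :: ("{ab_group_add,topological_space}") topological_space
begin

definition open_dual :: "'a dual set \<Rightarrow> bool" where
  "open_dual = generate_topology
     {{\<gamma>. char_eval \<gamma> ` K \<subseteq> U} | K U. compact K \<and> open U}"

instance
  by standard (auto simp: open_dual_def intro: generate_topology.intros)

end

section \<open>Square-integrable functions and the Fourier transform\<close>

definition L2 :: "'a measure \<Rightarrow> ('a \<Rightarrow> complex) set" where
  "L2 M = {f \<in> borel_measurable M. integrable M (\<lambda>x. (cmod (f x))\<^sup>2)}"

definition Linf :: "'a measure \<Rightarrow> ('a \<Rightarrow> complex) set" where
  "Linf M = {f \<in> borel_measurable M. \<exists>C. AE x in M. cmod (f x) \<le> C}"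

definition l2_inner :: "'a measure \<Rightarrow> ('a \<Rightarrow> complex) \<Rightarrow> ('a \<Rightarrow> complex) \<Rightarrow> complex" where
  "l2_inner M f g = (LINT x|M. f x * cnj (g x))"

definition l2_norm :: "'a measure \<Rightarrow> ('a \<Rightarrow> complex) \<Rightarrow> real" where
  "l2_norm M f = sqrt (LINT x|M. (cmod (f x))\<^sup>2)"

definition fourier_L1 ::
  "'a::{ab_group_add,topological_space} measure \<Rightarrow> ('a \<Rightarrow> complex) \<Rightarrow> 'a dual \<Rightarrow> complex" where
  "fourier_L1 \<mu> f \<xi> = (LINT x|\<mu>. f x * cnj (char_eval \<xi> x))"

text \<open>The normalization of the pair of Haar measures: the Fourier transform is isometric from
  \<open>L\<^sup>1 \<inter> L\<^sup>2\<close> into \<open>L\<^sup>2\<close> of the dual group. That its extension to \<open>L\<^sup>2\<close> is onto is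
  not part of the condition.\<close>

definition plancherel_normalized ::
  "'a::{ab_group_add,topological_space} measure \<Rightarrow> 'a dual measure \<Rightarrow> bool" where
  "plancherel_normalized \<mu> \<mu>d \<longleftrightarrow>
     (\<forall>f. integrable \<mu> f \<and> f \<in> L2 \<mu> \<longrightarrow>
        fourier_L1 \<mu> f \<in> L2 \<mu>d \<and> l2_norm \<mu>d (fourier_L1 \<mu> f) = l2_norm \<mu> f)"

text \<open>The Fourier transform on \<open>L\<^sup>2\<close> is the extension by continuity from \<open>L\<^sup>1 \<inter> L\<^sup>2\<close>. It is
  determined only up to null sets; \<open>fourier\<close> chooses a representative.\<close>

definition is_fourier_L2 ::
  "'a::{ab_group_add,topological_space} measure \<Rightarrow> 'a dual measure \<Rightarrow>
   ('a \<Rightarrow> complex) \<Rightarrow> ('a dual \<Rightarrow> complex) \<Rightarrow> bool" where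
  "is_fourier_L2 \<mu> \<mu>d f F \<longleftrightarrow>
     F \<in> L2 \<mu>d \<and>
     (\<exists>u. (\<forall>n. integrable \<mu> (u n) \<and> u n \<in> L2 \<mu>) \<and>
        (\<lambda>n::nat. l2_norm \<mu> (\<lambda>x. u n x - f x)) \<longlonglongrightarrow> 0 \<and>
        (\<lambda>n. l2_norm \<mu>d (\<lambda>\<xi>. fourier_L1 \<mu> (u n) \<xi> - F \<xi>)) \<longlonglongrightarrow> 0)"

definition fourier ::
  "'a::{ab_group_add,topological_space} measure \<Rightarrow> 'a dual measure \<Rightarrow>
   ('a \<Rightarrow> complex) \<Rightarrow> 'a dual \<Rightarrow> complex" where
  "fourier \<mu> \<mu>d f = (SOME F. is_fourier_L2 \<mu> \<mu>d f F)"

section \<open>The generalized wavelet transform\<close>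

definition convolution ::
  "'a::ab_group_add measure \<Rightarrow> ('a \<Rightarrow> complex) \<Rightarrow> ('a \<Rightarrow> complex) \<Rightarrow> 'a \<Rightarrow> complex" where
  "convolution \<mu> f h x = (LINT y|\<mu>. f y * h (x - y))"

definition involution :: "('a::ab_group_add \<Rightarrow> complex) \<Rightarrow> 'a \<Rightarrow> complex" where
  "involution g x = cnj (g (- x))"

definition translation :: "'a::ab_group_add \<Rightarrow> ('a \<Rightarrow> complex) \<Rightarrow> 'a \<Rightarrow> complex" where
  "translation x g y = g (y - x)"

definition wavelet_transform ::
  "'a::ab_group_add measure \<Rightarrow> ('l \<Rightarrow> 'a \<Rightarrow> complex) \<Rightarrow> ('a \<Rightarrow> complex) \<Rightarrow> 'a \<times> 'l \<Rightarrow> complex"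
  where "wavelet_transform \<mu> \<psi> f = (\<lambda>(x, l). convolution \<mu> f (involution (\<psi> l)) x)"

lemma wavelet_transform_eq_inner:
  "wavelet_transform \<mu> \<psi> f (x, l) = l2_inner \<mu> f (translation x (\<psi> l))"
  by (simp add: wavelet_transform_def convolution_def involution_def l2_inner_def
      translation_def)

definition weakly_borel_measurable ::
  "'a measure \<Rightarrow> ('l::topological_space \<Rightarrow> 'a \<Rightarrow> complex) \<Rightarrow> bool" where
  "weakly_borel_measurable \<mu> \<psi> \<longleftrightarrow>
     (\<forall>f\<in>L2 \<mu>. (\<lambda>l. l2_inner \<mu> f (\<psi> l)) \<in> borel_measurable borel)"

text \<open>Each transform of \<open>\<psi> l\<close> is determined only almost everywhere, so integrating over \<open>l\<close> for
  a fixed \<open>\<xi>\<close> requires representatives that are jointly measurable. For a weakly measurable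
  family such a choice exists, and by Fubini's theorem the condition does not depend on it.\<close>

definition calderon_condition ::
  "'a::{ab_group_add,topological_space} measure \<Rightarrow> 'a dual measure \<Rightarrow> 'l measure \<Rightarrow>
   ('l \<Rightarrow> 'a \<Rightarrow> complex) \<Rightarrow> bool" where
  "calderon_condition \<mu> \<mu>d \<nu> \<psi> \<longleftrightarrow>
     (\<exists>\<Phi>. (\<lambda>(l, \<xi>). \<Phi> l \<xi>) \<in> borel_measurable (\<nu> \<Otimes>\<^sub>M \<mu>d) \<and>
        (\<forall>l. AE \<xi> in \<mu>d. \<Phi> l \<xi> = fourier \<mu> \<mu>d (\<psi> l) \<xi>) \<and>
        (AE \<xi> in \<mu>d. (\<integral>\<^sup>+ l. ennreal ((cmod (\<Phi> l \<xi>))\<^sup>2) \<partial>\<nu>) = 1))"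

definition wavelet_isometry ::
  "'a::ab_group_add measure \<Rightarrow> 'l measure \<Rightarrow> ('l \<Rightarrow> 'a \<Rightarrow> complex) \<Rightarrow> bool" where
  "wavelet_isometry \<mu> \<nu> \<psi> \<longleftrightarrow>
     (\<forall>f\<in>L2 \<mu>. wavelet_transform \<mu> \<psi> f \<in> L2 (\<mu> \<Otimes>\<^sub>M \<nu>) \<and>
        l2_norm (\<mu> \<Otimes>\<^sub>M \<nu>) (wavelet_transform \<mu> \<psi> f) = l2_norm \<mu> f)"

text \<open>The first two clauses say that the weak integral makes sense; without them the Bochner
  integral would default to 0.\<close>

definition weak_inversion_formula ::
  "'a::ab_group_add measure \<Rightarrow> 'l measure \<Rightarrow> ('l \<Rightarrow> 'a \<Rightarrow> complex) \<Rightarrow> ('a \<Rightarrow> complex) \<Rightarrow> bool"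
  where
  "weak_inversion_formula \<mu> \<nu> \<psi> f \<longleftrightarrow>
     (AE l in \<nu>. convolution \<mu> f (involution (\<psi> l)) \<in> L2 \<mu>) \<and>
     (\<forall>g\<in>L2 \<mu>.
        integrable \<nu> (\<lambda>l. l2_inner \<mu> (convolution \<mu> f (involution (\<psi> l)))
                                       (convolution \<mu> g (involution (\<psi> l)))) \<and>
        l2_inner \<mu> f g =
          (LINT l|\<nu>. l2_inner \<mu> (convolution \<mu> f (involution (\<psi> l)))
                                (convolution \<mu> g (involution (\<psi> l)))))"

definition spectral_map ::
  "'a::{ab_group_add,topological_space} measure \<Rightarrow> 'a dual measure \<Rightarrow>
   ('l \<Rightarrow> 'a \<Rightarrow> complex) \<Rightarrow> ('a dual \<Rightarrow> complex) \<Rightarrow> 'l \<Rightarrow> complex" where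
  "spectral_map \<mu> \<mu>d \<psi> F l =
     (LINT \<xi>|\<mu>d. F \<xi> * complex_of_real ((cmod (fourier \<mu> \<mu>d (\<psi> l) \<xi>))\<^sup>2))"

text \<open>Injectivity is between spaces of classes of functions modulo null sets.\<close>

definition spectral_injectivity ::
  "'a::{ab_group_add,topological_space} measure \<Rightarrow> 'a dual measure \<Rightarrow> 'l measure \<Rightarrow>
   ('l \<Rightarrow> 'a \<Rightarrow> complex) \<Rightarrow> bool" where
  "spectral_injectivity \<mu> \<mu>d \<nu> \<psi> \<longleftrightarrow>
     (\<forall>l. fourier \<mu> \<mu>d (\<psi> l) \<in> Linf \<mu>d) \<and>
     (\<forall>F G. integrable \<mu>d F \<and> integrable \<mu>d G \<and>
        (AE l in \<nu>. spectral_map \<mu> \<mu>d \<psi> F l = spectral_map \<mu> \<mu>d \<psi> G l) \<longrightarrow>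
        (AE \<xi> in \<mu>d. F \<xi> = G \<xi>))"

end

theory Submission
  imports Defs
begin

text \<open>By Parseval, \<open>f * \<psi>\<^sub>l\<^sup>*\<close> is the inverse Fourier transform of the integrable function
  \<open>H = f\<^sup>\<wedge> cnj \<psi>\<^sub>l\<^sup>\<wedge>\<close>. Everything rests on the identity \<open>\<integral>\<bar>f * \<psi>\<^sub>l\<^sup>*\<bar>\<^sup>2 = \<integral>\<bar>H\<bar>\<^sup>2\<close>, valid in \<open>[0, \<infinity>]\<close>. It needs
  neither surjectivity of the Plancherel transform nor Pontryagin duality: testing against cut-offs
  shows that the inverse transform of \<open>H \<in> L\<^sup>1 \<inter> L\<^sup>2\<close> lies in \<open>L\<^sup>2\<close>, and an integrable function on
  the dual group with vanishing inverse transform is zero because the evaluations generate the Borel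
  sets of characters. With Tonelli's theorem the identity reduces (a) to
  \<open>\<integral>\<bar>f\<^sup>\<wedge>\<bar>\<^sup>2 C = \<parallel>f\<parallel>\<^sup>2\<close>, where \<open>C\<close> is the Calderon integral, and (b) to the hypothesis that
  \<open>\<bar>f\<^sup>\<wedge>\<bar>\<^sup>2\<close> is determined by the integrals \<open>\<integral>\<bar>f\<^sup>\<wedge>\<bar>\<^sup>2 \<bar>\<psi>\<^sub>l\<^sup>\<wedge>\<bar>\<^sup>2\<close>.\<close>

section \<open>Square-integrable functions\<close>

text \<open>Two obstacles shape the proof. The dual group comes with its compact-open topology only,
  so whatever countability it has must be drawn from that of \<open>'a\<close>. Countably many
  conditions "a basic open set is sent into a closed set" form a network of the dual; this makes
  evaluation measurable for the product sigma-algebra. Likewise, countably many indicators of open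
  sets of finite measure have transforms without a common zero. These transforms give
  sigma-finiteness of \<open>\<mu>d\<close>, hence Fubini's theorem, and they serve as multipliers:
  an unknown function on the dual need not be integrable, but weighted by such a transform it is,
  and the weight can be cancelled because at each character one of the countably many is nonzero.
  The second obstacle is that \<open>\<psi>\<close> is only weakly measurable, whereas Tonelli's
  theorem asks for transforms jointly measurable in \<open>l\<close> and \<open>\<xi>\<close>. A
  dense sequence in \<open>L2\<close> supplies such a representative \<open>\<Phi>\<close>, from
  which the joint measurability of the wavelet transform follows too.\<close>

lemma L2D:
  assumes "f \<in> L2 M"
  shows "f \<in> borel_measurable M" "integrable M (\<lambda>x. (cmod (f x))\<^sup>2)"
  using assms by (auto simp: L2_def)

lemma borel_measurable_cnj [measurable (raw)]:
  "f \<in> borel_measurable M \<Longrightarrow> (\<lambda>x. cnj (f x)) \<in> borel_measurable M"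
  by (rule borel_measurable_continuous_on[OF continuous_on_cnj[OF continuous_on_id]])

text \<open>Membership becomes finiteness of an integral in [0, infinity], the form in which
  Tonelli, Fatou and the transform identities deliver it.\<close>

lemma L2_iff_nn_integral:
  "f \<in> L2 M \<longleftrightarrow> f \<in> borel_measurable M \<and> (\<integral>\<^sup>+x. ennreal ((cmod (f x))\<^sup>2) \<partial>M) < \<infinity>"
  by (auto simp: L2_def integrable_iff_bounded)

lemma l2_norm_nonneg [simp]: "0 \<le> l2_norm M f"
  by (simp add: l2_norm_def)

lemma l2_norm_power2: "(l2_norm M f)\<^sup>2 = (LINT x|M. (cmod (f x))\<^sup>2)"
  by (simp add: l2_norm_def)

lemma nn_integral_L2:
  assumes "f \<in> L2 M"
  shows "(\<integral>\<^sup>+x. ennreal ((cmod (f x))\<^sup>2) \<partial>M) = ennreal ((l2_norm M f)\<^sup>2)"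
  unfolding l2_norm_power2 by (rule nn_integral_eq_integral) (use L2D[OF assms] in auto)

lemma l2_norm_eqI:
  assumes "f \<in> L2 M" "g \<in> L2 N"
    and "(\<integral>\<^sup>+x. ennreal ((cmod (f x))\<^sup>2) \<partial>M) = (\<integral>\<^sup>+x. ennreal ((cmod (g x))\<^sup>2) \<partial>N)"
  shows "l2_norm M f = l2_norm N g"
  using assms(3) unfolding nn_integral_L2[OF assms(1)] nn_integral_L2[OF assms(2)]
  by simp

lemma L2_bound:
  assumes "f \<in> borel_measurable M" "integrable M g" "AE x in M. (cmod (f x))\<^sup>2 \<le> g x"
  shows "f \<in> L2 M"
  unfolding L2_def using assms
  by (auto intro!: Bochner_Integration.integrable_bound[OF assms(2)])

lemma L2_cmult [intro]:
  assumes "f \<in> L2 M"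
  shows "(\<lambda>x. c * f x) \<in> L2 M"
  using L2D[OF assms] by (auto simp: L2_def norm_mult power_mult_distrib)

lemma cmod_add_power2_le: "(cmod (a + b))\<^sup>2 \<le> 2 * ((cmod a)\<^sup>2 + (cmod b)\<^sup>2)"
proof -
  have "(cmod (a + b))\<^sup>2 \<le> (cmod a + cmod b)\<^sup>2"
    by (intro power_mono norm_triangle_ineq) auto
  also have "\<dots> \<le> 2 * ((cmod a)\<^sup>2 + (cmod b)\<^sup>2)"
    using sum_squares_bound[of "cmod a" "cmod b"] by (simp add: power2_sum)
  finally show ?thesis .
qed

lemma L2_add [intro]:
  assumes "f \<in> L2 M" "g \<in> L2 M"
  shows "(\<lambda>x. f x + g x) \<in> L2 M"
proof (rule L2_bound)
  show "integrable M (\<lambda>x. 2 * ((cmod (f x))\<^sup>2 + (cmod (g x))\<^sup>2))"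
    using L2D[OF assms(1)] L2D[OF assms(2)] by auto
  show "AE x in M. (cmod (f x + g x))\<^sup>2 \<le> 2 * ((cmod (f x))\<^sup>2 + (cmod (g x))\<^sup>2)"
    by (intro AE_I2 cmod_add_power2_le)
qed (use L2D[OF assms(1)] L2D[OF assms(2)] in auto)

lemma L2_diff [intro]:
  assumes "f \<in> L2 M" "g \<in> L2 M"
  shows "(\<lambda>x. f x - g x) \<in> L2 M"
  using L2_add[OF assms(1) L2_cmult[OF assms(2), of "-1"]] by simp

lemma L2_zero [simp, intro]: "(\<lambda>x. 0) \<in> L2 M"
  by (simp add: L2_def)

lemma L2_unimodular:
  assumes "f \<in> L2 M" "c \<in> borel_measurable M" "\<And>x. cmod (c x) = 1"
  shows "(\<lambda>x. c x * f x) \<in> L2 M"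
  using L2D[OF assms(1)] assms by (auto simp: L2_def norm_mult)

lemma integrable_L2_mult:
  assumes "f \<in> L2 M" "g \<in> L2 M"
  shows "integrable M (\<lambda>x. f x * cnj (g x))" "integrable M (\<lambda>x. cmod (f x) * cmod (g x))"
proof -
  note [measurable] = L2D(1)[OF assms(1)] L2D(1)[OF assms(2)]
  have *: "cmod a * cmod b \<le> (cmod a)\<^sup>2 + (cmod b)\<^sup>2" for a b
    using sum_squares_bound[of "cmod a" "cmod b"] mult_nonneg_nonneg[OF norm_ge_zero norm_ge_zero, of a b]
    unfolding mult.assoc by linarith
  have int: "integrable M (\<lambda>x. (cmod (f x))\<^sup>2 + (cmod (g x))\<^sup>2)"
    using L2D[OF assms(1)] L2D[OF assms(2)] by auto
  show 1: "integrable M (\<lambda>x. cmod (f x) * cmod (g x))"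
    by (rule Bochner_Integration.integrable_bound[OF int])
       (use * in \<open>auto intro!: AE_I2 simp: abs_mult\<close>)
  show "integrable M (\<lambda>x. f x * cnj (g x))"
    by (rule Bochner_Integration.integrable_bound[OF 1], measurable) (auto simp: norm_mult)
qed

lemma l2_norm_eq_0_iff:
  assumes "f \<in> L2 M"
  shows "l2_norm M f = 0 \<longleftrightarrow> (AE x in M. f x = 0)"
proof -
  have "l2_norm M f = 0 \<longleftrightarrow> (LINT x|M. (cmod (f x))\<^sup>2) = 0"
    by (simp add: l2_norm_def)
  also have "\<dots> \<longleftrightarrow> (AE x in M. (cmod (f x))\<^sup>2 = 0)"
    by (rule integral_nonneg_eq_0_iff_AE) (use L2D[OF assms] in auto)
  finally show ?thesis by simp
qed

lemma l2_norm_cong_AE: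
  assumes "AE x in M. cmod (f x) = cmod (g x)" "f \<in> borel_measurable M" "g \<in> borel_measurable M"
  shows "l2_norm M f = l2_norm M g"
proof -
  have "(LINT x|M. (cmod (f x))\<^sup>2) = (LINT x|M. (cmod (g x))\<^sup>2)"
    by (rule integral_cong_AE) (use assms in auto)
  then show ?thesis by (simp add: l2_norm_def)
qed

lemma l2_norm_cmult: "l2_norm M (\<lambda>x. c * f x) = cmod c * l2_norm M f"
  by (simp add: l2_norm_def norm_mult power_mult_distrib real_sqrt_mult)

text \<open>The integral of \<open>(cmod (f x) - t * cmod (g x))\<^sup>2\<close> is a nonnegative
  quadratic in \<open>t\<close>; its value at the minimizer \<open>t = b / c\<close> gives the
  claim, and for \<open>c = 0\<close> the function \<open>g\<close> vanishes almost
  everywhere.\<close>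

lemma Cauchy_Schwarz_L2:
  assumes "f \<in> L2 M" "g \<in> L2 M"
  shows "(LINT x|M. cmod (f x) * cmod (g x)) \<le> l2_norm M f * l2_norm M g"
proof -
  define a b c where "a = (LINT x|M. (cmod (f x))\<^sup>2)"
    and "b = (LINT x|M. cmod (f x) * cmod (g x))" and "c = (LINT x|M. (cmod (g x))\<^sup>2)"
  note [simp] = L2D[OF assms(1)] L2D[OF assms(2)] integrable_L2_mult[OF assms]
  have q: "0 \<le> a - 2 * t * b + t\<^sup>2 * c" for t :: real
  proof -
    have "0 \<le> (LINT x|M. (cmod (f x) - t * cmod (g x))\<^sup>2)" by simp
    also have "\<dots> = (LINT x|M. (cmod (f x))\<^sup>2 - 2 * t * (cmod (f x) * cmod (g x)) + t\<^sup>2 * (cmod (g x))\<^sup>2)"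
      by (intro Bochner_Integration.integral_cong) (auto simp: power2_eq_square algebra_simps)
    also have "\<dots> = a - 2 * t * b + t\<^sup>2 * c" by (simp add: a_def b_def c_def)
    finally show ?thesis .
  qed
  have c0: "c \<ge> 0" and a0: "a \<ge> 0" and b0: "b \<ge> 0" by (auto simp: a_def b_def c_def)
  have "b\<^sup>2 \<le> a * c"
  proof (cases "c = 0")
    case True
    have "AE x in M. g x = 0" using True l2_norm_eq_0_iff[OF assms(2)] by (simp add: c_def l2_norm_def)
    then have "b = 0" unfolding b_def by (intro integral_eq_zero_AE) auto
    then show ?thesis using True by simp
  next
    case False
    then have "0 \<le> (a - 2 * (b / c) * b + (b / c)\<^sup>2 * c) * c" using q[of "b / c"] c0 by simp
    also have "\<dots> = a * c - b\<^sup>2" using False by (simp add: field_simps power2_eq_square)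
    finally show ?thesis by simp
  qed
  then have "b \<le> sqrt (a * c)" by (rule real_le_rsqrt)
  then show ?thesis by (simp add: a_def b_def c_def l2_norm_def real_sqrt_mult)
qed

lemma l2_inner_le:
  assumes "f \<in> L2 M" "g \<in> L2 M"
  shows "cmod (l2_inner M f g) \<le> l2_norm M f * l2_norm M g"
proof -
  have "cmod (l2_inner M f g) \<le> (LINT x|M. cmod (f x * cnj (g x)))"
    unfolding l2_inner_def by (rule integral_norm_bound)
  also have "\<dots> \<le> l2_norm M f * l2_norm M g"
    using Cauchy_Schwarz_L2[OF assms] by (simp add: norm_mult)
  finally show ?thesis .
qed

lemma l2_norm_triangle:
  assumes "f \<in> L2 M" "g \<in> L2 M"
  shows "l2_norm M (\<lambda>x. f x + g x) \<le> l2_norm M f + l2_norm M g"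
proof -
  note [simp] = L2D[OF assms(1)] L2D[OF assms(2)] integrable_L2_mult[OF assms]
    L2D[OF L2_add[OF assms]]
  have "(LINT x|M. (cmod (f x + g x))\<^sup>2)
      \<le> (LINT x|M. (cmod (f x))\<^sup>2 + 2 * (cmod (f x) * cmod (g x)) + (cmod (g x))\<^sup>2)"
  proof (intro integral_mono)
    fix x
    have "(cmod (f x + g x))\<^sup>2 \<le> (cmod (f x) + cmod (g x))\<^sup>2"
      by (intro power_mono norm_triangle_ineq) auto
    then show "(cmod (f x + g x))\<^sup>2 \<le> (cmod (f x))\<^sup>2 + 2 * (cmod (f x) * cmod (g x)) + (cmod (g x))\<^sup>2"
      by (simp add: power2_sum)
  qed auto
  also have "\<dots> \<le> (l2_norm M f + l2_norm M g)\<^sup>2"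
    using Cauchy_Schwarz_L2[OF assms] by (simp add: power2_sum l2_norm_power2)
  finally show ?thesis unfolding l2_norm_def[of M "\<lambda>x. f x + g x"]
    by (intro real_le_lsqrt) auto
qed

lemma l2_norm_minus_commute: "l2_norm M (\<lambda>x. f x - g x) = l2_norm M (\<lambda>x. g x - f x)"
  by (simp add: l2_norm_def norm_minus_commute)

lemma l2_norm_triangle_diff:
  assumes "f \<in> L2 M" "g \<in> L2 M" "h \<in> L2 M"
  shows "l2_norm M (\<lambda>x. f x - h x) \<le> l2_norm M (\<lambda>x. f x - g x) + l2_norm M (\<lambda>x. g x - h x)"
  using l2_norm_triangle[OF L2_diff[OF assms(1,2)] L2_diff[OF assms(2,3)]] by simp

lemma l2_norm_diff_le:
  assumes "f \<in> L2 M" "g \<in> L2 M"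
  shows "\<bar>l2_norm M f - l2_norm M g\<bar> \<le> l2_norm M (\<lambda>x. f x - g x)"
  using l2_norm_triangle[OF L2_diff[OF assms] assms(2)]
    l2_norm_triangle[OF L2_diff[OF assms(2,1)] assms(1)] l2_norm_minus_commute[of M f g] by simp

lemma l2_norm_tendsto:
  assumes "\<And>n. u n \<in> L2 M" "f \<in> L2 M" "(\<lambda>n. l2_norm M (\<lambda>x. u n x - f x)) \<longlonglongrightarrow> 0"
  shows "(\<lambda>n. l2_norm M (u n)) \<longlonglongrightarrow> l2_norm M f"
proof (rule LIM_zero_cancel, rule tendsto_rabs_zero_cancel,
    rule tendsto_sandwich[OF _ _ tendsto_const assms(3)])
  show "\<forall>\<^sub>F n in sequentially. \<bar>l2_norm M (u n) - l2_norm M f\<bar> \<le> l2_norm M (\<lambda>x. u n x - f x)"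
    using l2_norm_diff_le[OF assms(1,2)] by simp
qed (use assms in auto)

lemma l2_inner_self: "l2_inner M f f = of_real ((l2_norm M f)\<^sup>2)"
proof -
  have "l2_inner M f f = (LINT x|M. of_real ((cmod (f x))\<^sup>2))"
    unfolding l2_inner_def complex_norm_square ..
  then show ?thesis by (simp only: integral_complex_of_real l2_norm_power2)
qed

lemma l2_norm_add_cmult:
  assumes "f \<in> L2 M" "g \<in> L2 M"
  shows "(l2_norm M (\<lambda>x. f x + c * g x))\<^sup>2
    = (l2_norm M f)\<^sup>2 + 2 * Re (cnj c * l2_inner M f g) + (cmod c)\<^sup>2 * (l2_norm M g)\<^sup>2"
proof -
  note [simp] = L2D[OF assms(1)] L2D[OF assms(2)] integrable_L2_mult(1)[OF assms]
  have *: "(cmod (a + c * b))\<^sup>2 = (cmod a)\<^sup>2 + 2 * Re (cnj c * (a * cnj b)) + (cmod c)\<^sup>2 * (cmod b)\<^sup>2" for a b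
    unfolding cmod_power2 by (simp add: power2_eq_square algebra_simps)
  define p where "p = (\<lambda>x. Re (cnj c * (f x * cnj (g x))))"
  have p: "integrable M p" "(LINT x|M. p x) = Re (cnj c * l2_inner M f g)"
    unfolding p_def l2_inner_def by (auto intro!: integrable_Re simp: integral_Re simp del: times_complex.sel)
  have "(l2_norm M (\<lambda>x. f x + c * g x))\<^sup>2
    = (LINT x|M. (cmod (f x))\<^sup>2 + 2 * p x + (cmod c)\<^sup>2 * (cmod (g x))\<^sup>2)"
    unfolding l2_norm_power2 * p_def ..
  also have "\<dots> = (LINT x|M. (cmod (f x))\<^sup>2) + 2 * (LINT x|M. p x)
      + (cmod c)\<^sup>2 * (LINT x|M. (cmod (g x))\<^sup>2)"
    using p by simp
  finally show ?thesis unfolding l2_norm_power2 p(2) .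
qed

text \<open>Polarization between two measure spaces: every isometry of the development is upgraded
  to an identity of inner products through this rule.\<close>

lemma l2_inner_eqI:
  assumes "f \<in> L2 M" "g \<in> L2 M" "f' \<in> L2 N" "g' \<in> L2 N"
    and "\<And>a b. l2_norm M (\<lambda>x. a * f x + b * g x) = l2_norm N (\<lambda>x. a * f' x + b * g' x)"
  shows "l2_inner M f g = l2_inner N f' g'"
proof -
  have nf: "l2_norm M f = l2_norm N f'" using assms(5)[of 1 0] by simp
  have ng: "l2_norm M g = l2_norm N g'" using assms(5)[of 0 1] by simp
  have "Re (cnj c * l2_inner M f g) = Re (cnj c * l2_inner N f' g')" for c
    using l2_norm_add_cmult[OF assms(1,2), of c] l2_norm_add_cmult[OF assms(3,4), of c]
      assms(5)[of 1 c] nf ng by simp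
  \<comment> \<open>Since \<open>Re (cnj \<i> * z) = Im z\<close>, the two instances recover the
    real and the imaginary part.\<close>
  from this[of 1] this[of \<i>] show ?thesis by (simp add: complex_eq_iff)
qed

lemma l2_inner_diff_left:
  assumes "f \<in> L2 M" "g \<in> L2 M" "h \<in> L2 M"
  shows "l2_inner M (\<lambda>x. f x - g x) h = l2_inner M f h - l2_inner M g h"
  using integrable_L2_mult(1)[OF assms(1,3)] integrable_L2_mult(1)[OF assms(2,3)]
  by (simp add: l2_inner_def left_diff_distrib)

lemma l2_inner_commute: "l2_inner M f g = cnj (l2_inner M g f)"
proof -
  have "cnj (l2_inner M g f) = (LINT x|M. cnj (g x * cnj (f x)))" unfolding l2_inner_def
    by (simp only: Bochner_Integration.integral_cnj)
  then show ?thesis by (simp add: l2_inner_def mult.commute)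
qed

lemma l2_inner_diff_right:
  assumes "f \<in> L2 M" "g \<in> L2 M" "h \<in> L2 M"
  shows "l2_inner M h (\<lambda>x. f x - g x) = l2_inner M h f - l2_inner M h g"
  unfolding l2_inner_commute[of M h] l2_inner_diff_left[OF assms] by simp

section \<open>Almost everywhere convergence, completeness and simple functions in
  \<open>L2\<close>\<close>

text \<open>The weight \<open>4^n\<close> turns the squared bound
  \<open>C\<^sup>2 * (1/16)^n\<close> into a convergent geometric series. Hence
  \<open>4^n * (cmod (d n x))\<^sup>2\<close> is summable for almost every \<open>x\<close>, so it
  eventually drops below 1.\<close>

lemma AE_eventually_small_of_fast_L2:
  assumes "\<And>n. d n \<in> L2 M" "\<And>n. l2_norm M (d n) \<le> C * (1/4)^n"
  shows "AE x in M. \<forall>\<^sub>F n in sequentially. cmod (d n x) \<le> (1/2)^n"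
proof -
  note [measurable] = L2D(1)[OF assms(1)]
  have C: "C \<ge> 0" using order_trans[OF l2_norm_nonneg assms(2)[of 0]] by simp
  have b: "(\<integral>\<^sup>+x. ennreal (4^n * (cmod (d n x))\<^sup>2) \<partial>M) \<le> ennreal (C\<^sup>2 * (1/4)^n)" for n
  proof -
    have "(\<integral>\<^sup>+x. ennreal (4^n * (cmod (d n x))\<^sup>2) \<partial>M) = ennreal (4^n) * ennreal ((l2_norm M (d n))\<^sup>2)"
      by (simp add: ennreal_mult nn_integral_cmult nn_integral_L2[OF assms(1)])
    also have "\<dots> \<le> ennreal (4^n * (C * (1/4)^n)\<^sup>2)"
      by (subst ennreal_mult[symmetric])
         (auto intro!: ennreal_leI mult_left_mono power_mono assms(2))
    also have "4^n * (C * (1/4)^n)\<^sup>2 = C\<^sup>2 * (1/4::real)^n"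
      by (simp add: power_mult_distrib power2_eq_square field_simps)
    finally show ?thesis .
  qed
  have "(\<integral>\<^sup>+x. (\<Sum>n. ennreal (4^n * (cmod (d n x))\<^sup>2)) \<partial>M)
      = (\<Sum>n. \<integral>\<^sup>+x. ennreal (4^n * (cmod (d n x))\<^sup>2) \<partial>M)"
    by (rule nn_integral_suminf) measurable
  also have "\<dots> \<le> (\<Sum>n. ennreal (C\<^sup>2 * (1/4)^n))"
    by (intro suminf_le b) auto
  also have "\<dots> < \<infinity>"
  proof -
    have "summable (\<lambda>n. C\<^sup>2 * (1/4::real)^n)" by (intro summable_mult summable_geometric) auto
    then have "(\<Sum>n. ennreal (C\<^sup>2 * (1/4)^n)) = ennreal (\<Sum>n. C\<^sup>2 * (1/4)^n)"
      by (intro suminf_ennreal2) auto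
    then show ?thesis by simp
  qed
  finally have "AE x in M. (\<Sum>n. ennreal (4^n * (cmod (d n x))\<^sup>2)) \<noteq> \<infinity>"
    by (intro nn_integral_PInf_AE) auto
  then show ?thesis
  proof eventually_elim
    case (elim x)
    then have "summable (\<lambda>n. 4^n * (cmod (d n x))\<^sup>2)"
      by (intro summable_suminf_not_top) auto
    from order_tendstoD(2)[OF summable_LIMSEQ_zero[OF this], of 1]
    have "\<forall>\<^sub>F n in sequentially. 4^n * (cmod (d n x))\<^sup>2 < 1" by simp
    then show ?case
    proof eventually_elim
      case (elim n)
      have "(2^n * cmod (d n x))\<^sup>2 = 4^n * (cmod (d n x))\<^sup>2"
        by (simp add: power_mult_distrib power_mult[symmetric] mult.commute[of n] power_mult)
      then have "(2^n * cmod (d n x))\<^sup>2 \<le> 1\<^sup>2" using elim by simp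
      then have "2^n * cmod (d n x) \<le> 1" by (rule power2_le_imp_le) auto
      then show ?case by (simp add: field_simps)
    qed
  qed
qed

lemma AE_tendsto_of_fast_L2:
  assumes "\<And>n. u n \<in> L2 M" "f \<in> L2 M" "\<And>n. l2_norm M (\<lambda>x. u n x - f x) \<le> C * (1/4)^n"
  shows "AE x in M. (\<lambda>n. u n x) \<longlonglongrightarrow> f x"
proof -
  have "AE x in M. \<forall>\<^sub>F n in sequentially. cmod (u n x - f x) \<le> (1/2)^n"
    by (rule AE_eventually_small_of_fast_L2) (use assms in auto)
  then show ?thesis
  proof eventually_elim
    case (elim x)
    have "(\<lambda>n. (1/2::real)^n) \<longlonglongrightarrow> 0" by (rule LIMSEQ_power_zero) auto
    from tendsto_0_le[OF this, of "\<lambda>n. u n x - f x" 1] elim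
    have "(\<lambda>n. u n x - f x) \<longlonglongrightarrow> 0" by simp
    then show ?case by (rule LIM_zero_cancel)
  qed
qed

text \<open>Approximating sequences can be chosen to converge geometrically, so this form of
  completeness suffices. Consecutive differences are then pointwise summable almost everywhere,
  which yields the limit without passing to a subsequence.\<close>

lemma L2_complete:
  assumes u: "\<And>n. u n \<in> L2 M"
    and C: "\<And>m n. n \<le> m \<Longrightarrow> l2_norm M (\<lambda>x. u m x - u n x) \<le> C * (1/4)^n"
  obtains f where "f \<in> L2 M" "(\<lambda>n. l2_norm M (\<lambda>x. u n x - f x)) \<longlonglongrightarrow> 0"
proof -
  note [measurable] = L2D(1)[OF u]
  define f where "f = (\<lambda>x. lim (\<lambda>n. u n x))"
  have [measurable]: "f \<in> borel_measurable M" unfolding f_def by measurable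
  have "AE x in M. \<forall>\<^sub>F n in sequentially. cmod (u (Suc n) x - u n x) \<le> (1/2)^n"
    by (rule AE_eventually_small_of_fast_L2[where C = C]) (use u C in auto)
  then have conv: "AE x in M. (\<lambda>n. u n x) \<longlonglongrightarrow> f x"
  proof eventually_elim
    case (elim x)
    have "summable (\<lambda>n. u (Suc n) x - u n x)"
      by (rule summable_comparison_test_ev[OF elim]) (rule summable_geometric, simp)
    then have "(\<lambda>n. \<Sum>k<n. u (Suc k) x - u k x) \<longlonglongrightarrow> (\<Sum>n. u (Suc n) x - u n x)"
      by (rule summable_LIMSEQ)
    then have "(\<lambda>n. (u n x - u 0 x) + u 0 x) \<longlonglongrightarrow> (\<Sum>n. u (Suc n) x - u n x) + u 0 x"
      by (intro tendsto_add tendsto_const) (simp add: sum_lessThan_telescope[of "\<lambda>k. u k x"])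
    then have "convergent (\<lambda>n. u n x)" by (auto simp: convergent_def)
    then show ?case by (simp add: f_def convergent_LIMSEQ_iff)
  qed
  \<comment> \<open>Fatou's lemma lets \<open>m\<close> tend to infinity in the Cauchy estimate, so
    the limit inherits its rate.\<close>
  have le: "(\<integral>\<^sup>+x. ennreal ((cmod (u n x - f x))\<^sup>2) \<partial>M) \<le> ennreal ((C * (1/4)^n)\<^sup>2)" for n
  proof -
    have "(\<integral>\<^sup>+x. ennreal ((cmod (u n x - f x))\<^sup>2) \<partial>M)
        = (\<integral>\<^sup>+x. liminf (\<lambda>m. ennreal ((cmod (u n x - u m x))\<^sup>2)) \<partial>M)"
    proof (intro nn_integral_cong_AE, use conv in eventually_elim)
      case (elim x)
      have "(\<lambda>m. ennreal ((cmod (u n x - u m x))\<^sup>2)) \<longlonglongrightarrow> ennreal ((cmod (u n x - f x))\<^sup>2)"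
        by (intro tendsto_ennrealI tendsto_intros elim)
      from lim_imp_Liminf[OF _ this] show ?case by simp
    qed
    also have "\<dots> \<le> liminf (\<lambda>m. \<integral>\<^sup>+x. ennreal ((cmod (u n x - u m x))\<^sup>2) \<partial>M)"
      by (rule nn_integral_liminf) measurable
    also have "\<dots> \<le> ennreal ((C * (1/4)^n)\<^sup>2)"
    proof (rule Liminf_le)
      show "\<forall>\<^sub>F m in sequentially. (\<integral>\<^sup>+x. ennreal ((cmod (u n x - u m x))\<^sup>2) \<partial>M) \<le> ennreal ((C * (1/4)^n)\<^sup>2)"
        using eventually_ge_at_top[of n]
      proof eventually_elim
        case (elim m)
        show ?case
          using C[OF elim] nn_integral_L2[OF L2_diff[OF u u], of n m]
          by (auto simp: l2_norm_minus_commute[of M "u n"] intro!: ennreal_leI power_mono)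
      qed
    qed (rule sequentially_bot)
    finally show ?thesis .
  qed
  have d: "(\<lambda>x. u n x - f x) \<in> L2 M" for n
    using le[of n] unfolding L2_iff_nn_integral by (auto simp: le_less_trans)
  have f: "f \<in> L2 M" using L2_diff[OF u[of 0] d[of 0]] by simp
  have C0: "C \<ge> 0" using order_trans[OF l2_norm_nonneg C[of 0 0]] by simp
  have bound: "l2_norm M (\<lambda>x. u n x - f x) \<le> C * (1/4)^n" for n
  proof -
    have "(l2_norm M (\<lambda>x. u n x - f x))\<^sup>2 \<le> (C * (1/4)^n)\<^sup>2"
      using le[of n] unfolding nn_integral_L2[OF d] by (simp add: ennreal_le_iff)
    then show ?thesis by (rule power2_le_imp_le) (use C0 in auto)
  qed
  have lim: "(\<lambda>n. C * (1/4::real)^n) \<longlonglongrightarrow> 0"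
    by (intro tendsto_mult_right_zero LIMSEQ_power_zero) auto
  have "(\<lambda>n. l2_norm M (\<lambda>x. u n x - f x)) \<longlonglongrightarrow> 0"
    by (rule tendsto_sandwich[OF _ _ tendsto_const lim]) (use bound in auto)
  with f show ?thesis by (rule that)
qed

text \<open>The finite measure of the nonzero level sets is what later reduces density questions to
  indicators.\<close>

lemma L2_simple_approx:
  assumes f: "f \<in> L2 M" and "e > 0"
  obtains s where "simple_function M s" "s \<in> L2 M" "integrable M s"
    "\<And>y. y \<noteq> 0 \<Longrightarrow> emeasure M {x\<in>space M. s x = y} < \<infinity>" "l2_norm M (\<lambda>x. s x - f x) < e"
proof -
  note [measurable] = L2D(1)[OF f]
  obtain F where F: "\<And>i. simple_function M (F i)"
    "\<And>x. x \<in> space M \<Longrightarrow> (\<lambda>i. F i x) \<longlonglongrightarrow> f x"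
    "\<And>i x. x \<in> space M \<Longrightarrow> dist (F i x) 0 \<le> 2 * dist (f x) 0"
    using borel_measurable_implies_sequence_metric[OF L2D(1)[OF f], of 0] by blast
  have [measurable]: "F i \<in> borel_measurable M" for i
    by (rule borel_measurable_simple_function) (rule F)
  \<comment> \<open>From \<open>cmod (F i x) \<le> 2 * cmod (f x)\<close> follows
    \<open>cmod (F i x - f x) \<le> 3 * cmod (f x)\<close>; the dominating constants 4 and 9 are the
    squares of 2 and 3.\<close>
  have FL: "F i \<in> L2 M" for i
  proof (rule L2_bound)
    show "integrable M (\<lambda>x. 4 * (cmod (f x))\<^sup>2)" using L2D(2)[OF f] by simp
    show "AE x in M. (cmod (F i x))\<^sup>2 \<le> 4 * (cmod (f x))\<^sup>2"
      using F(3) by (auto intro!: AE_I2 abs_le_square_iff[THEN iffD1, of _ "2 * _", simplified power_mult_distrib, simplified])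
  qed simp
  have "(\<lambda>i. LINT x|M. (cmod (F i x - f x))\<^sup>2) \<longlonglongrightarrow> (LINT x|M. 0)"
  proof (rule integral_dominated_convergence)
    show "integrable M (\<lambda>x. 9 * (cmod (f x))\<^sup>2)" using L2D(2)[OF f] by simp
    show "AE x in M. (\<lambda>i. (cmod (F i x - f x))\<^sup>2) \<longlonglongrightarrow> 0"
    proof (rule AE_I2)
      fix x assume "x \<in> space M"
      then have "(\<lambda>i. (cmod (F i x - f x))\<^sup>2) \<longlonglongrightarrow> (cmod (f x - f x))\<^sup>2"
        by (intro tendsto_intros F)
      then show "(\<lambda>i. (cmod (F i x - f x))\<^sup>2) \<longlonglongrightarrow> 0" by simp
    qed
    show "AE x in M. norm ((cmod (F i x - f x))\<^sup>2) \<le> 9 * (cmod (f x))\<^sup>2" for i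
    proof (rule AE_I2)
      fix x assume "x \<in> space M"
      then have "cmod (F i x - f x) \<le> 3 * cmod (f x)"
        using F(3)[of x i] norm_triangle_ineq4[of "F i x" "f x"] by simp
      then have "(cmod (F i x - f x))\<^sup>2 \<le> (3 * cmod (f x))\<^sup>2" by (intro power_mono) auto
      then show "norm ((cmod (F i x - f x))\<^sup>2) \<le> 9 * (cmod (f x))\<^sup>2" by (simp add: power_mult_distrib)
    qed
  qed auto
  then have "(\<lambda>i. l2_norm M (\<lambda>x. F i x - f x)) \<longlonglongrightarrow> sqrt (LINT x|M. 0)"
    unfolding l2_norm_def by (rule tendsto_real_sqrt)
  then have "(\<lambda>i. l2_norm M (\<lambda>x. F i x - f x)) \<longlonglongrightarrow> 0" by simp
  from order_tendstoD(2)[OF this \<open>e > 0\<close>] obtain i where i: "l2_norm M (\<lambda>x. F i x - f x) < e"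
    by (auto simp: eventually_sequentially)
  \<comment> \<open>Chebyshev's inequality on a level set. The value 0 is excluded, because its
    level set may have infinite measure.\<close>
  have fin: "emeasure M {x\<in>space M. F i x = y} < \<infinity>" if "y \<noteq> 0" for y
  proof -
    have "ennreal ((cmod y)\<^sup>2) * emeasure M {x\<in>space M. F i x = y}
        = (\<integral>\<^sup>+x. ennreal ((cmod y)\<^sup>2) * indicator {x\<in>space M. F i x = y} x \<partial>M)"
      by (subst nn_integral_cmult_indicator) auto
    also have "\<dots> \<le> (\<integral>\<^sup>+x. ennreal ((cmod (F i x))\<^sup>2) \<partial>M)"
      by (intro nn_integral_mono) (auto simp: indicator_def)
    also have "\<dots> < \<infinity>" using FL[of i] by (simp add: L2_iff_nn_integral)
    finally show ?thesis using that by (auto simp: ennreal_mult_less_top)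
  qed
  have "emeasure M {x\<in>space M. F i x \<noteq> 0} < \<infinity>"
  proof -
    have "{x\<in>space M. F i x \<noteq> 0} = (\<Union>y\<in>F i ` space M - {0}. {x\<in>space M. F i x = y})" by auto
    moreover have "emeasure M (\<Union>y\<in>F i ` space M - {0}. {x\<in>space M. F i x = y})
        \<le> (\<Sum>y\<in>F i ` space M - {0}. emeasure M {x\<in>space M. F i x = y})"
      by (intro emeasure_subadditive_finite) (use F(1)[of i] in \<open>auto simp: simple_function_def\<close>)
    moreover have "\<dots> < \<infinity>"
      using fin F(1)[of i] by (auto simp: simple_function_def intro!: ennreal_sum_less_top)
    ultimately show ?thesis by simp
  qed
  then have "Bochner_Integration.simple_bochner_integrable M (F i)"
    using F(1) by (simp add: simple_bochner_integrable.simps)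
  then have "integrable M (F i)"
    by (auto dest!: has_bochner_integral_simple_bochner_integrable simp: integrable.simps)
  from that[OF F(1) FL this fin i] show ?thesis .
qed

section \<open>The dual group\<close>

lemma is_character_char_eval: "is_character (char_eval \<xi>)"
  using char_eval by simp

lemma norm_char_eval [simp]: "cmod (char_eval \<xi> x) = 1"
  using is_character_char_eval[of \<xi>] by (simp add: is_character_def)

lemma char_eval_add: "char_eval \<xi> (x + y) = char_eval \<xi> x * char_eval \<xi> y"
  using is_character_char_eval[of \<xi>] by (simp add: is_character_def)

lemma continuous_char_eval: "continuous_on S (char_eval \<xi>)"
  using is_character_char_eval[of \<xi>] continuous_on_subset[of UNIV] by (auto simp: is_character_def)

lemma char_eval_neq_0 [simp]: "char_eval \<xi> x \<noteq> 0"
  using norm_char_eval[of \<xi> x] by (metis norm_zero zero_neq_one)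

lemma char_eval_0 [simp]: "char_eval \<xi> 0 = 1"
  using char_eval_add[of \<xi> 0 0] by simp

lemma char_eval_mult_cnj [simp]: "char_eval \<xi> x * cnj (char_eval \<xi> x) = 1"
  by (metis complex_norm_square norm_char_eval of_real_1 one_power2)

lemma char_eval_minus: "char_eval \<xi> (- x) = cnj (char_eval \<xi> x)"
proof -
  have "char_eval \<xi> x * char_eval \<xi> (- x) = char_eval \<xi> x * cnj (char_eval \<xi> x)"
    using char_eval_add[of \<xi> x "- x"] by simp
  then show ?thesis by (subst (asm) mult_left_cancel) auto
qed

section \<open>Borel sets of characters and measurability of evaluation\<close>

lemma open_dual_subbasic:
  assumes "compact K" "open U"
  shows "open {\<xi>. char_eval \<xi> ` K \<subseteq> U}"
  unfolding open_dual_def using assms by (intro generate_topology.Basis) blast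

lemma char_eval_measurable: "(\<lambda>\<xi>. char_eval \<xi> x) \<in> borel_measurable borel"
proof (rule borel_measurableI)
  fix S :: "complex set" assume "open S"
  then have "open {\<xi>. char_eval \<xi> ` {x} \<subseteq> S}" by (intro open_dual_subbasic) auto
  moreover have "(\<lambda>\<xi>. char_eval \<xi> x) -` S \<inter> space borel = {\<xi>. char_eval \<xi> ` {x} \<subseteq> S}" by auto
  ultimately show "(\<lambda>\<xi>. char_eval \<xi> x) -` S \<inter> space borel \<in> sets borel" by simp
qed

text \<open>By continuity the points of \<open>V\<close> sent outside \<open>C\<close> form an open
  set, which would meet \<open>D\<close> if it were nonempty. With a countable \<open>D\<close>, a
  condition on all of \<open>V\<close> is thus tested by countably many evaluations.\<close>

lemma char_eval_in_closed_of_dense: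
  fixes D :: "'a::{ab_group_add,topological_space} set"
  assumes "\<And>X. open X \<Longrightarrow> X \<noteq> {} \<Longrightarrow> \<exists>d\<in>D. d \<in> X" "open V" "closed C"
    and "\<forall>d\<in>D \<inter> V. char_eval \<xi> d \<in> C" "y \<in> V"
  shows "char_eval \<xi> y \<in> C"
proof (rule ccontr)
  assume "char_eval \<xi> y \<notin> C"
  moreover have "open (V \<inter> char_eval \<xi> -` (- C))"
    using assms by (intro open_Int open_vimage) (auto simp: continuous_char_eval)
  ultimately obtain d where "d \<in> D" "d \<in> V \<inter> char_eval \<xi> -` (- C)"
    using assms(1)[of "V \<inter> char_eval \<xi> -` (- C)"] \<open>y \<in> V\<close> by auto
  then show False using assms(4) by auto
qed

text \<open>Although \<open>{\<xi>. \<forall>y\<in>V. \<xi> y \<in> C}\<close> need not be open, it is a countable intersection of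
  evaluation cylinders.\<close>

lemma evaluation_cylinders_generate:
  fixes V :: "'a::{ab_group_add,second_countable_topology} set" and S :: "'a dual set set"
  assumes "sigma_algebra UNIV S" and S: "\<And>x U. open U \<Longrightarrow> {\<xi>. char_eval \<xi> x \<in> U} \<in> S"
    and V: "open V" "closed C"
  shows "{\<xi>. \<forall>y\<in>V. char_eval \<xi> y \<in> C} \<in> S"
proof -
  interpret sigma_algebra UNIV S by fact
  obtain D :: "'a set" where D: "countable D" "\<And>X. open X \<Longrightarrow> X \<noteq> {} \<Longrightarrow> \<exists>d\<in>D. d \<in> X"
    using countable_dense_setE by blast
  have "{\<xi>. \<forall>y\<in>V. char_eval \<xi> y \<in> C} = {\<xi>. \<forall>d\<in>D\<inter>V. char_eval \<xi> d \<in> C}"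
    using char_eval_in_closed_of_dense[OF D(2) V] by blast
  also have "\<dots> = UNIV - (\<Union>d\<in>D\<inter>V. {\<xi>. char_eval \<xi> d \<in> - C})" by auto
  also have "\<dots> \<in> S"
  proof (intro compl_sets countable_UN')
    show "(\<lambda>d. {\<xi>. char_eval \<xi> d \<in> - C}) ` (D \<inter> V) \<subseteq> S"
      using S[of "- C"] V(2) by (auto simp: open_Compl)
  qed (use D(1) in auto)
  finally show ?thesis .
qed

text \<open>Closed targets are chosen because they can be tested on a dense set. A small closed ball
  inside \<open>U\<close> leaves room for the closure of a basic open set around the value, so one
  countable family serves all \<open>\<xi>\<close>, \<open>x\<close> and \<open>U\<close>.\<close>

lemma dual_countable_cylinders:
  obtains \<P> :: "('a::{ab_group_add,second_countable_topology} set \<times> complex set) set"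
  where "countable \<P>" "\<And>V C. (V, C) \<in> \<P> \<Longrightarrow> open V \<and> closed C"
    and "\<And>\<xi> x U. open U \<Longrightarrow> char_eval \<xi> x \<in> U \<Longrightarrow>
      \<exists>V C. (V, C) \<in> \<P> \<and> x \<in> V \<and> C \<subseteq> U \<and> (\<forall>y\<in>V. char_eval \<xi> y \<in> C)"
proof -
  obtain A :: "'a set set" where A: "countable A" "topological_basis A"
    using ex_countable_basis by blast
  obtain B :: "complex set set" where B: "countable B" "topological_basis B"
    using ex_countable_basis by blast
  show ?thesis
  proof (rule that[of "A \<times> closure ` B"])
    show "countable (A \<times> closure ` B)" using A B by auto
    show "open V \<and> closed C" if "(V, C) \<in> A \<times> closure ` B" for V C
      using that topological_basis_open[OF A(2)] by auto
    show "\<exists>V C. (V, C) \<in> A \<times> closure ` B \<and> x \<in> V \<and> C \<subseteq> U \<and> (\<forall>y\<in>V. char_eval \<xi> y \<in> C)"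
      if U: "open U" "char_eval \<xi> x \<in> U" for \<xi> x U
    proof -
      obtain e where e: "e > 0" "cball (char_eval \<xi> x) e \<subseteq> U"
        using U open_contains_cball by blast
      obtain W where W: "W \<in> B" "char_eval \<xi> x \<in> W" "W \<subseteq> ball (char_eval \<xi> x) e"
        using topological_basisE[OF B(2), of "ball (char_eval \<xi> x) e" "char_eval \<xi> x"] e
        by (auto simp del: mem_ball)
      have "closure W \<subseteq> U"
        using closure_mono[OF W(3)] e by (simp add: closure_ball)
      moreover have "open (char_eval \<xi> -` W)"
        by (rule open_vimage) (use W topological_basis_open[OF B(2)] continuous_char_eval in auto)
      then obtain V where "V \<in> A" "x \<in> V" "V \<subseteq> char_eval \<xi> -` W"
        using topological_basisE[OF A(2), of "char_eval \<xi> -` W" x] W by auto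
      ultimately show ?thesis using W closure_subset[of W]
        by (intro exI[of _ V] exI[of _ "closure W"]) auto
    qed
  qed
qed

text \<open>The sets \<open>N F\<close> need not be open, but they form a countable network: each
  open set is the union of those it contains, and \<open>S\<close> is closed under countable
  unions.\<close>

lemma borel_dual_subset:
  fixes S :: "'a::{ab_group_add,second_countable_topology} dual set set"
  assumes S: "sigma_algebra UNIV S" and cyl: "\<And>x U. open U \<Longrightarrow> {\<xi>. char_eval \<xi> x \<in> U} \<in> S"
  shows "sets borel \<subseteq> S"
proof -
  interpret sigma_algebra UNIV S by fact
  obtain \<P> :: "('a set \<times> complex set) set"
    where P: "countable \<P>" "\<And>V C. (V, C) \<in> \<P> \<Longrightarrow> open V \<and> closed C"
    and loc: "\<And>\<xi> x U. open U \<Longrightarrow> char_eval \<xi> x \<in> U \<Longrightarrow>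
      \<exists>V C. (V, C) \<in> \<P> \<and> x \<in> V \<and> C \<subseteq> U \<and> (\<forall>y\<in>V. char_eval \<xi> y \<in> C)"
    by (rule dual_countable_cylinders) (rule that)
  have meas: "{\<xi>. \<forall>y\<in>V. char_eval \<xi> y \<in> C} \<in> S" if "(V, C) \<in> \<P>" for V C
    using evaluation_cylinders_generate[OF S cyl] P(2)[OF that] by blast
  define N where "N F = {\<xi>. \<forall>(V, C)\<in>F. \<forall>y\<in>V. char_eval \<xi> y \<in> C}" for F :: "('a set \<times> complex set) set"
  have N: "N F \<in> S" if "finite F" "F \<subseteq> \<P>" for F
    using that
  proof (induction F)
    case empty
    then show ?case by (simp add: N_def)
  next
    case (insert p F)
    obtain V C where "p = (V, C)" by force
    then have "N (insert p F) = {\<xi>. \<forall>y\<in>V. char_eval \<xi> y \<in> C} \<inter> N F" by (auto simp: N_def)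
    then show ?case using insert meas \<open>p = (V, C)\<close> by auto
  qed
  \<comment> \<open>Induction along the generation of the compact-open topology. Compactness enters
    only in the subbasic case, where finitely many cylinders are kept from a cover of
    \<open>K\<close>.\<close>
  have nbh: "\<forall>\<xi>\<in>W. \<exists>F. finite F \<and> F \<subseteq> \<P> \<and> \<xi> \<in> N F \<and> N F \<subseteq> W" if "open W" for W
    using that unfolding open_dual_def
  proof induction
    case UNIV
    show ?case by (intro ballI exI[of _ "{}"]) (auto simp: N_def)
  next
    case (Int a b)
    show ?case
    proof
      fix \<xi> assume "\<xi> \<in> a \<inter> b"
      then have "\<xi> \<in> a" "\<xi> \<in> b" by auto
      from bspec[OF Int.IH(1) this(1)] bspec[OF Int.IH(2) this(2)] obtain F G where
        "finite F" "F \<subseteq> \<P>" "\<xi> \<in> N F" "N F \<subseteq> a" "finite G" "G \<subseteq> \<P>" "\<xi> \<in> N G" "N G \<subseteq> b"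
        by (elim exE conjE)
      moreover have "N (F \<union> G) = N F \<inter> N G" by (auto simp: N_def)
      ultimately show "\<exists>F. finite F \<and> F \<subseteq> \<P> \<and> \<xi> \<in> N F \<and> N F \<subseteq> a \<inter> b"
        by (intro exI[of _ "F \<union> G"]) auto
    qed
  next
    case (UN K)
    show ?case
    proof
      fix \<xi> assume "\<xi> \<in> \<Union> K"
      then obtain W where W: "W \<in> K" "\<xi> \<in> W" by blast
      from bspec[OF UN.IH[OF W(1)] W(2)] obtain F where "finite F" "F \<subseteq> \<P>" "\<xi> \<in> N F" "N F \<subseteq> W"
        by (elim exE conjE)
      then show "\<exists>F. finite F \<and> F \<subseteq> \<P> \<and> \<xi> \<in> N F \<and> N F \<subseteq> \<Union> K"
        using W(1) by (intro exI[of _ F]) auto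
    qed
  next
    case (Basis W)
    then obtain K U where KU: "W = {\<xi>. char_eval \<xi> ` K \<subseteq> U}" "compact K" "open U" by blast
    show ?case
    proof
      fix \<xi> assume "\<xi> \<in> W"
      then have "\<forall>x\<in>K. \<exists>V C. (V, C) \<in> \<P> \<and> x \<in> V \<and> C \<subseteq> U \<and> (\<forall>y\<in>V. char_eval \<xi> y \<in> C)"
        using KU loc by (auto simp: image_subset_iff)
      then obtain v c where vc: "\<And>x. x \<in> K \<Longrightarrow> (v x, c x) \<in> \<P> \<and> x \<in> v x \<and> c x \<subseteq> U \<and> (\<forall>y\<in>v x. char_eval \<xi> y \<in> c x)"
        by metis
      have ov: "open (v x)" if "x \<in> K" for x
        using vc[OF that] P(2)[of "v x" "c x"] by simp
      have cov: "K \<subseteq> (\<Union>x\<in>K. v x)" using vc by auto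
      obtain K' where K': "K' \<subseteq> K" "finite K'" "K \<subseteq> (\<Union>x\<in>K'. v x)"
        by (rule compactE_image[OF \<open>compact K\<close> ov cov])
      have "\<eta> \<in> W" if \<eta>: "\<eta> \<in> N ((\<lambda>x. (v x, c x)) ` K')" for \<eta>
      proof -
        have "char_eval \<eta> y \<in> U" if "y \<in> K" for y
        proof -
          obtain x where "x \<in> K'" "y \<in> v x" using K'(3) \<open>y \<in> K\<close> by auto
          then show ?thesis using \<eta> K'(1) vc[of x] by (auto simp: N_def)
        qed
        then show ?thesis unfolding KU by auto
      qed
      then show "\<exists>F. finite F \<and> F \<subseteq> \<P> \<and> \<xi> \<in> N F \<and> N F \<subseteq> W"
        using K' vc by (intro exI[of _ "(\<lambda>x. (v x, c x)) ` K'"]) (auto simp: N_def)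
    qed
  qed
  have "W \<in> S" if "open W" for W
  proof -
    define \<F> where "\<F> = {F. (finite F \<and> F \<subseteq> \<P>) \<and> N F \<subseteq> W}"
    have "countable \<F>" unfolding \<F>_def
      by (rule countable_subset[OF _ countable_Collect_finite_subset[OF P(1)]]) auto
    then have "(\<Union>F\<in>\<F>. N F) \<in> S" by (intro countable_UN') (auto simp: \<F>_def N)
    moreover have "(\<Union>F\<in>\<F>. N F) = W"
    proof
      show "(\<Union>F\<in>\<F>. N F) \<subseteq> W" by (auto simp: \<F>_def)
      show "W \<subseteq> (\<Union>F\<in>\<F>. N F)"
      proof
        fix \<xi> assume "\<xi> \<in> W"
        from bspec[OF nbh[OF that] this] show "\<xi> \<in> (\<Union>F\<in>\<F>. N F)" unfolding \<F>_def by auto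
      qed
    qed
    ultimately show ?thesis by simp
  qed
  then show ?thesis
    unfolding borel_def using sets_measure_of[of "{W. open W}" UNIV] sigma_sets_subset[of "{W. open W}"] by auto
qed

text \<open>The preimage of an open set is a countable union of rectangles. This gives measurability
  for the product sigma-algebra, as Fubini's theorem requires, and not just for the Borel sets of
  the product topology.\<close>

lemma char_eval_jointly_measurable:
  "(\<lambda>(x, \<xi>). char_eval \<xi> x) \<in>
    borel_measurable (borel \<Otimes>\<^sub>M (borel :: 'a::{ab_group_add,second_countable_topology} dual measure))"
proof (rule borel_measurableI)
  fix U :: "complex set" assume U: "open U"
  obtain \<P> :: "('a set \<times> complex set) set"
    where P: "countable \<P>" "\<And>V C. (V, C) \<in> \<P> \<Longrightarrow> open V \<and> closed C"
    and loc: "\<And>\<xi> x U. open U \<Longrightarrow> char_eval \<xi> x \<in> U \<Longrightarrow>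
      \<exists>V C. (V, C) \<in> \<P> \<and> x \<in> V \<and> C \<subseteq> U \<and> (\<forall>y\<in>V. char_eval \<xi> y \<in> C)"
    by (rule dual_countable_cylinders) (rule that)
  have cyl: "{\<xi>. char_eval \<xi> x \<in> U} \<in> sets borel" if "open U" for x :: 'a and U
    using measurable_sets[OF char_eval_measurable[of x], of U] that by (simp add: vimage_def)
  have m: "{\<xi>. \<forall>y\<in>V. char_eval \<xi> y \<in> C} \<in> sets borel" if "(V, C) \<in> \<P>" for V C
    using evaluation_cylinders_generate[of "sets borel" V C] cyl P(2)[OF that]
      sets.sigma_algebra_axioms[of borel] by simp
  have "(\<lambda>(x::'a, \<xi>). char_eval \<xi> x) -` U
      = (\<Union>(V, C)\<in>{(V, C)\<in>\<P>. C \<subseteq> U}. V \<times> {\<xi>. \<forall>y\<in>V. char_eval \<xi> y \<in> C})"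
  proof
    show "(\<lambda>(x::'a, \<xi>). char_eval \<xi> x) -` U
      \<subseteq> (\<Union>(V, C)\<in>{(V, C)\<in>\<P>. C \<subseteq> U}. V \<times> {\<xi>. \<forall>y\<in>V. char_eval \<xi> y \<in> C})"
    proof safe
      fix x :: 'a and \<xi> assume "char_eval \<xi> x \<in> U"
      from loc[OF U this] show "(x, \<xi>) \<in> (\<Union>(V, C)\<in>{(V, C)\<in>\<P>. C \<subseteq> U}. V \<times> {\<xi>. \<forall>y\<in>V. char_eval \<xi> y \<in> C})"
        by auto
    qed
  qed auto
  also have "\<dots> \<in> sets (borel \<Otimes>\<^sub>M borel)"
  proof (rule sets.countable_UN')
    show "countable {(V, C)\<in>\<P>. C \<subseteq> U}" by (rule countable_subset[OF _ P(1)]) auto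
  qed (use P m in auto)
  finally show "(\<lambda>(x, \<xi>). char_eval \<xi> x) -` U \<inter> space (borel \<Otimes>\<^sub>M (borel :: 'a dual measure))
      \<in> sets (borel \<Otimes>\<^sub>M borel)"
    by (simp add: space_pair_measure)
qed

section \<open>Uniqueness of inverse Fourier transforms\<close>

text \<open>This class is stable under multiplication by polynomials in an evaluation \<open>\<xi> \<mapsto> \<xi> y\<close>, hence
  by Stone--Weierstrass on the circle by continuous functions and then by indicators of open sets of
  values; it therefore reaches all Borel sets of characters.\<close>

definition char_null :: "'a::{ab_group_add,topological_space} dual measure \<Rightarrow> ('a dual \<Rightarrow> complex)
    \<Rightarrow> ('a dual \<Rightarrow> complex) set" where
  "char_null M K = {h \<in> borel_measurable M. (\<exists>B. \<forall>\<xi>. cmod (h \<xi>) \<le> B) \<and>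
     (\<forall>x. (LINT \<xi>|M. K \<xi> * h \<xi> * char_eval \<xi> x) = 0)}"

lemma char_eval_measurable' [measurable]:
  "sets M = sets borel \<Longrightarrow> (\<lambda>\<xi>. char_eval \<xi> x) \<in> borel_measurable M"
  using char_eval_measurable by (simp cong: measurable_cong_sets)

lemma integrable_mult_bounded:
  fixes K h :: "'a \<Rightarrow> complex"
  assumes "integrable M K" "h \<in> borel_measurable M" "\<And>x. cmod (h x) \<le> B"
  shows "integrable M (\<lambda>x. K x * h x)"
proof (rule Bochner_Integration.integrable_bound)
  show "integrable M (\<lambda>x. cmod (K x) * B)" using assms(1) by simp
  have "0 \<le> B" using order_trans[OF norm_ge_zero assms(3)] .
  then show "AE x in M. norm (K x * h x) \<le> norm (cmod (K x) * B)"
    using assms(3) by (auto intro!: AE_I2 mult_left_mono simp: norm_mult abs_mult)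
qed (use assms in measurable)

lemma bounded_on_circle:
  fixes g :: "complex \<Rightarrow> real"
  assumes "continuous_on UNIV g"
  shows "\<exists>C. \<forall>z. cmod z = 1 \<longrightarrow> \<bar>g z\<bar> \<le> C"
proof -
  have "compact (g ` sphere 0 1)"
    by (intro compact_continuous_image continuous_on_subset[OF assms]) auto
  then have "bounded (g ` sphere 0 1)" by (rule compact_imp_bounded)
  then obtain C where "\<forall>z\<in>sphere 0 1. \<bar>g z\<bar> \<le> C" unfolding bounded_iff by auto
  then show ?thesis by (intro exI[of _ C]) auto
qed

context
  fixes M :: "'a::{ab_group_add,topological_space} dual measure" and K :: "'a dual \<Rightarrow> complex"
  assumes M: "sets M = sets borel" and K: "integrable M K"
begin

lemma integrable_char_mult:
  assumes "h \<in> borel_measurable M" "\<And>\<xi>. cmod (h \<xi>) \<le> B"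
  shows "integrable M (\<lambda>\<xi>. K \<xi> * h \<xi> * char_eval \<xi> x)"
  by (rule integrable_mult_bounded[OF integrable_mult_bounded[OF K assms], where B = 1])
    (use M in auto)

lemma char_nullE:
  assumes "h \<in> char_null M K"
  obtains B where "h \<in> borel_measurable M" "\<And>\<xi>. cmod (h \<xi>) \<le> B"
    "\<And>x. (LINT \<xi>|M. K \<xi> * h \<xi> * char_eval \<xi> x) = 0"
proof -
  from assms obtain B where "\<forall>\<xi>. cmod (h \<xi>) \<le> B" unfolding char_null_def by auto
  then show ?thesis using assms by (intro that[of B]) (auto simp: char_null_def)
qed

text \<open>Characters take values in the unit circle, where a continuous \<open>g\<close> is
  bounded; only the vanishing integrals remain to be supplied.\<close>

lemma char_null_mult_continuousI:
  fixes g :: "complex \<Rightarrow> real"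
  assumes h: "h \<in> char_null M K" and g: "continuous_on UNIV g"
    and z: "\<And>x. (LINT \<xi>|M. K \<xi> * (h \<xi> * of_real (g (char_eval \<xi> y))) * char_eval \<xi> x) = 0"
  shows "(\<lambda>\<xi>. h \<xi> * of_real (g (char_eval \<xi> y))) \<in> char_null M K"
proof -
  obtain B where B: "h \<in> borel_measurable M" "\<And>\<xi>. cmod (h \<xi>) \<le> B" using h by (rule char_nullE) (rule that)
  obtain C where C: "\<And>z. cmod z = 1 \<Longrightarrow> \<bar>g z\<bar> \<le> C" using bounded_on_circle[OF g] by blast
  have "cmod (h \<xi> * of_real (g (char_eval \<xi> y))) \<le> B * C" for \<xi>
    unfolding norm_mult using B(2)[of \<xi>] C[of "char_eval \<xi> y"] order_trans[OF norm_ge_zero B(2)]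
    by (intro mult_mono) auto
  moreover have "(\<lambda>\<xi>. g (char_eval \<xi> y)) \<in> borel_measurable M"
    by (rule borel_measurable_continuous_on[OF g char_eval_measurable'[OF M]])
  ultimately show ?thesis unfolding char_null_def using B(1) z by auto
qed

text \<open>Multiplication by \<open>char_eval \<xi> y\<close> or by its conjugate only moves the
  free point \<open>x\<close> to \<open>x + y\<close> or \<open>x - y\<close>. This is why
  \<open>char_null\<close> asks for vanishing at every \<open>x\<close>.\<close>

lemma char_null_polynomial:
  assumes "real_polynomial_function g" "h \<in> char_null M K"
  shows "(\<lambda>\<xi>. h \<xi> * of_real (g (char_eval \<xi> y))) \<in> char_null M K"
  using assms
proof (induction arbitrary: h)
  case (linear f)
  obtain B where B: "h \<in> borel_measurable M" "\<And>\<xi>. cmod (h \<xi>) \<le> B"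
    "\<And>x. (LINT \<xi>|M. K \<xi> * h \<xi> * char_eval \<xi> x) = 0" using linear.prems by (rule char_nullE) (rule that)
  show ?case
  proof (rule char_null_mult_continuousI[OF linear.prems])
    show "continuous_on UNIV f" by (rule linear_continuous_on[OF linear.hyps])
    fix x
    \<comment> \<open>The coefficients of \<open>z\<close> and \<open>cnj z\<close> in the
      real-linear functional \<open>f\<close>, read off from its values at 1 and
      \<open>\<i>\<close>.\<close>
    define a b where "a = (of_real (f 1) - \<i> * of_real (f \<i>)) / 2"
      and "b = (of_real (f 1) + \<i> * of_real (f \<i>)) / 2"
    have f: "complex_of_real (f z) = a * z + b * cnj z" for z
    proof -
      have "z = Re z *\<^sub>R 1 + Im z *\<^sub>R \<i>" by (simp add: complex_eq_iff)
      then have "f z = Re z * f 1 + Im z * f \<i>"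
        using linear_add[OF bounded_linear.linear[OF linear.hyps], of "Re z *\<^sub>R 1" "Im z *\<^sub>R \<i>"]
          linear_scale[OF bounded_linear.linear[OF linear.hyps]] by simp
      then show ?thesis by (simp add: a_def b_def complex_eq_iff field_simps)
    qed
    have "(LINT \<xi>|M. K \<xi> * (h \<xi> * of_real (f (char_eval \<xi> y))) * char_eval \<xi> x)
      = (LINT \<xi>|M. a * (K \<xi> * h \<xi> * char_eval \<xi> (x + y)) + b * (K \<xi> * h \<xi> * char_eval \<xi> (x + - y)))"
      by (intro Bochner_Integration.integral_cong) (auto simp: f char_eval_add char_eval_minus algebra_simps simp del: add_uminus_conv_diff)
    also have "\<dots> = a * (LINT \<xi>|M. K \<xi> * h \<xi> * char_eval \<xi> (x + y)) + b * (LINT \<xi>|M. K \<xi> * h \<xi> * char_eval \<xi> (x + - y))"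
      using integrable_char_mult[OF B(1,2)] by (simp del: add_uminus_conv_diff)
    finally show "(LINT \<xi>|M. K \<xi> * (h \<xi> * of_real (f (char_eval \<xi> y))) * char_eval \<xi> x) = 0"
      using B(3) by simp
  qed
next
  case (const c)
  obtain B where B: "h \<in> borel_measurable M" "\<And>\<xi>. cmod (h \<xi>) \<le> B"
    "\<And>x. (LINT \<xi>|M. K \<xi> * h \<xi> * char_eval \<xi> x) = 0" using const.prems by (rule char_nullE) (rule that)
  show ?case
  proof (rule char_null_mult_continuousI[OF const.prems])
    fix x
    have "(LINT \<xi>|M. K \<xi> * (h \<xi> * of_real c) * char_eval \<xi> x) = (LINT \<xi>|M. of_real c * (K \<xi> * h \<xi> * char_eval \<xi> x))"
      by (simp add: algebra_simps)
    then show "(LINT \<xi>|M. K \<xi> * (h \<xi> * of_real c) * char_eval \<xi> x) = 0" using B(3) by simp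
  qed simp
next
  case (add f g)
  from add.IH(1)[OF add.prems] obtain B where B: "(\<lambda>\<xi>. h \<xi> * of_real (f (char_eval \<xi> y))) \<in> borel_measurable M"
    "\<And>\<xi>. cmod (h \<xi> * of_real (f (char_eval \<xi> y))) \<le> B"
    "\<And>x. (LINT \<xi>|M. K \<xi> * (h \<xi> * of_real (f (char_eval \<xi> y))) * char_eval \<xi> x) = 0"
    by (rule char_nullE) (rule that)
  from add.IH(2)[OF add.prems] obtain C where C: "(\<lambda>\<xi>. h \<xi> * of_real (g (char_eval \<xi> y))) \<in> borel_measurable M"
    "\<And>\<xi>. cmod (h \<xi> * of_real (g (char_eval \<xi> y))) \<le> C"
    "\<And>x. (LINT \<xi>|M. K \<xi> * (h \<xi> * of_real (g (char_eval \<xi> y))) * char_eval \<xi> x) = 0"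
    by (rule char_nullE) (rule that)
  show ?case
  proof (rule char_null_mult_continuousI[OF add.prems])
    show "continuous_on UNIV (\<lambda>x. f x + g x)"
      by (intro continuous_at_imp_continuous_on ballI continuous_real_polymonial_function
          real_polynomial_function.intros(3) add.hyps)
    fix x
    have "(LINT \<xi>|M. K \<xi> * (h \<xi> * of_real (f (char_eval \<xi> y) + g (char_eval \<xi> y))) * char_eval \<xi> x)
      = (LINT \<xi>|M. K \<xi> * (h \<xi> * of_real (f (char_eval \<xi> y))) * char_eval \<xi> x
          + K \<xi> * (h \<xi> * of_real (g (char_eval \<xi> y))) * char_eval \<xi> x)"
      by (simp add: algebra_simps)
    then show "(LINT \<xi>|M. K \<xi> * (h \<xi> * of_real (f (char_eval \<xi> y) + g (char_eval \<xi> y))) * char_eval \<xi> x) = 0"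
      using B(3) C(3) integrable_char_mult[OF B(1,2)] integrable_char_mult[OF C(1,2)] by simp
  qed
next
  case (mult f g)
  \<comment> \<open>The factor coming from \<open>f\<close> is absorbed into \<open>h\<close>, which
    is why the induction leaves \<open>h\<close> arbitrary.\<close>
  from mult.IH(2)[OF mult.IH(1)[OF mult.prems]] show ?case by (simp add: mult.assoc)
qed

text \<open>A polynomial within \<open>e\<close> of \<open>g\<close> on the circle contributes the
  integral 0, and the error is at most \<open>e\<close> times the bound of \<open>h\<close> times
  the integral of \<open>cmod (K \<xi>)\<close>.\<close>

lemma char_null_continuous:
  fixes g :: "complex \<Rightarrow> real"
  assumes h: "h \<in> char_null M K" and g: "continuous_on UNIV g"
  shows "(\<lambda>\<xi>. h \<xi> * of_real (g (char_eval \<xi> y))) \<in> char_null M K"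
proof (rule char_null_mult_continuousI[OF h g])
  obtain B where B: "h \<in> borel_measurable M" "\<And>\<xi>. cmod (h \<xi>) \<le> B" using h by (rule char_nullE) (rule that)
  have B0: "0 \<le> B" using order_trans[OF norm_ge_zero B(2)] .
  fix x
  let ?I = "\<lambda>g. LINT \<xi>|M. K \<xi> * (h \<xi> * of_real (g (char_eval \<xi> y))) * char_eval \<xi> x"
  have gb: "integrable M (\<lambda>\<xi>. K \<xi> * (h \<xi> * of_real (g (char_eval \<xi> y))) * char_eval \<xi> x)"
    if g: "continuous_on UNIV g" for g
  proof -
    obtain C where C: "\<And>z. cmod z = 1 \<Longrightarrow> \<bar>g z\<bar> \<le> C" using bounded_on_circle[OF g] by blast
    have "cmod (h \<xi> * of_real (g (char_eval \<xi> y))) \<le> B * C" for \<xi>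
      unfolding norm_mult using B(2)[of \<xi>] C[of "char_eval \<xi> y"] B0
      by (intro mult_mono) auto
    moreover have "(\<lambda>\<xi>. g (char_eval \<xi> y)) \<in> borel_measurable M"
      by (rule borel_measurable_continuous_on[OF g char_eval_measurable'[OF M]])
    ultimately show ?thesis using B(1) by (intro integrable_char_mult[where B = "B * C"]) auto
  qed
  define c where "c = B * (LINT \<xi>|M. cmod (K \<xi>))"
  have "c \<ge> 0" using B0 by (simp add: c_def)
  have "cmod (?I g) \<le> e * c" if "e > 0" for e
  proof -
    obtain p where p: "real_polynomial_function p" "\<And>z. z \<in> sphere 0 1 \<Longrightarrow> \<bar>g z - p z\<bar> < e"
      using Stone_Weierstrass_real_polynomial_function[of "sphere 0 1" g e] \<open>e > 0\<close>
        continuous_on_subset[OF g] by auto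
    have "?I p = 0" using char_null_polynomial[OF p(1) h] by (auto elim: char_nullE)
    have pc: "continuous_on UNIV p"
      by (intro continuous_at_imp_continuous_on ballI continuous_real_polymonial_function p)
    have "?I g = ?I g - ?I p" using \<open>?I p = 0\<close> by simp
    also have "\<dots> = (LINT \<xi>|M. K \<xi> * (h \<xi> * of_real (g (char_eval \<xi> y))) * char_eval \<xi> x
        - K \<xi> * (h \<xi> * of_real (p (char_eval \<xi> y))) * char_eval \<xi> x)"
      using gb[OF g] gb[OF pc] by simp
    also have "cmod \<dots> \<le> (LINT \<xi>|M. e * (B * cmod (K \<xi>)))"
    proof (rule order_trans[OF integral_norm_bound], rule integral_mono)
      fix \<xi>
      have "cmod (K \<xi> * (h \<xi> * of_real (g (char_eval \<xi> y))) * char_eval \<xi> x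
          - K \<xi> * (h \<xi> * of_real (p (char_eval \<xi> y))) * char_eval \<xi> x)
        = cmod (K \<xi> * h \<xi> * of_real (g (char_eval \<xi> y) - p (char_eval \<xi> y)) * char_eval \<xi> x)"
        by (simp add: algebra_simps)
      also have "\<dots> = cmod (K \<xi>) * (cmod (h \<xi>) * \<bar>g (char_eval \<xi> y) - p (char_eval \<xi> y)\<bar>)"
        by (simp only: norm_mult norm_of_real norm_char_eval mult.assoc mult_1_right)
      also have "\<dots> \<le> cmod (K \<xi>) * (B * e)"
        using B(2)[of \<xi>] B0 p(2)[of "char_eval \<xi> y"] by (intro mult_left_mono mult_mono) auto
      finally show "cmod (K \<xi> * (h \<xi> * of_real (g (char_eval \<xi> y))) * char_eval \<xi> x
          - K \<xi> * (h \<xi> * of_real (p (char_eval \<xi> y))) * char_eval \<xi> x) \<le> e * (B * cmod (K \<xi>))"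
        by (simp add: algebra_simps)
    qed (use gb[OF g] gb[OF pc] K in auto)
    finally show ?thesis by (simp add: c_def)
  qed
  note * = this
  have "cmod (?I g) \<le> e" if "e > 0" for e
  proof -
    \<comment> \<open>The summand 1 keeps the divisor positive when \<open>c = 0\<close>.\<close>
    have "cmod (?I g) \<le> e / (c + 1) * c" using \<open>c \<ge> 0\<close> that by (intro *) auto
    also have "\<dots> \<le> e" using \<open>c \<ge> 0\<close> that by (simp add: field_simps)
    finally show ?thesis .
  qed
  then have "cmod (?I g) \<le> 0" by (rule field_le_epsilon) simp
  then show "?I g = 0" by simp
qed

text \<open>The continuous cut-offs \<open>min 1 (n * infdist z (- U))\<close> converge pointwise to
  the indicator of \<open>U\<close>, and \<open>B * cmod (K \<xi>)\<close> dominates the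
  integrands.\<close>

lemma char_null_open:
  assumes h: "h \<in> char_null M K" and U: "open U"
  shows "(\<lambda>\<xi>. h \<xi> * indicator {\<xi>. char_eval \<xi> y \<in> U} \<xi>) \<in> char_null M K"
\<comment> \<open>The distance \<open>infdist\<close> to the empty set is 0 by convention, so for
  \<open>U = UNIV\<close> the cut-offs would vanish identically; this case is settled
  separately.\<close>
proof (cases "U = UNIV")
  case True
  then show ?thesis using h by simp
next
  case False
  obtain B where B: "h \<in> borel_measurable M" "\<And>\<xi>. cmod (h \<xi>) \<le> B" using h by (rule char_nullE) (rule that)
  note [measurable] = B(1) char_eval_measurable'[OF M]
  have KM [measurable]: "K \<in> borel_measurable M" using K by simp
  have B0: "0 \<le> B" using order_trans[OF norm_ge_zero B(2)] .
  define g where "g n z = min 1 (real n * infdist z (- U))" for n and z :: complex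
  have g: "continuous_on UNIV (g n)" for n unfolding g_def by (intro continuous_intros)
  have gm [measurable]: "(\<lambda>\<xi>. g n (char_eval \<xi> y)) \<in> borel_measurable M" for n
    by (rule borel_measurable_continuous_on[OF g char_eval_measurable'[OF M]])
  have g01: "0 \<le> g n z" "g n z \<le> 1" for n z by (auto simp: g_def infdist_nonneg)
  have lim: "(\<lambda>n. g n z) \<longlonglongrightarrow> indicator U z" for z
  proof (cases "z \<in> U")
    case True
    then have "0 < infdist z (- U)"
      using in_closed_iff_infdist_zero[of "- U" z] U False infdist_nonneg[of z "- U"] by (auto simp: closed_def less_le)
    then obtain N where "1 < real N * infdist z (- U)" using reals_Archimedean3 by blast
    then have "\<forall>n\<ge>N. g n z = 1"
      unfolding g_def using infdist_nonneg[of z "- U"]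
      by (auto simp: min_def intro!: antisym intro: order_trans[OF less_imp_le mult_right_mono])
    then show ?thesis using True by (auto intro!: tendsto_eventually exI[of _ N] simp: eventually_sequentially)
  next
    case False
    then show ?thesis by (simp add: g_def)
  qed
  have Um: "{\<xi>. char_eval \<xi> y \<in> U} \<in> sets M"
    using measurable_sets[OF char_eval_measurable[of y], of U] U M by (simp add: vimage_def)
  have "(LINT \<xi>|M. K \<xi> * (h \<xi> * indicator {\<xi>. char_eval \<xi> y \<in> U} \<xi>) * char_eval \<xi> x) = 0" for x
  proof -
    have "(\<lambda>n. LINT \<xi>|M. K \<xi> * (h \<xi> * of_real (g n (char_eval \<xi> y))) * char_eval \<xi> x)
      \<longlonglongrightarrow> (LINT \<xi>|M. K \<xi> * (h \<xi> * indicator {\<xi>. char_eval \<xi> y \<in> U} \<xi>) * char_eval \<xi> x)"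
    proof (rule integral_dominated_convergence[where w = "\<lambda>\<xi>. B * cmod (K \<xi>)"])
      show "AE \<xi> in M. (\<lambda>n. K \<xi> * (h \<xi> * of_real (g n (char_eval \<xi> y))) * char_eval \<xi> x)
          \<longlonglongrightarrow> K \<xi> * (h \<xi> * indicator {\<xi>. char_eval \<xi> y \<in> U} \<xi>) * char_eval \<xi> x"
      proof (rule AE_I2)
        fix \<xi>
        have "(\<lambda>n. K \<xi> * (h \<xi> * of_real (g n (char_eval \<xi> y))) * char_eval \<xi> x)
          \<longlonglongrightarrow> K \<xi> * (h \<xi> * of_real (indicator U (char_eval \<xi> y))) * char_eval \<xi> x"
          by (intro tendsto_intros lim)
        then show "(\<lambda>n. K \<xi> * (h \<xi> * of_real (g n (char_eval \<xi> y))) * char_eval \<xi> x)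
          \<longlonglongrightarrow> K \<xi> * (h \<xi> * indicator {\<xi>. char_eval \<xi> y \<in> U} \<xi>) * char_eval \<xi> x"
          by (cases "char_eval \<xi> y \<in> U") simp_all
      qed
      show "AE \<xi> in M. norm (K \<xi> * (h \<xi> * of_real (g n (char_eval \<xi> y))) * char_eval \<xi> x) \<le> B * cmod (K \<xi>)" for n
      proof (rule AE_I2)
        fix \<xi>
        have "norm (K \<xi> * (h \<xi> * of_real (g n (char_eval \<xi> y))) * char_eval \<xi> x)
            = cmod (K \<xi>) * (cmod (h \<xi>) * g n (char_eval \<xi> y))"
          using g01(1)[of n "char_eval \<xi> y"] by (simp add: norm_mult)
        also have "\<dots> \<le> cmod (K \<xi>) * (B * 1)"
          using B(2)[of \<xi>] B0 g01[of n "char_eval \<xi> y"] by (intro mult_left_mono mult_mono) auto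
        finally show "norm (K \<xi> * (h \<xi> * of_real (g n (char_eval \<xi> y))) * char_eval \<xi> x) \<le> B * cmod (K \<xi>)"
          by (simp add: mult.commute)
      qed
    qed (use K Um in \<open>auto intro!: measurable\<close>)
    moreover have "(LINT \<xi>|M. K \<xi> * (h \<xi> * of_real (g n (char_eval \<xi> y))) * char_eval \<xi> x) = 0" for n
      using char_null_continuous[OF h g] by (rule char_nullE)
    ultimately show ?thesis by (simp add: LIMSEQ_const_iff)
  qed
  moreover have "cmod (h \<xi> * indicator {\<xi>. char_eval \<xi> y \<in> U} \<xi>) \<le> B" for \<xi>
    using B(2)[of \<xi>] B0 by (auto simp: indicator_def)
  moreover have "(\<lambda>\<xi>. h \<xi> * indicator {\<xi>. char_eval \<xi> y \<in> U} \<xi>) \<in> borel_measurable M"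
    using B(1) Um by measurable
  ultimately show ?thesis unfolding char_null_def by blast
qed

text \<open>Induction on the number of conditions: the indicator already obtained plays the part of
  \<open>h\<close> in \<open>char_null_open\<close>.\<close>

lemma char_null_cylinder:
  assumes "(\<lambda>_. 1) \<in> char_null M K" "finite F" "\<And>x U. (x, U) \<in> F \<Longrightarrow> open U"
  shows "indicator {\<xi>. \<forall>(x, U)\<in>F. char_eval \<xi> x \<in> U} \<in> char_null M K"
  using assms(2,3)
proof (induction F)
  case empty
  then show ?case using assms(1) by (simp add: indicator_def[abs_def])
next
  case (insert p F)
  obtain y U where p: "p = (y, U)" by force
  have "indicator {\<xi>. \<forall>(x, U)\<in>F. char_eval \<xi> x \<in> U} \<in> char_null M K"
    using insert by auto
  from char_null_open[OF this, of U y]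
  have "(\<lambda>\<xi>. indicator {\<xi>. \<forall>(x, U)\<in>F. char_eval \<xi> x \<in> U} \<xi> * indicator {\<xi>. char_eval \<xi> y \<in> U} \<xi>) \<in> char_null M K"
    using insert.prems p by auto
  moreover have "(\<lambda>\<xi>. indicator {\<xi>. \<forall>(x, U)\<in>F. char_eval \<xi> x \<in> U} \<xi> * indicator {\<xi>. char_eval \<xi> y \<in> U} \<xi>)
    = (indicator {\<xi>. \<forall>(x, U)\<in>insert p F. char_eval \<xi> x \<in> U} :: 'a dual \<Rightarrow> complex)"
    by (auto simp: p indicator_def fun_eq_iff)
  ultimately show ?case by simp
qed

end

text \<open>Testing on the set where the function is positive leaves a nonnegative integrand with
  integral 0; this is applied to \<open>K\<close> and to \<open>- K\<close>.\<close>

lemma AE_zero_of_integral_indicator_zero: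
  fixes K :: "'a \<Rightarrow> real"
  assumes K: "integrable M K" and z: "\<And>A. A \<in> sets M \<Longrightarrow> (LINT x|M. K x * indicator A x) = 0"
  shows "AE x in M. K x = 0"
proof -
  have *: "AE x in M. L x \<le> 0"
    if L: "integrable M L" and z: "\<And>A. A \<in> sets M \<Longrightarrow> (LINT x|M. L x * indicator A x) = 0" for L :: "'a \<Rightarrow> real"
  proof -
    define A where "A = {x\<in>space M. 0 < L x}"
    have A: "A \<in> sets M" using L unfolding A_def by measurable
    have int: "integrable M (\<lambda>x. L x * indicator A x)"
      using integrable_mult_indicator[OF A L] by (simp add: mult.commute)
    have "AE x in M. L x * indicator A x = 0"
      using z[OF A] by (subst (asm) integral_nonneg_eq_0_iff_AE[OF int]) (auto simp: A_def indicator_def)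
    then show ?thesis using AE_space by eventually_elim (auto simp: A_def indicator_def split: if_splits)
  qed
  have "AE x in M. K x \<le> 0" by (rule *[OF K z])
  moreover have "AE x in M. - K x \<le> 0" by (rule *) (use K z in auto)
  ultimately show ?thesis by eventually_elim auto
qed

text \<open>Finite cylinders are closed under intersection, generate the Borel sets and have
  indicators in \<open>char_null\<close>. A Dynkin argument carries the vanishing of the integral of
  \<open>K\<close> from them to every Borel set.\<close>

theorem inverse_fourier_unique:
  fixes M :: "'a::{ab_group_add,second_countable_topology} dual measure"
  assumes M: "sets M = sets borel" and K: "integrable M K"
    and zero: "\<And>x. (LINT \<xi>|M. K \<xi> * char_eval \<xi> x) = 0"
  shows "AE \<xi> in M. K \<xi> = 0"
proof -
  have one: "(\<lambda>_. 1) \<in> char_null M K" unfolding char_null_def using zero by auto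
  have sp: "space M = UNIV" using sets_eq_imp_space_eq[OF M] by simp
  define G where "G = {{\<xi> :: 'a dual. \<forall>(x, U)\<in>F. char_eval \<xi> x \<in> U} | F. finite F \<and> (\<forall>(x, U)\<in>F. open U)}"
  have "Int_stable G"
  proof (rule Int_stableI)
    fix a b assume "a \<in> G" "b \<in> G"
    then obtain E F where "finite E" "\<forall>(x, U)\<in>E. open U" "a = {\<xi>. \<forall>(x, U)\<in>E. char_eval \<xi> x \<in> U}"
      "finite F" "\<forall>(x, U)\<in>F. open U" "b = {\<xi>. \<forall>(x, U)\<in>F. char_eval \<xi> x \<in> U}" unfolding G_def by blast
    then show "a \<inter> b \<in> G" unfolding G_def by (intro CollectI exI[of _ "E \<union> F"]) auto
  qed
  have sigma: "sigma_algebra UNIV (sigma_sets UNIV G)" by (rule sigma_algebra_sigma_sets) simp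
  have "{\<xi>. char_eval \<xi> x \<in> U} \<in> sigma_sets UNIV G" if "open U" for x :: 'a and U
    using that unfolding G_def by (intro sigma_sets.Basic CollectI exI[of _ "{(x, U)}"]) auto
  from borel_dual_subset[OF sigma this]
  have sub: "sets M \<subseteq> sigma_sets UNIV G" unfolding M .
  have G: "A \<in> sets M" if "A \<in> G" for A
  proof -
    obtain F where F: "finite F" "\<forall>(x, U)\<in>F. open U" and A: "A = {\<xi>. \<forall>(x, U)\<in>F. char_eval \<xi> x \<in> U}"
      using \<open>A \<in> G\<close> unfolding G_def by blast
    have "A = space M \<inter> (\<Inter>(x, U)\<in>F. {\<xi>. char_eval \<xi> x \<in> U})" unfolding A sp by auto
    moreover have "{\<xi>. char_eval \<xi> x \<in> U} \<in> sets M" if "open U" for x :: 'a and U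
      using measurable_sets[OF char_eval_measurable[of x], of U] M that by (simp add: vimage_def)
    then have "(\<Inter>(x, U)\<in>F. {\<xi>. char_eval \<xi> x \<in> U}) \<in> sets M" if "F \<noteq> {}"
      using F that by (intro sets.finite_INT) auto
    ultimately show ?thesis by (cases "F = {}") auto
  qed
  have "sigma_sets (space M) G \<subseteq> sets M" by (rule sets.sigma_sets_subset) (use G in auto)
  then have GM: "sigma_sets UNIV G \<subseteq> sets M" unfolding sp .
  have int: "integrable M (\<lambda>\<xi>. K \<xi> * indicator A \<xi>)" if "A \<in> sets M" for A
    by (rule integrable_mult_bounded[OF K, where B = 1]) (use that in \<open>auto simp: indicator_def\<close>)
  have z: "(LINT \<xi>|M. K \<xi> * indicator A \<xi>) = 0" if "A \<in> sets M" for A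
  proof -
    have "G \<subseteq> Pow UNIV" "A \<in> sigma_sets UNIV G" using that sub by auto
    with \<open>Int_stable G\<close> show ?thesis
    proof (induction rule: sigma_sets_induct_disjoint)
      case (basic A)
      then obtain F where F: "finite F" "\<forall>(x, U)\<in>F. open U" and A: "A = {\<xi>. \<forall>(x, U)\<in>F. char_eval \<xi> x \<in> U}"
        unfolding G_def by blast
      have "indicator A \<in> char_null M K" unfolding A
        by (rule char_null_cylinder[OF M K one F(1)]) (use F(2) in auto)
      \<comment> \<open>Every character equals 1 at the point 0, so the evaluation factor
        disappears.\<close>
      then have "(LINT \<xi>|M. K \<xi> * indicator A \<xi> * char_eval \<xi> 0) = 0" unfolding char_null_def by blast
      then show ?case by simp
    next
      case empty
      show ?case by simp
    next
      case (compl A)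
      then have A: "A \<in> sets M" using GM by auto
      have "(LINT \<xi>|M. K \<xi> * indicator (UNIV - A) \<xi>) = (LINT \<xi>|M. K \<xi> - K \<xi> * indicator A \<xi>)"
        by (intro Bochner_Integration.integral_cong) (auto simp: indicator_def)
      \<comment> \<open>The hypothesis at the point 0 says that the total integral of
        \<open>K\<close> vanishes, which gives closure under complements.\<close>
      also have "\<dots> = 0" using compl(2) int[OF A] K zero[of 0] by simp
      finally show ?case .
    next
      case (union A)
      then have A: "A i \<in> sets M" for i using GM by auto
      have lim: "(\<lambda>n. LINT \<xi>|M. K \<xi> * indicator (\<Union>i<n. A i) \<xi>) \<longlonglongrightarrow> (LINT \<xi>|M. K \<xi> * indicator (\<Union>i. A i) \<xi>)"
      proof (rule integral_dominated_convergence[where w = "\<lambda>\<xi>. cmod (K \<xi>)"])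
        show "AE \<xi> in M. (\<lambda>n. K \<xi> * indicator (\<Union>i<n. A i) \<xi>) \<longlonglongrightarrow> K \<xi> * indicator (\<Union>i. A i) \<xi>"
          by (intro AE_I2 tendsto_mult tendsto_const LIMSEQ_indicator_UN)
      qed (use K A in \<open>auto simp: indicator_def\<close>)
      have "(LINT \<xi>|M. K \<xi> * indicator (\<Union>i<n. A i) \<xi>) = 0" for n
      proof -
        have "(LINT \<xi>|M. K \<xi> * indicator (\<Union>i<n. A i) \<xi>) = (LINT \<xi>|M. (\<Sum>i<n. K \<xi> * indicator (A i) \<xi>))"
          using union(1) by (subst indicator_UN_disjoint) (auto simp: sum_distrib_left disjoint_family_on_def)
        also have "\<dots> = (\<Sum>i<n. LINT \<xi>|M. K \<xi> * indicator (A i) \<xi>)"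
          by (rule Bochner_Integration.integral_sum) (rule int[OF A])
        finally show ?thesis using union(3) by simp
      qed
      with lim show ?case by (simp add: LIMSEQ_const_iff)
    qed
  qed
  have "(LINT \<xi>|M. Re (K \<xi>) * indicator A \<xi>) = 0" "(LINT \<xi>|M. Im (K \<xi>) * indicator A \<xi>) = 0" if "A \<in> sets M" for A
  proof -
    have "(LINT \<xi>|M. Re (K \<xi>) * indicator A \<xi>) = (LINT \<xi>|M. Re (K \<xi> * indicator A \<xi>))"
      by (intro Bochner_Integration.integral_cong) (auto simp: indicator_def)
    then show "(LINT \<xi>|M. Re (K \<xi>) * indicator A \<xi>) = 0"
      using z[OF that] integral_Re[OF int[OF that]] by simp
    have "(LINT \<xi>|M. Im (K \<xi>) * indicator A \<xi>) = (LINT \<xi>|M. Im (K \<xi> * indicator A \<xi>))"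
      by (intro Bochner_Integration.integral_cong) (auto simp: indicator_def)
    then show "(LINT \<xi>|M. Im (K \<xi>) * indicator A \<xi>) = 0"
      using z[OF that] integral_Im[OF int[OF that]] by simp
  qed
  then have "AE \<xi> in M. Re (K \<xi>) = 0" "AE \<xi> in M. Im (K \<xi>) = 0"
    using AE_zero_of_integral_indicator_zero[of M "\<lambda>\<xi>. Re (K \<xi>)"] AE_zero_of_integral_indicator_zero[of M "\<lambda>\<xi>. Im (K \<xi>)"] K
    by auto
  then show ?thesis by eventually_elim (simp add: complex_eq_iff)
qed

section \<open>The Plancherel transform\<close>

lemma radon_measure_compact_finite:
  assumes "radon_measure M" "compact K" "closed K"
  shows "emeasure M K < \<infinity>"
proof -
  have "\<forall>K. compact K \<and> closed K \<longrightarrow> emeasure M K < \<infinity>"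
    using assms(1) unfolding radon_measure_def by (elim conjE)
  then show ?thesis using assms by simp
qed

lemma radon_measure_outer_regular:
  assumes "radon_measure M" "B \<in> sets M"
  shows "emeasure M B = (INF U\<in>{U. open U \<and> B \<subseteq> U}. emeasure M U)"
proof -
  have s: "sets M = sets borel" using assms(1) unfolding radon_measure_def by (rule conjunct1)
  have out: "\<forall>B\<in>sets borel. emeasure M B = (INF U\<in>{U. open U \<and> B \<subseteq> U}. emeasure M U)"
    using assms(1) unfolding radon_measure_def by (elim conjE)
  from assms(2) have "B \<in> sets borel" by (simp only: s)
  from bspec[OF out this] show ?thesis .
qed

locale plancherel_pair =
  fixes \<mu> :: "'a::{topological_ab_group_add,t2_space,second_countable_topology} measure"
    and \<mu>d :: "'a dual measure"
  assumes locally_compact: "locally_compact_space (euclidean :: 'a topology)"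
    and haar: "haar_measure \<mu>"
    and haar_dual: "haar_measure \<mu>d"
    and plancherel: "plancherel_normalized \<mu> \<mu>d"
begin

lemma sets_mu [measurable_cong, simp]: "sets \<mu> = sets borel"
  using haar by (simp add: haar_measure_def radon_measure_def)

lemma sets_mud [measurable_cong, simp]: "sets \<mu>d = sets borel"
  using haar_dual by (simp add: haar_measure_def radon_measure_def)

lemma space_mu [simp]: "space \<mu> = UNIV"
  using sets_eq_imp_space_eq[OF sets_mu] by simp

lemma space_mud [simp]: "space \<mu>d = UNIV"
  using sets_eq_imp_space_eq[OF sets_mud] by simp

lemma char_eval_measurable_mu [measurable]: "char_eval \<xi> \<in> borel_measurable \<mu>"
proof -
  have "char_eval \<xi> \<in> borel_measurable borel"
    by (intro borel_measurable_continuous_onI continuous_char_eval)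
  then show ?thesis by (simp cong: measurable_cong_sets)
qed

section \<open>Basic open sets of finite measure and sigma-finiteness of both Haar measures\<close>

text \<open>Each point has a neighbourhood inside a compact set, which has finite measure, so the
  basic sets of finite measure still form a basis. They supply the test functions
  throughout.\<close>

lemma finite_measure_basis:
  obtains \<V> :: "'a set set" where "countable \<V>"
    "\<And>V. V \<in> \<V> \<Longrightarrow> open V \<and> emeasure \<mu> V < \<infinity>"
    "\<And>x U. open U \<Longrightarrow> x \<in> U \<Longrightarrow> \<exists>V\<in>\<V>. x \<in> V \<and> V \<subseteq> U"
proof -
  obtain A :: "'a set set" where A: "countable A" "topological_basis A"
    using ex_countable_basis by blast
  have loc: "\<exists>V\<in>{V\<in>A. emeasure \<mu> V < \<infinity>}. x \<in> V \<and> V \<subseteq> U" if "open U" "x \<in> U" for x U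
  proof -
    have "\<forall>x::'a. \<exists>W. open W \<and> (\<exists>K. compact K \<and> x \<in> W \<and> W \<subseteq> K)"
      using locally_compact by (simp add: locally_compact_space_def)
    from spec[OF this, of x] obtain W K where WK: "open W" "compact K" "x \<in> W" "W \<subseteq> K"
      by (elim exE conjE)
    have "open (U \<inter> W)" "x \<in> U \<inter> W" using that WK by auto
    then obtain V where V: "V \<in> A" "x \<in> V" "V \<subseteq> U \<inter> W" by (rule topological_basisE[OF A(2)])
    have K: "K \<in> sets \<mu>" using WK(2) by (simp add: borel_closed compact_imp_closed)
    have "emeasure \<mu> V \<le> emeasure \<mu> K" using V WK K by (intro emeasure_mono) auto
    also have "emeasure \<mu> K < \<infinity>"
      using haar WK(2) compact_imp_closed[OF WK(2)] 
        radon_measure_compact_finite[of \<mu> K] by (simp add: haar_measure_def)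
    finally show ?thesis using V by auto
  qed
  show ?thesis
  proof (rule that[of "{V\<in>A. emeasure \<mu> V < \<infinity>}"])
    show "countable {V\<in>A. emeasure \<mu> V < \<infinity>}" by (rule countable_subset[OF _ A(1)]) auto
    show "open V \<and> emeasure \<mu> V < \<infinity>" if "V \<in> {V\<in>A. emeasure \<mu> V < \<infinity>}" for V
      using that topological_basis_open[OF A(2)] by auto
  qed (rule loc)
qed

sublocale mu: sigma_finite_measure \<mu>
proof
  obtain \<V> :: "'a set set" where V: "countable \<V>"
    "\<And>V. V \<in> \<V> \<Longrightarrow> open V \<and> emeasure \<mu> V < \<infinity>"
    "\<And>x U. open U \<Longrightarrow> x \<in> U \<Longrightarrow> \<exists>V\<in>\<V>. x \<in> V \<and> V \<subseteq> U"
    by (rule finite_measure_basis) (rule that)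
  show "\<exists>A. countable A \<and> A \<subseteq> sets \<mu> \<and> \<Union> A = space \<mu> \<and> (\<forall>a\<in>A. emeasure \<mu> a \<noteq> \<infinity>)"
  proof (intro exI conjI)
    show "\<Union> \<V> = space \<mu>" using V(3)[OF open_UNIV] by auto
    show "\<forall>V\<in>\<V>. emeasure \<mu> V \<noteq> \<infinity>"
    proof
      fix V assume "V \<in> \<V>"
      from V(2)[OF this] show "emeasure \<mu> V \<noteq> \<infinity>" by auto
    qed
  qed (use V(1,2) in auto)
qed

lemma indicator_L1_L2:
  assumes "B \<in> sets \<mu>" "emeasure \<mu> B < \<infinity>"
  shows "integrable \<mu> (indicator B :: 'a \<Rightarrow> complex)" "(indicator B :: 'a \<Rightarrow> complex) \<in> L2 \<mu>"
    "(LINT x|\<mu>. indicator B x) = complex_of_real (measure \<mu> B)"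
proof -
  have r: "integrable \<mu> (indicator B :: 'a \<Rightarrow> real)" using assms by (intro integrable_real_indicator) auto
  have "(\<lambda>x. complex_of_real (indicator B x)) = indicator B" by (auto simp: indicator_def)
  moreover have "integrable \<mu> (\<lambda>x. complex_of_real (indicator B x))"
    using r by (rule integrable_of_real)
  ultimately show "integrable \<mu> (indicator B :: 'a \<Rightarrow> complex)"
    and "(LINT x|\<mu>. indicator B x) = complex_of_real (measure \<mu> B)"
    using integral_complex_of_real[of \<mu> "indicator B"] assms by auto
  have "(\<lambda>x. (cmod (indicator B x))\<^sup>2) = (indicator B :: 'a \<Rightarrow> real)" by (auto simp: indicator_def)
  then show "(indicator B :: 'a \<Rightarrow> complex) \<in> L2 \<mu>" using r assms unfolding L2_def by auto
qed

lemma fourier_L1_integrable: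
  assumes "integrable \<mu> u"
  shows "integrable \<mu> (\<lambda>x. u x * cnj (char_eval \<xi> x))"
  by (rule integrable_mult_bounded[OF assms, where B = 1]) auto

text \<open>A character is nearly constant on small sets, so the transform of the indicator of a
  suitable small set does not vanish there.\<close>

lemma fourier_indicator_nonzero:
  assumes "countable \<V>" "\<And>V. V \<in> \<V> \<Longrightarrow> open V \<and> emeasure \<mu> V < \<infinity>"
    and "\<And>x U. open U \<Longrightarrow> x \<in> U \<Longrightarrow> \<exists>V\<in>\<V>. x \<in> V \<and> V \<subseteq> U"
  shows "\<exists>V\<in>\<V>. fourier_L1 \<mu> (indicator V) \<xi> \<noteq> 0"
proof -
  \<comment> \<open>Cells on which \<open>\<xi>\<close> stays within 1/2 of a fixed number
    \<open>c\<close> of modulus 1.\<close>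
  define \<W> where "\<W> = {V\<in>\<V>. \<exists>c. cmod c = 1 \<and> (\<forall>y\<in>V. cmod (char_eval \<xi> y - c) < 1/2)}"
  have "x \<in> \<Union>\<W>" for x
  proof -
    have "open (char_eval \<xi> -` ball (char_eval \<xi> x) (1/2))"
      by (rule open_vimage) (auto simp: continuous_char_eval)
    then obtain V where "V \<in> \<V>" "x \<in> V" "V \<subseteq> char_eval \<xi> -` ball (char_eval \<xi> x) (1/2)"
      using assms(3)[of "char_eval \<xi> -` ball (char_eval \<xi> x) (1/2)" x] by auto
    then show ?thesis unfolding \<W>_def
      by (intro UnionI[of V] CollectI conjI exI[of _ "char_eval \<xi> x"])
         (auto simp: subset_eq dist_norm norm_minus_commute)
  qed
  then have U: "(\<Union>V\<in>\<W>. V) = UNIV" by auto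
  have cW: "countable \<W>" by (rule countable_subset[OF _ assms(1)]) (auto simp: \<W>_def)
  \<comment> \<open>Countably many cells cover the group, which has nonzero measure, so they cannot
    all be null.\<close>
  have "\<exists>V\<in>\<W>. emeasure \<mu> V \<noteq> 0"
  proof (rule ccontr)
    assume "\<not> ?thesis"
    then have "(\<Union>V\<in>\<W>. V) \<in> null_sets \<mu>"
      using assms(2) by (intro null_sets_UN' cW) (auto simp: \<W>_def null_sets_def)
    then show False using haar unfolding U haar_measure_def by auto
  qed
  then obtain V c where V: "V \<in> \<V>" "emeasure \<mu> V \<noteq> 0" and c: "cmod c = 1" "\<And>y. y \<in> V \<Longrightarrow> cmod (char_eval \<xi> y - c) < 1/2"
    unfolding \<W>_def by blast
  have Vm: "V \<in> sets \<mu>" "emeasure \<mu> V < \<infinity>" using assms(2)[OF V(1)] by auto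
  note int = indicator_L1_L2(1)[OF Vm]
  have m: "measure \<mu> V > 0" using V(2) Vm by (simp add: measure_def enn2real_positive_iff zero_less_iff_neq_zero)
  define I where "I = fourier_L1 \<mu> (indicator V) \<xi>"
  \<comment> \<open>On the cell the conjugate character is within 1/2 of \<open>cnj c\<close>, so
    the transform stays within \<open>measure \<mu> V / 2\<close> of a number of modulus
    \<open>measure \<mu> V\<close>.\<close>
  have "I - cnj c * measure \<mu> V = (LINT x|\<mu>. indicator V x * cnj (char_eval \<xi> x) - cnj c * indicator V x)"
    unfolding I_def fourier_L1_def using int fourier_L1_integrable[OF int] indicator_L1_L2(3)[OF Vm] by simp
  also have "cmod \<dots> \<le> (LINT x|\<mu>. 1/2 * indicator V x)"
  proof (rule order_trans[OF integral_norm_bound], rule integral_mono)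
    fix x
    show "cmod (indicator V x * cnj (char_eval \<xi> x) - cnj c * indicator V x) \<le> 1/2 * indicator V x"
      using c(2)[of x] complex_mod_cnj[of "char_eval \<xi> x - c"] by (auto simp: indicator_def)
  qed (use int fourier_L1_integrable[OF int] Vm in \<open>auto intro!: integrable_real_indicator\<close>)
  also have "\<dots> = measure \<mu> V / 2" using Vm by simp
  finally have "cmod (I - cnj c * measure \<mu> V) \<le> measure \<mu> V / 2" .
  then have "I \<noteq> 0" using m c(1) by (auto simp: norm_mult)
  then show ?thesis using V(1) by (auto simp: I_def)
qed

lemma fourier_L1_L2:
  assumes "integrable \<mu> u" "u \<in> L2 \<mu>"
  shows "fourier_L1 \<mu> u \<in> L2 \<mu>d" "l2_norm \<mu>d (fourier_L1 \<mu> u) = l2_norm \<mu> u"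
  using plancherel assms by (auto simp: plancherel_normalized_def)

text \<open>The transforms \<open>F V\<close> are square-integrable, so by Chebyshev's inequality
  their superlevel sets have finite measure; these cover the dual because the \<open>F V\<close>
  have no common zero. Sigma-finiteness is thus a consequence of the Plancherel isometry.\<close>

sublocale mud: sigma_finite_measure \<mu>d
proof
  obtain \<V> :: "'a set set" where V: "countable \<V>"
    "\<And>V. V \<in> \<V> \<Longrightarrow> open V \<and> emeasure \<mu> V < \<infinity>"
    "\<And>x U. open U \<Longrightarrow> x \<in> U \<Longrightarrow> \<exists>V\<in>\<V>. x \<in> V \<and> V \<subseteq> U"
    by (rule finite_measure_basis) (rule that)
  define F where "F V = fourier_L1 \<mu> (indicator V)" for V
  have F: "F V \<in> L2 \<mu>d" if "V \<in> \<V>" for V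
    unfolding F_def using V(2)[OF that] by (intro fourier_L1_L2 indicator_L1_L2) auto
  \<comment> \<open>The condition that \<open>(cmod (F V \<xi>))\<^sup>2\<close> is at least
    \<open>1 / n\<close>, written without division; for \<open>n = 0\<close> the set is
    empty.\<close>
  define E where "E = (\<lambda>(V, n). {\<xi>. 1 \<le> ennreal (real n) * ennreal ((cmod (F V \<xi>))\<^sup>2)})"
  have Em: "E (V, n) \<in> sets \<mu>d" if "V \<in> \<V>" for V n
  proof -
    have [measurable]: "F V \<in> borel_measurable \<mu>d" using F[OF that] by (rule L2D)
    have "{\<xi>\<in>space \<mu>d. 1 \<le> ennreal (real n) * ennreal ((cmod (F V \<xi>))\<^sup>2)} \<in> sets \<mu>d" by measurable
    then show ?thesis by (simp add: E_def)
  qed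
  have Efin: "emeasure \<mu>d (E (V, n)) < \<infinity>" if "V \<in> \<V>" for V n
  proof -
    have [measurable]: "F V \<in> borel_measurable \<mu>d" using F[OF that] by (rule L2D)
    have "emeasure \<mu>d (E (V, n)) = (\<integral>\<^sup>+\<xi>. indicator (E (V, n)) \<xi> \<partial>\<mu>d)" using Em[OF that] by simp
    also have "\<dots> \<le> (\<integral>\<^sup>+\<xi>. ennreal (real n) * ennreal ((cmod (F V \<xi>))\<^sup>2) \<partial>\<mu>d)"
      by (intro nn_integral_mono) (auto simp: E_def indicator_def)
    also have "\<dots> = ennreal (real n) * (\<integral>\<^sup>+\<xi>. ennreal ((cmod (F V \<xi>))\<^sup>2) \<partial>\<mu>d)"
      by (rule nn_integral_cmult) measurable
    also have "\<dots> < \<infinity>" using F[OF that] by (simp add: L2_iff_nn_integral ennreal_mult_less_top)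
    finally show ?thesis .
  qed
  show "\<exists>A. countable A \<and> A \<subseteq> sets \<mu>d \<and> \<Union> A = space \<mu>d \<and> (\<forall>a\<in>A. emeasure \<mu>d a \<noteq> \<infinity>)"
  proof (intro exI conjI)
    show "countable (E ` (\<V> \<times> UNIV))" using V(1) by auto
    show "E ` (\<V> \<times> UNIV) \<subseteq> sets \<mu>d" using Em by auto
    show "\<forall>a\<in>E ` (\<V> \<times> UNIV). emeasure \<mu>d a \<noteq> \<infinity>"
    proof
      fix a assume "a \<in> E ` (\<V> \<times> UNIV)"
      then obtain V n where "V \<in> \<V>" "a = E (V, n)" by auto
      then show "emeasure \<mu>d a \<noteq> \<infinity>" using Efin[of V n] by auto
    qed
    have "\<exists>V\<in>\<V>. \<exists>n. \<xi> \<in> E (V, n)" for \<xi>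
    proof -
      obtain W where W: "W \<in> \<V>" "F W \<xi> \<noteq> 0"
        using fourier_indicator_nonzero[OF V, of \<xi>] unfolding F_def by auto
      then have "0 < (cmod (F W \<xi>))\<^sup>2" by simp
      then obtain n where "1 < real n * (cmod (F W \<xi>))\<^sup>2" using reals_Archimedean3 by blast
      then have "ennreal 1 \<le> ennreal (real n * (cmod (F W \<xi>))\<^sup>2)" by (intro ennreal_leI) simp
      then have "\<xi> \<in> E (W, n)" by (simp add: E_def ennreal_mult)
      then show ?thesis using W by blast
    qed
    then show "\<Union> (E ` (\<V> \<times> UNIV)) = space \<mu>d" by fastforce
  qed
qed

sublocale mud_mu: pair_sigma_finite \<mu>d \<mu> ..

lemma char_eval_pair_measurable [measurable]:
  "(\<lambda>p. char_eval (fst p) (snd p)) \<in> borel_measurable (\<mu>d \<Otimes>\<^sub>M \<mu>)"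
proof -
  have "(\<lambda>p. case (snd p, fst p) of (x, \<xi>) \<Rightarrow> char_eval \<xi> x) \<in> borel_measurable (\<mu>d \<Otimes>\<^sub>M \<mu>)"
    by (rule measurable_compose[OF _ char_eval_jointly_measurable]) measurable
  then show ?thesis by simp
qed

lemma fourier_L1_lin:
  assumes "integrable \<mu> u" "integrable \<mu> v"
  shows "fourier_L1 \<mu> (\<lambda>x. a * u x + b * v x) \<xi> = a * fourier_L1 \<mu> u \<xi> + b * fourier_L1 \<mu> v \<xi>"
proof -
  have "fourier_L1 \<mu> (\<lambda>x. a * u x + b * v x) \<xi>
      = (LINT x|\<mu>. a * (u x * cnj (char_eval \<xi> x)) + b * (v x * cnj (char_eval \<xi> x)))"
    unfolding fourier_L1_def by (simp add: algebra_simps)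
  then show ?thesis
    using fourier_L1_integrable[OF assms(1)] fourier_L1_integrable[OF assms(2)]
    by (simp add: fourier_L1_def)
qed

section \<open>The Fourier transform on \<open>L2\<close> and Parseval's identity\<close>

lemma is_fourier_L2_L1:
  assumes "integrable \<mu> u" "u \<in> L2 \<mu>"
  shows "is_fourier_L2 \<mu> \<mu>d u (fourier_L1 \<mu> u)"
  unfolding is_fourier_L2_def using assms fourier_L1_L2[OF assms]
  by (auto intro!: exI[of _ "\<lambda>_. u"] simp: l2_norm_def)

lemma is_fourier_L2_lin:
  assumes "is_fourier_L2 \<mu> \<mu>d f F" "is_fourier_L2 \<mu> \<mu>d g G" and fg: "f \<in> L2 \<mu>" "g \<in> L2 \<mu>"
  shows "is_fourier_L2 \<mu> \<mu>d (\<lambda>x. a * f x + b * g x) (\<lambda>\<xi>. a * F \<xi> + b * G \<xi>)"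
proof -
  obtain u where u: "\<And>n. integrable \<mu> (u n)" "\<And>n. u n \<in> L2 \<mu>"
    "(\<lambda>n::nat. l2_norm \<mu> (\<lambda>x. u n x - f x)) \<longlonglongrightarrow> 0"
    "(\<lambda>n. l2_norm \<mu>d (\<lambda>\<xi>. fourier_L1 \<mu> (u n) \<xi> - F \<xi>)) \<longlonglongrightarrow> 0" and F: "F \<in> L2 \<mu>d"
    using assms(1) unfolding is_fourier_L2_def by auto
  obtain v where v: "\<And>n. integrable \<mu> (v n)" "\<And>n. v n \<in> L2 \<mu>"
    "(\<lambda>n::nat. l2_norm \<mu> (\<lambda>x. v n x - g x)) \<longlonglongrightarrow> 0"
    "(\<lambda>n. l2_norm \<mu>d (\<lambda>\<xi>. fourier_L1 \<mu> (v n) \<xi> - G \<xi>)) \<longlonglongrightarrow> 0" and G: "G \<in> L2 \<mu>d"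
    using assms(2) unfolding is_fourier_L2_def by auto
  \<comment> \<open>Stated for an arbitrary measure, since the same estimate is applied on the group
    and on the dual.\<close>
  have *: "(\<lambda>n. l2_norm M (\<lambda>x. (a * p n x + b * q n x) - (a * f x + b * g x))) \<longlonglongrightarrow> 0"
    if pq: "\<And>n. p n \<in> L2 M" "\<And>n. q n \<in> L2 M" "f \<in> L2 M" "g \<in> L2 M"
      and l: "(\<lambda>n::nat. l2_norm M (\<lambda>x. p n x - f x)) \<longlonglongrightarrow> 0" "(\<lambda>n. l2_norm M (\<lambda>x. q n x - g x)) \<longlonglongrightarrow> 0"
    for M :: "'c measure" and p q f g
  proof (rule tendsto_sandwich[OF _ _ tendsto_const])
    show "(\<lambda>n. cmod a * l2_norm M (\<lambda>x. p n x - f x) + cmod b * l2_norm M (\<lambda>x. q n x - g x)) \<longlonglongrightarrow> 0"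
      using tendsto_add[OF tendsto_mult_right_zero[OF l(1)] tendsto_mult_right_zero[OF l(2)]] by simp
    have "(\<lambda>x. (a * p n x + b * q n x) - (a * f x + b * g x))
        = (\<lambda>x. a * (p n x - f x) + b * (q n x - g x))" for n by (simp add: algebra_simps)
    then have "l2_norm M (\<lambda>x. (a * p n x + b * q n x) - (a * f x + b * g x))
        \<le> cmod a * l2_norm M (\<lambda>x. p n x - f x) + cmod b * l2_norm M (\<lambda>x. q n x - g x)" for n
      using l2_norm_triangle[OF L2_cmult[OF L2_diff[OF pq(1,3)], of a] L2_cmult[OF L2_diff[OF pq(2,4)], of b]]
      by (simp only: l2_norm_cmult)
    then show "\<forall>\<^sub>F n in sequentially. l2_norm M (\<lambda>x. (a * p n x + b * q n x) - (a * f x + b * g x))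
        \<le> cmod a * l2_norm M (\<lambda>x. p n x - f x) + cmod b * l2_norm M (\<lambda>x. q n x - g x)" by simp
  qed simp
  have uv: "integrable \<mu> (\<lambda>x. a * u n x + b * v n x)" "(\<lambda>x. a * u n x + b * v n x) \<in> L2 \<mu>" for n
    using u(1)[of n] v(1)[of n] L2_add[OF L2_cmult[OF u(2)] L2_cmult[OF v(2)]] by auto
  show ?thesis unfolding is_fourier_L2_def
  proof (intro conjI exI[of _ "\<lambda>n x. a * u n x + b * v n x"] allI uv)
    show "(\<lambda>\<xi>. a * F \<xi> + b * G \<xi>) \<in> L2 \<mu>d" using F G by auto
    show "(\<lambda>n. l2_norm \<mu> (\<lambda>x. a * u n x + b * v n x - (a * f x + b * g x))) \<longlonglongrightarrow> 0"
      by (rule *[OF u(2) v(2) fg u(3) v(3)])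
    show "(\<lambda>n. l2_norm \<mu>d (\<lambda>\<xi>. fourier_L1 \<mu> (\<lambda>x. a * u n x + b * v n x) \<xi> - (a * F \<xi> + b * G \<xi>))) \<longlonglongrightarrow> 0"
      unfolding fourier_L1_lin[OF u(1) v(1)]
      by (rule *[OF fourier_L1_L2(1)[OF u(1,2)] fourier_L1_L2(1)[OF v(1,2)] F G u(4) v(4)])
  qed
qed

lemma is_fourier_L2_norm:
  assumes "is_fourier_L2 \<mu> \<mu>d f F" "f \<in> L2 \<mu>"
  shows "l2_norm \<mu>d F = l2_norm \<mu> f"
proof -
  obtain u where u: "\<And>n. integrable \<mu> (u n)" "\<And>n. u n \<in> L2 \<mu>"
    "(\<lambda>n::nat. l2_norm \<mu> (\<lambda>x. u n x - f x)) \<longlonglongrightarrow> 0"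
    "(\<lambda>n. l2_norm \<mu>d (\<lambda>\<xi>. fourier_L1 \<mu> (u n) \<xi> - F \<xi>)) \<longlonglongrightarrow> 0" and F: "F \<in> L2 \<mu>d"
    using assms(1) unfolding is_fourier_L2_def by auto
  have "(\<lambda>n. l2_norm \<mu> (u n)) \<longlonglongrightarrow> l2_norm \<mu> f" by (rule l2_norm_tendsto[OF u(2) assms(2) u(3)])
  moreover have "(\<lambda>n. l2_norm \<mu>d (fourier_L1 \<mu> (u n))) \<longlonglongrightarrow> l2_norm \<mu>d F"
    by (rule l2_norm_tendsto[OF fourier_L1_L2(1)[OF u(1,2)] F u(4)])
  ultimately show ?thesis using fourier_L1_L2(2)[OF u(1,2)] by (simp add: LIMSEQ_unique)
qed

text \<open>Simple functions approach \<open>f\<close> at speed \<open>(1/4)^n\<close>. By linearity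
  and isometry their transforms have the same mutual distances, bounded by
  \<open>2 * (1/4)^n\<close> through a comparison with \<open>f\<close>, so
  \<open>L2_complete\<close> yields the limit.\<close>

lemma is_fourier_L2_exists:
  assumes f: "f \<in> L2 \<mu>"
  shows "\<exists>F. is_fourier_L2 \<mu> \<mu>d f F"
proof -
  have "\<exists>s. integrable \<mu> s \<and> s \<in> L2 \<mu> \<and> l2_norm \<mu> (\<lambda>x. s x - f x) < (1/4)^n" for n :: nat
    by (rule L2_simple_approx[OF f, of "(1/4)^n"]) auto
  then obtain u where u: "\<And>n::nat. integrable \<mu> (u n)" "\<And>n. u n \<in> L2 \<mu>"
    "\<And>n. l2_norm \<mu> (\<lambda>x. u n x - f x) < (1/4)^n" by metis
  have fu: "fourier_L1 \<mu> (\<lambda>x. u m x - u n x) \<xi> = fourier_L1 \<mu> (u m) \<xi> - fourier_L1 \<mu> (u n) \<xi>" for m n \<xi>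
    using fourier_L1_lin[OF u(1) u(1), of 1 m "-1" n \<xi>] by simp
  have cauchy: "l2_norm \<mu>d (\<lambda>\<xi>. fourier_L1 \<mu> (u m) \<xi> - fourier_L1 \<mu> (u n) \<xi>) \<le> 2 * (1/4)^n"
    if "n \<le> m" for m n
  proof -
    have "l2_norm \<mu>d (\<lambda>\<xi>. fourier_L1 \<mu> (u m) \<xi> - fourier_L1 \<mu> (u n) \<xi>) = l2_norm \<mu> (\<lambda>x. u m x - u n x)"
      using fourier_L1_L2(2)[of "\<lambda>x. u m x - u n x"] u(1) L2_diff[OF u(2) u(2)]
      by (simp add: fu[abs_def, symmetric] eta_contract_eq)
    also have "\<dots> \<le> l2_norm \<mu> (\<lambda>x. u m x - f x) + l2_norm \<mu> (\<lambda>x. f x - u n x)"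
      by (rule l2_norm_triangle_diff[OF u(2) f u(2)])
    also have "\<dots> \<le> (1/4)^m + (1/4)^n"
      using u(3)[of m] u(3)[of n] l2_norm_minus_commute[of \<mu> f "u n"] by simp
    also have "\<dots> \<le> 2 * (1/4)^n" using power_decreasing[OF that, of "1/4::real"] by simp
    finally show ?thesis .
  qed
  obtain F where F: "F \<in> L2 \<mu>d" "(\<lambda>n. l2_norm \<mu>d (\<lambda>\<xi>. fourier_L1 \<mu> (u n) \<xi> - F \<xi>)) \<longlonglongrightarrow> 0"
    by (rule L2_complete[of "\<lambda>n. fourier_L1 \<mu> (u n)" \<mu>d 2, OF fourier_L1_L2(1)[OF u(1,2)] cauchy])
  have lim: "(\<lambda>n. (1/4::real)^n) \<longlonglongrightarrow> 0" by (rule LIMSEQ_power_zero) auto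
  have "(\<lambda>n. l2_norm \<mu> (\<lambda>x. u n x - f x)) \<longlonglongrightarrow> 0"
    by (rule tendsto_sandwich[OF _ _ tendsto_const lim]) (use u(3) in \<open>auto intro!: always_eventually less_imp_le\<close>)
  then show ?thesis unfolding is_fourier_L2_def
    using u(1,2) F by (intro exI[of _ F] conjI exI[of _ u] allI) auto
qed

lemma is_fourier_L2_fourier: "f \<in> L2 \<mu> \<Longrightarrow> is_fourier_L2 \<mu> \<mu>d f (fourier \<mu> \<mu>d f)"
  unfolding fourier_def by (rule someI_ex[OF is_fourier_L2_exists])

lemma fourier_in_L2 [intro]: "f \<in> L2 \<mu> \<Longrightarrow> fourier \<mu> \<mu>d f \<in> L2 \<mu>d"
  using is_fourier_L2_fourier by (auto simp: is_fourier_L2_def)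

lemma l2_norm_fourier: "f \<in> L2 \<mu> \<Longrightarrow> l2_norm \<mu>d (fourier \<mu> \<mu>d f) = l2_norm \<mu> f"
  using is_fourier_L2_norm is_fourier_L2_fourier by blast

text \<open>Polarization of the isometry. The relation \<open>is_fourier_L2\<close> is used because
  it is stable under linear combinations, whereas \<open>fourier\<close> is a fixed choice of
  representatives.\<close>

lemma parseval:
  assumes "is_fourier_L2 \<mu> \<mu>d f F" "is_fourier_L2 \<mu> \<mu>d g G" "f \<in> L2 \<mu>" "g \<in> L2 \<mu>"
  shows "l2_inner \<mu>d F G = l2_inner \<mu> f g"
proof (rule l2_inner_eqI)
  fix a b
  show "l2_norm \<mu>d (\<lambda>x. a * F x + b * G x) = l2_norm \<mu> (\<lambda>x. a * f x + b * g x)"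
    by (rule is_fourier_L2_norm[OF is_fourier_L2_lin[OF assms]
          L2_add[OF L2_cmult[OF assms(3)] L2_cmult[OF assms(4)]]])
qed (use assms in \<open>auto simp: is_fourier_L2_def\<close>)

lemma is_fourier_L2_dist:
  assumes "is_fourier_L2 \<mu> \<mu>d f F" "is_fourier_L2 \<mu> \<mu>d g G" "f \<in> L2 \<mu>" "g \<in> L2 \<mu>"
  shows "l2_norm \<mu>d (\<lambda>\<xi>. F \<xi> - G \<xi>) = l2_norm \<mu> (\<lambda>x. f x - g x)"
  using is_fourier_L2_norm[OF is_fourier_L2_lin[OF assms, of 1 "-1"]] L2_diff[OF assms(3,4)] by simp

lemma is_fourier_L2_unique:
  assumes "is_fourier_L2 \<mu> \<mu>d f F" "is_fourier_L2 \<mu> \<mu>d f G" "f \<in> L2 \<mu>"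
  shows "AE \<xi> in \<mu>d. F \<xi> = G \<xi>"
proof -
  have "(\<lambda>\<xi>. F \<xi> - G \<xi>) \<in> L2 \<mu>d" using assms by (auto simp: is_fourier_L2_def)
  moreover have "l2_norm \<mu>d (\<lambda>\<xi>. F \<xi> - G \<xi>) = 0"
    using is_fourier_L2_dist[OF assms(1,2,3,3)] by (simp add: l2_norm_def)
  ultimately have "AE \<xi> in \<mu>d. F \<xi> - G \<xi> = 0" by (simp only: l2_norm_eq_0_iff)
  then show ?thesis by simp
qed

section \<open>Translations of the group and modulations of the dual\<close>

lemma minus_const_measurable [measurable]: "(\<lambda>y. y - x) \<in> measurable \<mu> \<mu>"
proof -
  have "(\<lambda>y::'a. y - x) \<in> borel_measurable borel"
    by (intro borel_measurable_continuous_onI continuous_intros)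
  then show ?thesis by (simp cong: measurable_cong_sets)
qed

lemma distr_translation: "distr \<mu> \<mu> (\<lambda>y. y - x) = \<mu>"
proof (rule measure_eqI)
  fix B assume "B \<in> sets (distr \<mu> \<mu> (\<lambda>y. y - x))"
  then have B: "B \<in> sets borel" by simp
  have "(\<lambda>y. y - x) -` B \<inter> space \<mu> = (+) x ` B"
    by (auto simp: image_iff) (metis add.commute diff_add_cancel)
  then show "emeasure (distr \<mu> \<mu> (\<lambda>y. y - x)) B = emeasure \<mu> B"
    using haar B by (simp add: emeasure_distr haar_measure_def)
qed simp

lemma integral_translation:
  assumes "f \<in> borel_measurable \<mu>"
  shows "(LINT y|\<mu>. f (y - x)) = (LINT y|\<mu>. (f y :: 'b::{banach,second_countable_topology}))"
  using integral_distr[OF minus_const_measurable, of f x] assms unfolding distr_translation by simp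

lemma integrable_translation:
  assumes "integrable \<mu> f"
  shows "integrable \<mu> (\<lambda>y. f (y - x) :: 'b::{banach,second_countable_topology})"
  using integrable_distr_eq[OF minus_const_measurable, of f x] assms unfolding distr_translation by simp

lemma translation_L2: "f \<in> L2 \<mu> \<Longrightarrow> translation x f \<in> L2 \<mu>"
  using integrable_translation[of "\<lambda>y. (cmod (f y))\<^sup>2" x] measurable_compose[OF minus_const_measurable[of x], of f borel]
  by (auto simp: L2_def translation_def[abs_def])

lemma fourier_L1_translation:
  assumes "integrable \<mu> u"
  shows "fourier_L1 \<mu> (translation x u) \<xi> = cnj (char_eval \<xi> x) * fourier_L1 \<mu> u \<xi>"
proof -
  \<comment> \<open>Writing \<open>y\<close> as \<open>(y - x) + x\<close> exhibits the integrand as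
    a translate, so that invariance applies.\<close>
  have "fourier_L1 \<mu> (translation x u) \<xi> = (LINT y|\<mu>. u (y - x) * cnj (char_eval \<xi> ((y - x) + x)))"
    by (simp add: fourier_L1_def translation_def)
  also have "\<dots> = (LINT y|\<mu>. u y * cnj (char_eval \<xi> (y + x)))"
  proof (rule integral_translation)
    have "integrable \<mu> (\<lambda>y. cnj (char_eval \<xi> x) * (u y * cnj (char_eval \<xi> y)))"
      using fourier_L1_integrable[OF assms] by simp
    then show "(\<lambda>y. u y * cnj (char_eval \<xi> (y + x))) \<in> borel_measurable \<mu>"
      by (auto simp: char_eval_add algebra_simps dest: borel_measurable_integrable)
  qed
  also have "\<dots> = (LINT y|\<mu>. cnj (char_eval \<xi> x) * (u y * cnj (char_eval \<xi> y)))"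
    by (simp add: char_eval_add algebra_simps)
  also have "\<dots> = cnj (char_eval \<xi> x) * fourier_L1 \<mu> u \<xi>"
    using fourier_L1_integrable[OF assms] by (simp add: fourier_L1_def)
  finally show ?thesis .
qed

text \<open>Translation on the group and multiplication by a unimodular function on the dual
  preserve norms, so the translated approximants converge as before.\<close>

lemma is_fourier_L2_translation:
  assumes "is_fourier_L2 \<mu> \<mu>d f F" and f: "f \<in> L2 \<mu>"
  shows "is_fourier_L2 \<mu> \<mu>d (translation x f) (\<lambda>\<xi>. cnj (char_eval \<xi> x) * F \<xi>)"
proof -
  obtain u where u: "\<And>n. integrable \<mu> (u n)" "\<And>n. u n \<in> L2 \<mu>"
    "(\<lambda>n::nat. l2_norm \<mu> (\<lambda>x. u n x - f x)) \<longlonglongrightarrow> 0"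
    "(\<lambda>n. l2_norm \<mu>d (\<lambda>\<xi>. fourier_L1 \<mu> (u n) \<xi> - F \<xi>)) \<longlonglongrightarrow> 0" and F: "F \<in> L2 \<mu>d"
    using assms(1) unfolding is_fourier_L2_def by auto
  show ?thesis unfolding is_fourier_L2_def
  proof (intro conjI exI[of _ "\<lambda>n. translation x (u n)"] allI)
    show "(\<lambda>\<xi>. cnj (char_eval \<xi> x) * F \<xi>) \<in> L2 \<mu>d"
      by (rule L2_unimodular[OF F]) auto
    show "integrable \<mu> (translation x (u n))" for n
      using integrable_translation[OF u(1)] by (simp add: translation_def[abs_def])
    show "translation x (u n) \<in> L2 \<mu>" for n by (rule translation_L2[OF u(2)])
    have "l2_norm \<mu> (\<lambda>y. translation x (u n) y - translation x f y) = l2_norm \<mu> (\<lambda>x. u n x - f x)" for n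
      unfolding l2_norm_def translation_def
      using integral_translation[of "\<lambda>y. (cmod (u n y - f y))\<^sup>2" x] L2D[OF L2_diff[OF u(2) f], of n] by auto
    then show "(\<lambda>n. l2_norm \<mu> (\<lambda>y. translation x (u n) y - translation x f y)) \<longlonglongrightarrow> 0"
      using u(3) by simp
    have "l2_norm \<mu>d (\<lambda>\<xi>. fourier_L1 \<mu> (translation x (u n)) \<xi> - cnj (char_eval \<xi> x) * F \<xi>)
      = l2_norm \<mu>d (\<lambda>\<xi>. fourier_L1 \<mu> (u n) \<xi> - F \<xi>)" for n
      unfolding fourier_L1_translation[OF u(1)] right_diff_distrib[symmetric] l2_norm_def
      by (simp add: norm_mult)
    then show "(\<lambda>n. l2_norm \<mu>d (\<lambda>\<xi>. fourier_L1 \<mu> (translation x (u n)) \<xi> - cnj (char_eval \<xi> x) * F \<xi>)) \<longlonglongrightarrow> 0"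
      using u(4) by simp
  qed
qed

text \<open>The value at \<open>x\<close> is an inner product with a translate of \<open>p\<close>,
  and the transform turns that translation into a modulation. Both sides are integrals insensitive
  to null sets, so the equality holds at every \<open>x\<close>.\<close>

lemma convolution_eq_inverse_fourier:
  assumes f: "f \<in> L2 \<mu>" and p: "p \<in> L2 \<mu>"
  shows "convolution \<mu> f (involution p) x
    = (LINT \<xi>|\<mu>d. fourier \<mu> \<mu>d f \<xi> * cnj (fourier \<mu> \<mu>d p \<xi>) * char_eval \<xi> x)"
proof -
  have "convolution \<mu> f (involution p) x = l2_inner \<mu> f (translation x p)"
    by (simp add: convolution_def involution_def l2_inner_def translation_def)
  also have "\<dots> = l2_inner \<mu>d (fourier \<mu> \<mu>d f) (\<lambda>\<xi>. cnj (char_eval \<xi> x) * fourier \<mu> \<mu>d p \<xi>)"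
    by (rule parseval[symmetric, OF is_fourier_L2_fourier[OF f]
          is_fourier_L2_translation[OF is_fourier_L2_fourier[OF p] p] f translation_L2[OF p]])
  also have "\<dots> = (LINT \<xi>|\<mu>d. fourier \<mu> \<mu>d f \<xi> * cnj (fourier \<mu> \<mu>d p \<xi>) * char_eval \<xi> x)"
    unfolding l2_inner_def by (simp add: mult_ac)
  finally show ?thesis .
qed

end

section \<open>Inverse Fourier transforms of integrable functions\<close>

context plancherel_pair
begin

definition inverse_fourier :: "('a dual \<Rightarrow> complex) \<Rightarrow> 'a \<Rightarrow> complex" where
  "inverse_fourier H x = (LINT \<xi>|\<mu>d. H \<xi> * char_eval \<xi> x)"

lemma char_eval_pair_measurable_sigma:
  assumes "sets N = sets borel"
  shows "(\<lambda>p. char_eval (snd p) (fst p)) \<in> borel_measurable (N \<Otimes>\<^sub>M \<mu>d)"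
proof -
  have "sets (N \<Otimes>\<^sub>M \<mu>d) = sets (borel \<Otimes>\<^sub>M borel)" using assms by (intro sets_pair_measure_cong) auto
  then show ?thesis
    using char_eval_jointly_measurable[where 'a = 'a] by (simp add: case_prod_beta' cong: measurable_cong_sets)
qed

lemma inverse_fourier_measurable:
  assumes [measurable]: "H \<in> borel_measurable \<mu>d"
  shows "inverse_fourier H \<in> borel_measurable \<mu>"
proof -
  note [measurable] = char_eval_pair_measurable_sigma[OF sets_mu]
  have "(\<lambda>x. LINT \<xi>|\<mu>d. H \<xi> * char_eval \<xi> x) \<in> borel_measurable \<mu>"
  proof (rule mud.borel_measurable_lebesgue_integral)
    have "(\<lambda>p. H (snd p) * char_eval (snd p) (fst p)) \<in> borel_measurable (\<mu> \<Otimes>\<^sub>M \<mu>d)" by measurable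
    then show "(\<lambda>(x, \<xi>). H \<xi> * char_eval \<xi> x) \<in> borel_measurable (\<mu> \<Otimes>\<^sub>M \<mu>d)"
      by (simp add: case_prod_beta')
  qed
  then show ?thesis by (simp add: inverse_fourier_def[abs_def])
qed

lemma inverse_fourier_bound: "cmod (inverse_fourier H x) \<le> (LINT \<xi>|\<mu>d. cmod (H \<xi>))"
  unfolding inverse_fourier_def by (rule order_trans[OF integral_norm_bound]) (simp add: norm_mult)

text \<open>Fubini's theorem for \<open>H \<xi> * (char_eval \<xi> x * cnj (p x))\<close>, whose
  modulus is a product of two integrable functions. It takes the place of Parseval when
  \<open>H\<close> is merely integrable.\<close>

lemma inverse_fourier_pairing:
  assumes H: "integrable \<mu>d H" and p: "integrable \<mu> p"
  shows "(LINT x|\<mu>. inverse_fourier H x * cnj (p x)) = (LINT \<xi>|\<mu>d. H \<xi> * cnj (fourier_L1 \<mu> p \<xi>))"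
proof -
  define f where "f = (\<lambda>\<xi> x. H \<xi> * (char_eval \<xi> x * cnj (p x)))"
  note [measurable] = borel_measurable_integrable[OF H] borel_measurable_integrable[OF p]
  have cp: "integrable \<mu> (\<lambda>x. char_eval \<xi> x * cnj (p x))" for \<xi>
    using Bochner_Integration.integrable_cnj[OF fourier_L1_integrable[OF p, of \<xi>]] by (simp add: mult.commute)
  have int: "integrable (\<mu>d \<Otimes>\<^sub>M \<mu>) (case_prod f)"
  proof (rule mud_mu.Fubini_integrable)
    have "(\<lambda>q. H (fst q) * (char_eval (fst q) (snd q) * cnj (p (snd q)))) \<in> borel_measurable (\<mu>d \<Otimes>\<^sub>M \<mu>)"
      by measurable
    then show "case_prod f \<in> borel_measurable (\<mu>d \<Otimes>\<^sub>M \<mu>)" by (simp add: f_def case_prod_beta')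
    show "integrable \<mu>d (\<lambda>\<xi>. LINT x|\<mu>. norm (case_prod f (\<xi>, x)))"
      using H by (simp add: f_def norm_mult)
    show "AE \<xi> in \<mu>d. integrable \<mu> (\<lambda>x. case_prod f (\<xi>, x))"
      using cp by (simp add: f_def)
  qed
  have "inverse_fourier H x * cnj (p x) = (LINT \<xi>|\<mu>d. f \<xi> x)" for x
  proof -
    have "integrable \<mu>d (\<lambda>\<xi>. H \<xi> * char_eval \<xi> x)"
      by (rule integrable_mult_bounded[OF H, where B = 1]) auto
    then show ?thesis by (simp add: inverse_fourier_def f_def flip: mult.assoc)
  qed
  moreover have "H \<xi> * cnj (fourier_L1 \<mu> p \<xi>) = (LINT x|\<mu>. f \<xi> x)" for \<xi>
  proof -
    have "cnj (fourier_L1 \<mu> p \<xi>) = (LINT x|\<mu>. cnj (p x * cnj (char_eval \<xi> x)))"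
      unfolding fourier_L1_def by (simp only: Bochner_Integration.integral_cnj)
    then show ?thesis using cp[of \<xi>] by (simp add: f_def mult.commute)
  qed
  ultimately show ?thesis using mud_mu.Fubini_integral[OF int] by simp
qed

text \<open>Injectivity of the inverse transform, tested against translates of the small indicators
  whose transforms have no common zero.\<close>

lemma fourier_inverse_fourier:
  assumes H: "integrable \<mu>d H" and h: "inverse_fourier H \<in> L2 \<mu>"
  shows "AE \<xi> in \<mu>d. fourier \<mu> \<mu>d (inverse_fourier H) \<xi> = H \<xi>"
proof -
  obtain \<V> :: "'a set set" where V: "countable \<V>"
    "\<And>V. V \<in> \<V> \<Longrightarrow> open V \<and> emeasure \<mu> V < \<infinity>"
    "\<And>x U. open U \<Longrightarrow> x \<in> U \<Longrightarrow> \<exists>V\<in>\<V>. x \<in> V \<and> V \<subseteq> U"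
    by (rule finite_measure_basis) (rule that)
  define G where "G = fourier \<mu> \<mu>d (inverse_fourier H)"
  have G: "G \<in> L2 \<mu>d" "is_fourier_L2 \<mu> \<mu>d (inverse_fourier H) G"
    unfolding G_def using h by (auto intro: is_fourier_L2_fourier)
  \<comment> \<open>\<open>G\<close> is only square-integrable, so the difference is weighted by a
    transform that is both square-integrable and bounded: then the part with \<open>G\<close> is a
    product of two \<open>L2\<close> functions and the part with \<open>H\<close> an integrable
    function times a bounded one.\<close>
  have "AE \<xi> in \<mu>d. (G \<xi> - H \<xi>) * cnj (fourier_L1 \<mu> (indicator V) \<xi>) = 0" if "V \<in> \<V>" for V
  proof -
    define p where "p = (indicator V :: 'a \<Rightarrow> complex)"
    have p: "integrable \<mu> p" "p \<in> L2 \<mu>" unfolding p_def using V(2)[OF that] by (auto intro!: indicator_L1_L2)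
    have b: "cmod (fourier_L1 \<mu> p \<xi>) \<le> (LINT x|\<mu>. cmod (p x))" for \<xi>
      unfolding fourier_L1_def by (rule order_trans[OF integral_norm_bound]) (simp add: norm_mult)
    note pF = fourier_L1_L2(1)[OF p]
    have i1: "integrable \<mu>d (\<lambda>\<xi>. G \<xi> * cnj (fourier_L1 \<mu> p \<xi>))"
      by (rule integrable_L2_mult(1)[OF G(1) pF])
    have i2: "integrable \<mu>d (\<lambda>\<xi>. H \<xi> * cnj (fourier_L1 \<mu> p \<xi>))"
      by (rule integrable_mult_bounded[OF H]) (use b L2D(1)[OF pF] in auto)
    \<comment> \<open>The character is absorbed by translating \<open>p\<close>. Parseval evaluates
      the integral with \<open>G\<close> and Fubini the one with \<open>H\<close>; both equal the
      pairing of \<open>inverse_fourier H\<close> with \<open>q\<close>.\<close>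
    have "(LINT \<xi>|\<mu>d. (G \<xi> - H \<xi>) * cnj (fourier_L1 \<mu> p \<xi>) * char_eval \<xi> x) = 0" for x
    proof -
      define q where "q = translation x p"
      have q: "integrable \<mu> q" "q \<in> L2 \<mu>"
        unfolding q_def using integrable_translation[OF p(1)] translation_L2[OF p(2)]
        by (auto simp: translation_def[abs_def])
      have qF: "cnj (fourier_L1 \<mu> q \<xi>) = cnj (fourier_L1 \<mu> p \<xi>) * char_eval \<xi> x" for \<xi>
        unfolding q_def fourier_L1_translation[OF p(1)] by simp
      have j1: "integrable \<mu>d (\<lambda>\<xi>. G \<xi> * cnj (fourier_L1 \<mu> p \<xi>) * char_eval \<xi> x)"
        by (rule integrable_mult_bounded[OF i1, where B = 1]) auto
      have j2: "integrable \<mu>d (\<lambda>\<xi>. H \<xi> * cnj (fourier_L1 \<mu> p \<xi>) * char_eval \<xi> x)"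
        by (rule integrable_mult_bounded[OF i2, where B = 1]) auto
      have "(LINT \<xi>|\<mu>d. G \<xi> * cnj (fourier_L1 \<mu> p \<xi>) * char_eval \<xi> x) = l2_inner \<mu>d G (fourier_L1 \<mu> q)"
        unfolding l2_inner_def qF by (simp add: mult.assoc)
      also have "\<dots> = l2_inner \<mu> (inverse_fourier H) q"
        by (rule parseval[OF G(2) is_fourier_L2_L1[OF q] h q(2)])
      also have "\<dots> = (LINT \<xi>|\<mu>d. H \<xi> * cnj (fourier_L1 \<mu> q \<xi>))"
        unfolding l2_inner_def by (rule inverse_fourier_pairing[OF H q(1)])
      also have "\<dots> = (LINT \<xi>|\<mu>d. H \<xi> * cnj (fourier_L1 \<mu> p \<xi>) * char_eval \<xi> x)"
        unfolding qF by (simp add: mult.assoc)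
      finally show ?thesis using j1 j2 by (simp add: left_diff_distrib)
    qed
    moreover have "integrable \<mu>d (\<lambda>\<xi>. (G \<xi> - H \<xi>) * cnj (fourier_L1 \<mu> p \<xi>))"
      using i1 i2 by (simp add: left_diff_distrib)
    ultimately show ?thesis unfolding p_def[symmetric] by (intro inverse_fourier_unique[OF sets_mud])
  qed
  \<comment> \<open>Countability gathers the exceptional sets into one null set; at each remaining
    character a nonzero weight can be cancelled.\<close>
  then have "AE \<xi> in \<mu>d. \<forall>V\<in>\<V>. (G \<xi> - H \<xi>) * cnj (fourier_L1 \<mu> (indicator V) \<xi>) = 0"
    by (intro AE_ball_countable[OF V(1), THEN iffD2] ballI)
  then show ?thesis
  proof eventually_elim
    case (elim \<xi>)
    obtain V where "V \<in> \<V>" "fourier_L1 \<mu> (indicator V) \<xi> \<noteq> 0"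
      using fourier_indicator_nonzero[OF V, of \<xi>] by auto
    with bspec[OF elim \<open>V \<in> \<V>\<close>] show ?case by (simp add: G_def)
  qed
qed

text \<open>Testing against \<open>h\<close> cut off to sets of finite measure replaces surjectivity of the
  Plancherel transform.\<close>

lemma inverse_fourier_L2:
  assumes H: "integrable \<mu>d H" "H \<in> L2 \<mu>d"
  shows "inverse_fourier H \<in> L2 \<mu>"
proof -
  define h where "h = inverse_fourier H"
  have hm [measurable]: "h \<in> borel_measurable \<mu>"
    unfolding h_def using H by (intro inverse_fourier_measurable) auto
  define C where "C = (LINT \<xi>|\<mu>d. cmod (H \<xi>))"
  have C: "cmod (h x) \<le> C" for x unfolding h_def C_def by (rule inverse_fourier_bound)
  obtain A :: "nat \<Rightarrow> 'a set" where A: "range A \<subseteq> sets \<mu>" "(\<Union>i. A i) = space \<mu>"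
    "\<And>i. emeasure \<mu> (A i) \<noteq> \<infinity>" "incseq A"
    by (rule mu.sigma_finite_incseq) (rule that)
  have Am [measurable]: "A n \<in> sets borel" for n using A(1) by auto
  define p where "p = (\<lambda>n x. h x * indicator (A n) x)"
  have pm [measurable]: "p n \<in> borel_measurable \<mu>" for n unfolding p_def by measurable
  have fin: "emeasure \<mu> (A n) < \<infinity>" for n using A(3)[of n] by (simp add: less_top)
  have p1: "integrable \<mu> (p n)" for n
  proof -
    have "A n \<in> sets \<mu>" by simp
    from integrable_mult_bounded[OF indicator_L1_L2(1)[OF this fin] hm C]
    show ?thesis by (simp add: p_def mult.commute)
  qed
  have p2: "p n \<in> L2 \<mu>" for n
  proof (rule L2_bound)
    have C0: "0 \<le> C" using order_trans[OF norm_ge_zero C] .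
    show "integrable \<mu> (\<lambda>x. C\<^sup>2 * indicator (A n) x)"
      using fin by (intro integrable_mult_right integrable_real_indicator) auto
    show "AE x in \<mu>. (cmod (p n x))\<^sup>2 \<le> C\<^sup>2 * indicator (A n) x"
      using C C0 by (intro AE_I2) (auto simp: p_def indicator_def intro!: power_mono)
  qed simp
  \<comment> \<open>The squared norm of the cut-off is its pairing with \<open>h\<close>, hence the
    pairing of \<open>H\<close> with its transform. Cauchy-Schwarz and the isometry leave one factor
    \<open>l2_norm \<mu> (p n)\<close> to cancel.\<close>
  have le: "l2_norm \<mu> (p n) \<le> l2_norm \<mu>d H" for n
  proof -
    have "of_real ((l2_norm \<mu> (p n))\<^sup>2) = l2_inner \<mu> (p n) (p n)" by (simp add: l2_inner_self)
    also have "\<dots> = (LINT x|\<mu>. inverse_fourier H x * cnj (p n x))"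
      unfolding l2_inner_def by (intro Bochner_Integration.integral_cong) (auto simp: p_def h_def indicator_def)
    also have "\<dots> = l2_inner \<mu>d H (fourier_L1 \<mu> (p n))"
      unfolding l2_inner_def by (rule inverse_fourier_pairing[OF H(1) p1])
    finally have "cmod (of_real ((l2_norm \<mu> (p n))\<^sup>2)) \<le> l2_norm \<mu>d H * l2_norm \<mu>d (fourier_L1 \<mu> (p n))"
      using l2_inner_le[OF H(2) fourier_L1_L2(1)[OF p1 p2]] by simp
    then have "l2_norm \<mu> (p n) * l2_norm \<mu> (p n) \<le> l2_norm \<mu>d H * l2_norm \<mu> (p n)"
      unfolding fourier_L1_L2(2)[OF p1 p2] norm_of_real by (simp add: power2_eq_square)
    then show ?thesis
      by (cases "l2_norm \<mu> (p n) = 0") (auto simp: less_le dest: mult_right_le_imp_le)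
  qed
  \<comment> \<open>At each point the cut-offs eventually equal \<open>h\<close>, so Fatou's lemma
    passes the uniform bound on to \<open>h\<close>.\<close>
  have "(\<integral>\<^sup>+x. ennreal ((cmod (h x))\<^sup>2) \<partial>\<mu>) = (\<integral>\<^sup>+x. liminf (\<lambda>n. ennreal ((cmod (p n x))\<^sup>2)) \<partial>\<mu>)"
  proof (intro nn_integral_cong)
    fix x
    obtain i where "x \<in> A i" using A(2) by auto
    then have "\<forall>\<^sub>F n in sequentially. ennreal ((cmod (p n x))\<^sup>2) = ennreal ((cmod (h x))\<^sup>2)"
      using A(4) by (auto simp: eventually_sequentially p_def indicator_def incseq_def intro!: exI[of _ i])
    from lim_imp_Liminf[OF sequentially_bot tendsto_eventually[OF this]]
    show "ennreal ((cmod (h x))\<^sup>2) = liminf (\<lambda>n. ennreal ((cmod (p n x))\<^sup>2))" by simp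
  qed
  also have "\<dots> \<le> liminf (\<lambda>n. \<integral>\<^sup>+x. ennreal ((cmod (p n x))\<^sup>2) \<partial>\<mu>)"
    by (rule nn_integral_liminf) measurable
  also have "\<dots> \<le> ennreal ((l2_norm \<mu>d H)\<^sup>2)"
    using le by (intro Liminf_le always_eventually allI) (auto simp: nn_integral_L2[OF p2] intro!: ennreal_leI power_mono)
  finally show ?thesis
    unfolding L2_iff_nn_integral h_def[symmetric] by (auto simp: le_less_trans)
qed

text \<open>If the inverse transform is square-integrable, transforming it back returns
  \<open>H\<close> and the isometry applies. Otherwise \<open>inverse_fourier_L2\<close> excludes
  \<open>H\<close> from \<open>L2\<close> as well, and both sides are infinite.\<close>

theorem inverse_fourier_plancherel:
  assumes H: "integrable \<mu>d H"
  shows "(\<integral>\<^sup>+x. ennreal ((cmod (inverse_fourier H x))\<^sup>2) \<partial>\<mu>) = (\<integral>\<^sup>+\<xi>. ennreal ((cmod (H \<xi>))\<^sup>2) \<partial>\<mu>d)"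
proof -
  have Hm: "H \<in> borel_measurable \<mu>d" using H by simp
  show ?thesis
  proof (cases "inverse_fourier H \<in> L2 \<mu>")
    case True
    have "(\<integral>\<^sup>+x. ennreal ((cmod (inverse_fourier H x))\<^sup>2) \<partial>\<mu>) = ennreal ((l2_norm \<mu> (inverse_fourier H))\<^sup>2)"
      by (rule nn_integral_L2[OF True])
    also have "\<dots> = (\<integral>\<^sup>+\<xi>. ennreal ((cmod (fourier \<mu> \<mu>d (inverse_fourier H) \<xi>))\<^sup>2) \<partial>\<mu>d)"
      by (simp add: nn_integral_L2[OF fourier_in_L2[OF True]] l2_norm_fourier[OF True])
    also have "\<dots> = (\<integral>\<^sup>+\<xi>. ennreal ((cmod (H \<xi>))\<^sup>2) \<partial>\<mu>d)"
      by (rule nn_integral_cong_AE) (use fourier_inverse_fourier[OF H True] in \<open>auto elim!: eventually_mono\<close>)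
    finally show ?thesis .
  next
    case False
    then have "H \<notin> L2 \<mu>d" using inverse_fourier_L2[OF H] by auto
    then show ?thesis using False inverse_fourier_measurable[OF Hm] Hm
      by (simp add: L2_iff_nn_integral not_less top_unique)
  qed
qed

end

section \<open>Separability and measurable selection\<close>

context plancherel_pair
begin

lemma l2_norm_indicator_diff:
  assumes "B \<in> sets \<mu>" "W \<in> sets \<mu>" "emeasure \<mu> B < \<infinity>" "emeasure \<mu> W < \<infinity>"
  shows "(l2_norm \<mu> (\<lambda>x. indicator B x - indicator W x))\<^sup>2 = measure \<mu> (B - W) + measure \<mu> (W - B)"
proof -
  have f: "emeasure \<mu> (B - W) < \<infinity>" "emeasure \<mu> (W - B) < \<infinity>"
    using assms emeasure_mono[of "B - W" B \<mu>] emeasure_mono[of "W - B" W \<mu>] by (auto simp: le_less_trans)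
  have "(l2_norm \<mu> (\<lambda>x. indicator B x - indicator W x))\<^sup>2
      = (LINT x|\<mu>. indicator (B - W) x + indicator (W - B) x)"
    unfolding l2_norm_power2 by (intro Bochner_Integration.integral_cong) (auto simp: indicator_def)
  also have "\<dots> = measure \<mu> (B - W) + measure \<mu> (W - B)"
    using f assms by (subst Bochner_Integration.integral_add) auto
  finally show ?thesis .
qed

text \<open>Outer regularity encloses \<open>B\<close> in an open \<open>U\<close> at a cost below
  \<open>e/2\<close>; finite unions of basic sets then exhaust \<open>U\<close> up to another
  \<open>e/2\<close>.\<close>

lemma approx_by_basic_open:
  assumes \<V>: "countable \<V>" "\<And>V. V \<in> \<V> \<Longrightarrow> open V \<and> emeasure \<mu> V < \<infinity>"
    "\<And>x U. open U \<Longrightarrow> x \<in> U \<Longrightarrow> \<exists>V\<in>\<V>. x \<in> V \<and> V \<subseteq> U"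
    and B: "B \<in> sets \<mu>" "emeasure \<mu> B < \<infinity>" and "e > 0"
  obtains F where "finite F" "F \<subseteq> \<V>" "(l2_norm \<mu> (\<lambda>x. indicator B x - indicator (\<Union>F) x))\<^sup>2 < e"
proof -
  have "emeasure \<mu> B < emeasure \<mu> B + ennreal (e/2)"
    using B(2) \<open>e > 0\<close>
    by (cases "emeasure \<mu> B" rule: ennreal_cases) (auto simp: ennreal_plus[symmetric] ennreal_less_iff simp del: ennreal_plus)
  then have "(INF U\<in>{U. open U \<and> B \<subseteq> U}. emeasure \<mu> U) < emeasure \<mu> B + ennreal (e/2)"
    using radon_measure_outer_regular[of \<mu> B] haar B(1) by (simp add: haar_measure_def)
  then obtain U where U: "open U" "B \<subseteq> U" "emeasure \<mu> U < emeasure \<mu> B + ennreal (e/2)"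
    by (auto simp: INF_less_iff)
  have Ufin: "emeasure \<mu> U < \<infinity>" using U(3) by (rule order_less_le_trans) simp
  have Um: "U \<in> sets \<mu>" using U by simp
  have mU: "measure \<mu> U < measure \<mu> B + e/2"
  proof -
    have "ennreal (measure \<mu> U) < ennreal (measure \<mu> B + e/2)"
      using U(3) Ufin B(2) \<open>e > 0\<close> by (simp add: emeasure_eq_ennreal_measure ennreal_plus less_top)
    then show ?thesis by (simp add: ennreal_less_iff)
  qed
  \<comment> \<open>The empty set makes the family nonempty, so that \<open>from_nat_into\<close>
    enumerates all of it. It is removed again in the end, as it need not belong to
    \<open>\<V>\<close>.\<close>
  define G where "G = insert {} {V\<in>\<V>. V \<subseteq> U}"
  have G: "countable G" "G \<noteq> {}" unfolding G_def
    using countable_subset[OF _ \<V>(1), of "{V\<in>\<V>. V \<subseteq> U}"] by auto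
  define v where "v = from_nat_into G"
  have v: "range v = G" unfolding v_def by (rule range_from_nat_into[OF G(2,1)])
  then have vG: "v i \<in> G" for i by auto
  define W where "W n = (\<Union>i<n. v i)" for n :: nat
  have open_v: "open (v i)" for i using vG[of i] \<V>(2) by (auto simp: G_def)
  then have Wm: "W n \<in> sets \<mu>" for n unfolding W_def by auto
  have "(\<Union>n. W n) = \<Union>G" unfolding W_def v[symmetric] by auto
  also have "\<dots> = U" using \<V>(3)[OF U(1)] unfolding G_def by blast
  finally have WU: "(\<Union>n. W n) = U" .
  have "incseq W" unfolding W_def incseq_def by (auto intro: less_le_trans)
  then have "(\<lambda>n. measure \<mu> (W n)) \<longlonglongrightarrow> measure \<mu> (\<Union>n. W n)"
    using Wm Ufin unfolding WU[symmetric] by (intro Lim_measure_incseq) auto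
  then have "\<forall>\<^sub>F n in sequentially. measure \<mu> U - e/2 < measure \<mu> (W n)"
    unfolding WU using \<open>e > 0\<close> by (intro order_tendstoD(1)) auto
  then obtain n where n: "measure \<mu> U - e/2 < measure \<mu> (W n)" by (auto simp: eventually_sequentially)
  have WsubU: "W n \<subseteq> U" using WU by auto
  have Wfin: "emeasure \<mu> (W n) < \<infinity>" using emeasure_mono[OF WsubU Um] Ufin by (auto simp: le_less_trans)
  have "(l2_norm \<mu> (\<lambda>x. indicator B x - indicator (W n) x))\<^sup>2 = measure \<mu> (B - W n) + measure \<mu> (W n - B)"
    by (rule l2_norm_indicator_diff[OF B(1) Wm B(2) Wfin])
  also have "\<dots> \<le> measure \<mu> (U - W n) + measure \<mu> (U - B)"
    using U(2) WsubU Um Wm B Ufin emeasure_mono[of "U - W n" U \<mu>] emeasure_mono[of "U - B" U \<mu>]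
    by (intro add_mono measure_mono_fmeasurable) (auto simp: fmeasurable_def le_less_trans)
  also have "\<dots> = (measure \<mu> U - measure \<mu> (W n)) + (measure \<mu> U - measure \<mu> B)"
    using Um Wm B U(2) WsubU Ufin by (simp add: measure_Diff)
  also have "\<dots> < e" using n mU by simp
  finally have *: "(l2_norm \<mu> (\<lambda>x. indicator B x - indicator (W n) x))\<^sup>2 < e" .
  show ?thesis
  proof (rule that[of "v ` {..<n} - {{}}"])
    show "v ` {..<n} - {{}} \<subseteq> \<V>" using vG by (auto simp: G_def)
    have "\<Union> (v ` {..<n} - {{}}) = W n" unfolding W_def by auto
    then show "(l2_norm \<mu> (\<lambda>x. indicator B x - indicator (\<Union> (v ` {..<n} - {{}})) x))\<^sup>2 < e" using * by simp
  qed simp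
qed

text \<open>Three approximations are chained: functions by simple functions, their level sets by
  finite unions of basic open sets, and coefficients by a countable dense set of complex
  numbers.\<close>

theorem L2_separable:
  obtains e :: "nat \<Rightarrow> 'a \<Rightarrow> complex" where "\<And>k. e k \<in> L2 \<mu>"
    "\<And>f \<epsilon>. f \<in> L2 \<mu> \<Longrightarrow> \<epsilon> > 0 \<Longrightarrow> \<exists>k. l2_norm \<mu> (\<lambda>x. f x - e k x) < \<epsilon>"
proof -
  obtain \<V> :: "'a set set" where \<V>: "countable \<V>"
    "\<And>V. V \<in> \<V> \<Longrightarrow> open V \<and> emeasure \<mu> V < \<infinity>"
    "\<And>x U. open U \<Longrightarrow> x \<in> U \<Longrightarrow> \<exists>V\<in>\<V>. x \<in> V \<and> V \<subseteq> U"
    by (rule finite_measure_basis) (rule that)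
  obtain Q :: "complex set" where Q: "countable Q" "\<And>X. open X \<Longrightarrow> X \<noteq> {} \<Longrightarrow> \<exists>d\<in>Q. d \<in> X"
    by (rule countable_dense_setE) (rule that)
  define \<U> where "\<U> = Union ` {F. finite F \<and> F \<subseteq> \<V>}"
  have \<U>: "countable \<U>" unfolding \<U>_def
    by (intro countable_image countable_Collect_finite_subset \<V>(1))
  have U: "U \<in> sets \<mu>" "emeasure \<mu> U < \<infinity>" if UU: "U \<in> \<U>" for U
  proof -
    obtain F where F: "U = \<Union>F" "finite F" "F \<subseteq> \<V>" using UU unfolding \<U>_def by blast
    then have Fm: "F \<subseteq> sets \<mu>" using \<V>(2) by auto
    then show "U \<in> sets \<mu>" using F by (metis sets.finite_Union)
    have "emeasure \<mu> (\<Union>V\<in>F. V) \<le> (\<Sum>V\<in>F. emeasure \<mu> V)"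
      using F Fm by (intro emeasure_subadditive_finite) auto
    also have "\<dots> < \<infinity>" using F \<V>(2) by (auto intro!: ennreal_sum_less_top)
    finally show "emeasure \<mu> U < \<infinity>" using F by simp
  qed
  \<comment> \<open>Combinations are indexed by lists, which makes countability immediate and turns
    addition into concatenation.\<close>
  define S where "S xs x = (\<Sum>(q, U)\<leftarrow>xs. q * indicator U x)" for xs :: "(complex \<times> 'a set) list" and x
  define D where "D = S ` lists (Q \<times> \<U>)"
  have D: "countable D" unfolding D_def using Q(1) \<U> by auto
  have S_L2: "S xs \<in> L2 \<mu>" if "xs \<in> lists (Q \<times> \<U>)" for xs
    using that
  proof (induction xs)
    case Nil
    then show ?case by (simp add: S_def[abs_def])
  next
    case (Cons p xs)
    obtain q U where p: "p = (q, U)" by force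
    have "(\<lambda>x. q * indicator U x + S xs x) \<in> L2 \<mu>"
      using Cons p U indicator_L1_L2(2) by (intro L2_add L2_cmult) auto
    then show ?case by (simp add: S_def[abs_def] p)
  qed
  then have D_L2: "d \<in> L2 \<mu>" if "d \<in> D" for d using that by (auto simp: D_def)
  \<comment> \<open>Membership in the closure of \<open>D\<close>. It holds for scaled indicators of
    sets of finite measure and is stable under sums, which covers the simple functions that are
    used.\<close>
  define Cl where "Cl f \<longleftrightarrow> f \<in> L2 \<mu> \<and> (\<forall>\<epsilon>>0. \<exists>d\<in>D. l2_norm \<mu> (\<lambda>x. f x - d x) < \<epsilon>)" for f
  have ClD: "\<exists>d\<in>D. l2_norm \<mu> (\<lambda>x. f x - d x) < \<epsilon>" if "Cl f" "\<epsilon> > 0" for f \<epsilon>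
    using that by (simp add: Cl_def)
  have zero: "Cl (\<lambda>x. 0)"
  proof -
    have "S [] \<in> D" unfolding D_def by (rule imageI) simp
    then have "(\<lambda>x. 0) \<in> D" by (simp add: S_def[abs_def])
    then show ?thesis unfolding Cl_def by (auto intro!: bexI[of _ "\<lambda>x. 0"] simp: l2_norm_def)
  qed
  have add: "Cl (\<lambda>x. f x + g x)" if fC: "Cl f" and gC: "Cl g" for f g
    unfolding Cl_def
  proof (intro conjI allI impI)
    have fg: "f \<in> L2 \<mu>" "g \<in> L2 \<mu>" using fC gC by (auto simp: Cl_def)
    then show "(\<lambda>x. f x + g x) \<in> L2 \<mu>" by auto
    fix \<epsilon> :: real assume "\<epsilon> > 0"
    then have "\<epsilon> / 2 > 0" by simp
    from ClD[OF fC this] ClD[OF gC this] obtain d d' where d: "d \<in> D"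
      "l2_norm \<mu> (\<lambda>x. f x - d x) < \<epsilon>/2" "d' \<in> D" "l2_norm \<mu> (\<lambda>x. g x - d' x) < \<epsilon>/2"
      by (elim bexE)
    from d(1,3) obtain xs ys where xy: "d = S xs" "xs \<in> lists (Q \<times> \<U>)" "d' = S ys" "ys \<in> lists (Q \<times> \<U>)"
      unfolding D_def by (elim imageE)
    have eq: "S (xs @ ys) = (\<lambda>x. d x + d' x)" unfolding xy by (simp add: S_def[abs_def])
    have "S (xs @ ys) \<in> D" unfolding D_def using xy by (intro imageI) auto
    moreover have "l2_norm \<mu> (\<lambda>x. (f x + g x) - S (xs @ ys) x) < \<epsilon>"
    proof -
      have "(\<lambda>x. (f x + g x) - S (xs @ ys) x) = (\<lambda>x. (f x - d x) + (g x - d' x))" unfolding eq by (simp add: algebra_simps)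
      then show ?thesis
        using l2_norm_triangle[OF L2_diff[OF fg(1) D_L2[OF d(1)]] L2_diff[OF fg(2) D_L2[OF d(3)]]] d(2,4) by simp
    qed
    ultimately show "\<exists>d\<in>D. l2_norm \<mu> (\<lambda>x. (f x + g x) - d x) < \<epsilon>" by blast
  qed
  have ind: "Cl (\<lambda>x. c * indicator B x)" if B: "B \<in> sets \<mu>" "emeasure \<mu> B < \<infinity>" for c B
    unfolding Cl_def
  proof (intro conjI allI impI)
    note BL = indicator_L1_L2(2)[OF B]
    show "(\<lambda>x. c * indicator B x) \<in> L2 \<mu>" using BL by auto
    fix \<epsilon> :: real assume \<epsilon>: "\<epsilon> > 0"
    \<comment> \<open>\<open>r\<close> and the later \<open>t\<close> bound the errors from the set
      and from the coefficient by \<open>\<epsilon> / 3\<close> each; the summands 1 avoid division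
      by zero.\<close>
    define r where "r = \<epsilon> / (3 * (cmod c + 1))"
    have "0 < cmod c + 1" by (simp add: add_nonneg_pos)
    then have r: "r > 0" "cmod c * r \<le> \<epsilon> / 3" using \<epsilon> by (auto simp: r_def field_simps)
    have "r\<^sup>2 > 0" using r(1) by simp
    obtain F where F: "finite F" "F \<subseteq> \<V>" "(l2_norm \<mu> (\<lambda>x. indicator B x - indicator (\<Union>F) x))\<^sup>2 < r\<^sup>2"
      by (rule approx_by_basic_open[OF \<V> B \<open>r\<^sup>2 > 0\<close>])
    define W where "W = \<Union>F"
    have W: "W \<in> \<U>" unfolding W_def \<U>_def using F by auto
    note WL = indicator_L1_L2(2)[OF U[OF W]]
    have n1: "l2_norm \<mu> (\<lambda>x. indicator B x - indicator W x) < r"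
      unfolding W_def by (rule power2_less_imp_less[OF F(3) less_imp_le[OF r(1)]])
    define t where "t = \<epsilon> / (3 * (l2_norm \<mu> (indicator W) + 1))"
    have "0 < l2_norm \<mu> (indicator W) + 1" by (simp add: add_nonneg_pos)
    then have t: "t > 0" "t * l2_norm \<mu> (indicator W) \<le> \<epsilon> / 3" using \<epsilon> by (auto simp: t_def field_simps)
    have "ball c t \<noteq> {}" using t(1) by simp
    then obtain q where q: "q \<in> Q" "cmod (c - q) < t" using Q(2)[of "ball c t"] by (auto simp: dist_norm)
    have "S [(q, W)] \<in> D" unfolding D_def using q W by (intro imageI) auto
    moreover have "l2_norm \<mu> (\<lambda>x. c * indicator B x - S [(q, W)] x) < \<epsilon>"
    proof -
      have "(\<lambda>x. c * indicator B x - S [(q, W)] x) = (\<lambda>x. c * (indicator B x - indicator W x) + (c - q) * indicator W x)"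
        by (simp add: S_def algebra_simps)
      then have "l2_norm \<mu> (\<lambda>x. c * indicator B x - S [(q, W)] x)
          \<le> cmod c * l2_norm \<mu> (\<lambda>x. indicator B x - indicator W x) + cmod (c - q) * l2_norm \<mu> (indicator W)"
        using l2_norm_triangle[OF L2_cmult[OF L2_diff[OF BL WL], of c] L2_cmult[OF WL, of "c - q"]]
        by (simp only: l2_norm_cmult)
      moreover have "cmod c * l2_norm \<mu> (\<lambda>x. indicator B x - indicator W x) \<le> \<epsilon> / 3"
        using mult_left_mono[OF less_imp_le[OF n1], of "cmod c"] r(2) by simp
      moreover have "cmod (c - q) * l2_norm \<mu> (indicator W) \<le> t * l2_norm \<mu> (indicator W)"
        using q(2) by (intro mult_right_mono) auto
      ultimately show ?thesis using \<epsilon> t(2) by linarith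
    qed
    ultimately show "\<exists>d\<in>D. l2_norm \<mu> (\<lambda>x. c * indicator B x - d x) < \<epsilon>" by blast
  qed
  have sum: "Cl (\<lambda>x. \<Sum>y\<in>Y. g y x)" if "finite Y" "\<And>y. y \<in> Y \<Longrightarrow> Cl (g y)" for g :: "complex \<Rightarrow> 'a \<Rightarrow> complex" and Y
    using that by (induction Y) (auto simp: zero intro!: add)
  have Cl_all: "\<exists>d\<in>D. l2_norm \<mu> (\<lambda>x. f x - d x) < \<epsilon>" if f: "f \<in> L2 \<mu>" "\<epsilon> > 0" for f \<epsilon>
  proof -
    have "\<epsilon> / 2 > 0" using f(2) by simp
    with f(1) obtain s where s: "simple_function \<mu> s" "s \<in> L2 \<mu>"
      "\<And>y. y \<noteq> 0 \<Longrightarrow> emeasure \<mu> {x\<in>space \<mu>. s x = y} < \<infinity>" "l2_norm \<mu> (\<lambda>x. s x - f x) < \<epsilon>/2"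
      by (rule L2_simple_approx) (rule that)
    \<comment> \<open>The value 0 is left out of the sum, since its level set may have infinite
      measure.\<close>
    have "Cl (\<lambda>x. \<Sum>y\<in>range s - {0}. y * indicator {x. s x = y} x)"
    proof (rule sum)
      show "finite (range s - {0})" using s(1) by (simp add: simple_function_def)
      fix y assume "y \<in> range s - {0}"
      moreover have "{x\<in>space \<mu>. s x = y} \<in> sets \<mu>" using L2D(1)[OF s(2)] by measurable
      ultimately show "Cl (\<lambda>x. y * indicator {x. s x = y} x)" using s(3)[of y] by (intro ind) auto
    qed
    moreover have "(\<Sum>y\<in>range s - {0}. y * indicator {x. s x = y} x) = s x" for x
    proof -
      have "(\<Sum>y\<in>range s - {0}. y * indicator {x. s x = y} x) = (\<Sum>y\<in>range s - {0}. if y = s x then y else 0)"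
        by (intro sum.cong) (auto simp: indicator_def)
      then show ?thesis using s(1) by (auto simp: simple_function_def sum.delta)
    qed
    ultimately have "Cl s" by simp
    from ClD[OF this \<open>\<epsilon> / 2 > 0\<close>] obtain d where d: "d \<in> D" "l2_norm \<mu> (\<lambda>x. s x - d x) < \<epsilon>/2"
      by (elim bexE)
    have "l2_norm \<mu> (\<lambda>x. f x - d x) \<le> l2_norm \<mu> (\<lambda>x. f x - s x) + l2_norm \<mu> (\<lambda>x. s x - d x)"
      by (rule l2_norm_triangle_diff[OF f(1) s(2) D_L2[OF d(1)]])
    also have "\<dots> < \<epsilon>" using d(2) s(4) l2_norm_minus_commute[of \<mu> f s] by simp
    finally show ?thesis using d(1) by blast
  qed
  have "D \<noteq> {}" using zero unfolding Cl_def by (auto dest!: spec[of _ 1])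
  have rD: "range (from_nat_into D) = D" by (rule range_from_nat_into[OF \<open>D \<noteq> {}\<close> D])
  show ?thesis
  proof (rule that[of "from_nat_into D"])
    show "from_nat_into D k \<in> L2 \<mu>" for k using D_L2 from_nat_into[OF \<open>D \<noteq> {}\<close>] by auto
    show "\<exists>k. l2_norm \<mu> (\<lambda>x. f x - from_nat_into D k x) < \<epsilon>" if fe: "f \<in> L2 \<mu>" "\<epsilon> > 0" for f \<epsilon>
    proof -
      from Cl_all[OF fe] obtain d where d: "d \<in> D" "l2_norm \<mu> (\<lambda>x. f x - d x) < \<epsilon>" by (elim bexE)
      obtain k where "d = from_nat_into D k" using d(1) rD by auto
      with d(2) show ?thesis by auto
    qed
  qed
qed

end

text \<open>A bound on the norm becomes countably many conditions on inner products, which weak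
  measurability can handle. For the converse direction, \<open>v\<close> itself is approximated by
  some \<open>e k\<close>. Products instead of quotients admit an \<open>e k\<close> of norm
  0.\<close>

lemma l2_norm_le_iff_dense:
  assumes e: "\<And>k :: nat. e k \<in> L2 M"
    and dense: "\<And>f \<epsilon>. f \<in> L2 M \<Longrightarrow> \<epsilon> > 0 \<Longrightarrow> \<exists>k. l2_norm M (\<lambda>x. f x - e k x) < \<epsilon>"
    and v: "v \<in> L2 M" and r: "r \<ge> 0"
  shows "l2_norm M v \<le> r \<longleftrightarrow> (\<forall>k. cmod (l2_inner M (e k) v) \<le> r * l2_norm M (e k))"
proof
  assume le: "l2_norm M v \<le> r"
  show "\<forall>k. cmod (l2_inner M (e k) v) \<le> r * l2_norm M (e k)"
  proof
    fix k
    have "cmod (l2_inner M (e k) v) \<le> l2_norm M (e k) * l2_norm M v" by (rule l2_inner_le[OF e v])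
    also have "\<dots> \<le> r * l2_norm M (e k)" using le by (simp add: mult.commute mult_right_mono)
    finally show "cmod (l2_inner M (e k) v) \<le> r * l2_norm M (e k)" .
  qed
next
  assume le: "\<forall>k. cmod (l2_inner M (e k) v) \<le> r * l2_norm M (e k)"
  define n where "n = l2_norm M v"
  have n0: "n \<ge> 0" by (simp add: n_def)
  have "n * n \<le> r * n + d" if "d > 0" for d
  proof -
    \<comment> \<open>Chosen so that the total error \<open>\<epsilon> * (r + n)\<close> stays below
      \<open>d\<close>; the summand 1 keeps the denominator positive.\<close>
    define \<epsilon> where "\<epsilon> = d / (r + n + 1)"
    have "r + n + 1 > 0" using r n0 by simp
    then have \<epsilon>: "\<epsilon> > 0" "\<epsilon> * (r + n) \<le> d" using that r n0 by (auto simp: \<epsilon>_def field_simps)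
    from dense[OF v \<epsilon>(1)] obtain k where k: "l2_norm M (\<lambda>x. v x - e k x) < \<epsilon>" by (elim exE)
    have ek: "l2_norm M (e k) \<le> n + \<epsilon>"
      using l2_norm_diff_le[OF v e, of k] k by (simp add: n_def)
    have "n * n = cmod (l2_inner M v v)" by (simp add: l2_inner_self n_def power2_eq_square norm_mult)
    also have "l2_inner M v v = l2_inner M (\<lambda>x. v x - e k x) v + l2_inner M (e k) v"
      by (simp add: l2_inner_diff_left[OF v e v])
    also have "cmod \<dots> \<le> cmod (l2_inner M (\<lambda>x. v x - e k x) v) + cmod (l2_inner M (e k) v)"
      by (rule norm_triangle_ineq)
    also have "\<dots> \<le> \<epsilon> * n + r * (n + \<epsilon>)"
    proof (rule add_mono)
      have "cmod (l2_inner M (\<lambda>x. v x - e k x) v) \<le> l2_norm M (\<lambda>x. v x - e k x) * l2_norm M v"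
        by (rule l2_inner_le[OF L2_diff[OF v e] v])
      also have "\<dots> \<le> \<epsilon> * n" using k unfolding n_def by (intro mult_right_mono) auto
      finally show "cmod (l2_inner M (\<lambda>x. v x - e k x) v) \<le> \<epsilon> * n" .
      show "cmod (l2_inner M (e k) v) \<le> r * (n + \<epsilon>)"
        using spec[OF le, of k] mult_left_mono[OF ek r] by simp
    qed
    also have "\<dots> \<le> r * n + d" using \<epsilon>(2) by (simp add: algebra_simps)
    finally show ?thesis .
  qed
  then have "n * n \<le> r * n" by (rule field_le_epsilon)
  then have "n \<le> r" using n0 r by (cases "n = 0") (auto simp: mult_le_cancel_right)
  then show "l2_norm M v \<le> r" by (simp add: n_def)
qed

text \<open>Approximating \<open>\<psi> l\<close> by the first sufficiently close member of a dense sequence is a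
  measurable selection, because the norm is a countable supremum of weak evaluations.\<close>

lemma (in plancherel_pair) jointly_measurable_fourier:
  assumes \<nu>: "sets \<nu> = sets borel" and \<psi>: "\<And>l. \<psi> l \<in> L2 \<mu>" and weak: "weakly_borel_measurable \<mu> \<psi>"
  obtains \<Phi> where "(\<lambda>p. \<Phi> (fst p) (snd p)) \<in> borel_measurable (\<nu> \<Otimes>\<^sub>M \<mu>d)"
    "\<And>l. AE \<xi> in \<mu>d. \<Phi> l \<xi> = fourier \<mu> \<mu>d (\<psi> l) \<xi>"
proof -
  obtain e :: "nat \<Rightarrow> 'a \<Rightarrow> complex" where e: "\<And>k. e k \<in> L2 \<mu>"
    and dense: "\<And>f \<epsilon>. f \<in> L2 \<mu> \<Longrightarrow> \<epsilon> > 0 \<Longrightarrow> \<exists>k. l2_norm \<mu> (\<lambda>x. f x - e k x) < \<epsilon>"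
    by (rule L2_separable) (rule that)
  \<comment> \<open>The non-strict inequality matches \<open>l2_norm_le_iff_dense\<close>, and the
    rate \<open>(1/4)^n\<close> yields almost everywhere convergence of the transforms.\<close>
  define k where "k n l = (LEAST k. l2_norm \<mu> (\<lambda>x. \<psi> l x - e k x) \<le> (1/4)^n)" for n :: nat and l
  have inner [measurable]: "(\<lambda>l. l2_inner \<mu> f (\<psi> l)) \<in> borel_measurable \<nu>" if "f \<in> L2 \<mu>" for f
    using weak that \<nu> unfolding weakly_borel_measurable_def by (simp cong: measurable_cong_sets)
  have "Measurable.pred \<nu> (\<lambda>l. l2_norm \<mu> (\<lambda>x. \<psi> l x - e k x) \<le> (1/4)^n)" for k and n :: nat
  proof -
    have "l2_norm \<mu> (\<lambda>x. \<psi> l x - e k x) \<le> (1/4)^n \<longleftrightarrow>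
        (\<forall>j. cmod (l2_inner \<mu> (e j) (\<psi> l) - l2_inner \<mu> (e j) (e k)) \<le> (1/4)^n * l2_norm \<mu> (e j))" for l
      using l2_norm_le_iff_dense[OF e dense L2_diff[OF \<psi> e], of "(1/4)^n" l k]
      unfolding l2_inner_diff_right[OF \<psi> e e] by simp
    moreover have "Measurable.pred \<nu> (\<lambda>l. \<forall>j. cmod (l2_inner \<mu> (e j) (\<psi> l) - l2_inner \<mu> (e j) (e k)) \<le> (1/4)^n * l2_norm \<mu> (e j))"
      using inner[OF e] by measurable
    ultimately show ?thesis by simp
  qed
  then have km: "k n \<in> measurable \<nu> (count_space UNIV)" for n
    unfolding k_def by (rule measurable_Least)
  have k_close: "l2_norm \<mu> (\<lambda>x. \<psi> l x - e (k n l) x) \<le> (1/4)^n" for l n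
  proof -
    have "\<exists>k. l2_norm \<mu> (\<lambda>x. \<psi> l x - e k x) < (1/4)^n" by (rule dense[OF \<psi>]) simp
    then have "\<exists>k. l2_norm \<mu> (\<lambda>x. \<psi> l x - e k x) \<le> (1/4)^n" using less_imp_le by blast
    then show ?thesis unfolding k_def by (rule LeastI_ex)
  qed
  \<comment> \<open>A pointwise \<open>lim\<close> of measurable functions is measurable whether or
    not it converges; for each \<open>l\<close>, convergence is established for almost every
    \<open>\<xi>\<close>.\<close>
  define \<Phi> where "\<Phi> l \<xi> = lim (\<lambda>n. fourier \<mu> \<mu>d (e (k n l)) \<xi>)" for l \<xi>
  show ?thesis
  proof (rule that[of \<Phi>])
    have "(\<lambda>p. fourier \<mu> \<mu>d (e (k n (fst p))) (snd p)) \<in> borel_measurable (\<nu> \<Otimes>\<^sub>M \<mu>d)" for n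
    proof (rule measurable_compose_countable)
      show "(\<lambda>p. fourier \<mu> \<mu>d (e i) (snd p)) \<in> borel_measurable (\<nu> \<Otimes>\<^sub>M \<mu>d)" for i
        using L2D(1)[OF fourier_in_L2[OF e]] by measurable
      show "(\<lambda>p. k n (fst p)) \<in> measurable (\<nu> \<Otimes>\<^sub>M \<mu>d) (count_space UNIV)" using km by measurable
    qed
    then show "(\<lambda>p. \<Phi> (fst p) (snd p)) \<in> borel_measurable (\<nu> \<Otimes>\<^sub>M \<mu>d)"
      unfolding \<Phi>_def by measurable
    fix l
    have "AE \<xi> in \<mu>d. (\<lambda>n. fourier \<mu> \<mu>d (e (k n l)) \<xi>) \<longlonglongrightarrow> fourier \<mu> \<mu>d (\<psi> l) \<xi>"
    proof (rule AE_tendsto_of_fast_L2[where C = 1])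
      show "l2_norm \<mu>d (\<lambda>\<xi>. fourier \<mu> \<mu>d (e (k n l)) \<xi> - fourier \<mu> \<mu>d (\<psi> l) \<xi>) \<le> 1 * (1/4)^n" for n
        using is_fourier_L2_dist[OF is_fourier_L2_fourier[OF e] is_fourier_L2_fourier[OF \<psi>] e \<psi>, of "k n l" l]
          k_close[of l n] l2_norm_minus_commute[of \<mu> "\<psi> l"] by simp
    qed (use e \<psi> in auto)
    then show "AE \<xi> in \<mu>d. \<Phi> l \<xi> = fourier \<mu> \<mu>d (\<psi> l) \<xi>"
      by eventually_elim (auto simp: \<Phi>_def intro: limI)
  qed
qed

section \<open>Wavelet transforms\<close>

context plancherel_pair
begin

lemma integrable_fourier_mult:
  assumes "f \<in> L2 \<mu>" "p \<in> L2 \<mu>"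
  shows "integrable \<mu>d (\<lambda>\<xi>. fourier \<mu> \<mu>d f \<xi> * cnj (fourier \<mu> \<mu>d p \<xi>))"
  using assms by (intro integrable_L2_mult fourier_in_L2)

lemma convolution_involution:
  assumes "f \<in> L2 \<mu>" "p \<in> L2 \<mu>"
  shows "convolution \<mu> f (involution p) = inverse_fourier (\<lambda>\<xi>. fourier \<mu> \<mu>d f \<xi> * cnj (fourier \<mu> \<mu>d p \<xi>))"
  using convolution_eq_inverse_fourier[OF assms] by (simp add: inverse_fourier_def fun_eq_iff)

lemma convolution_measurable:
  assumes "f \<in> L2 \<mu>" "p \<in> L2 \<mu>"
  shows "convolution \<mu> f (involution p) \<in> borel_measurable \<mu>"
  unfolding convolution_involution[OF assms]
  using integrable_fourier_mult[OF assms] by (intro inverse_fourier_measurable) auto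

lemma nn_integral_convolution:
  assumes "f \<in> L2 \<mu>" "p \<in> L2 \<mu>"
  shows "(\<integral>\<^sup>+x. ennreal ((cmod (convolution \<mu> f (involution p) x))\<^sup>2) \<partial>\<mu>)
    = (\<integral>\<^sup>+\<xi>. ennreal ((cmod (fourier \<mu> \<mu>d f \<xi>))\<^sup>2 * (cmod (fourier \<mu> \<mu>d p \<xi>))\<^sup>2) \<partial>\<mu>d)"
  unfolding convolution_involution[OF assms] inverse_fourier_plancherel[OF integrable_fourier_mult[OF assms]]
  by (simp add: norm_mult power_mult_distrib)

text \<open>Square-integrability of the convolution is assumed because \<open>l2_norm\<close>
  defaults to 0 on a measurable function outside \<open>L2\<close>, where the choice made by
  \<open>fourier\<close> carries no information.\<close>

lemma fourier_convolution:
  assumes "f \<in> L2 \<mu>" "p \<in> L2 \<mu>" "convolution \<mu> f (involution p) \<in> L2 \<mu>"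
  shows "AE \<xi> in \<mu>d. fourier \<mu> \<mu>d (convolution \<mu> f (involution p)) \<xi>
    = fourier \<mu> \<mu>d f \<xi> * cnj (fourier \<mu> \<mu>d p \<xi>)"
  using fourier_inverse_fourier[OF integrable_fourier_mult[OF assms(1,2)]] assms(3)
  unfolding convolution_involution[OF assms(1,2)] by simp

text \<open>An essentially bounded transform of \<open>p\<close> keeps the product of transforms in
  \<open>L2\<close>. For phase retrieval this makes the transforms of the convolutions meaningful
  and the spectral integrals finite.\<close>

lemma convolution_Linf:
  assumes f: "f \<in> L2 \<mu>" and p: "p \<in> L2 \<mu>" and bdd: "fourier \<mu> \<mu>d p \<in> Linf \<mu>d"
  shows "convolution \<mu> f (involution p) \<in> L2 \<mu>"
    "integrable \<mu>d (\<lambda>\<xi>. (cmod (fourier \<mu> \<mu>d f \<xi>))\<^sup>2 * (cmod (fourier \<mu> \<mu>d p \<xi>))\<^sup>2)"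
proof -
  obtain C where C: "AE \<xi> in \<mu>d. cmod (fourier \<mu> \<mu>d p \<xi>) \<le> C" using bdd unfolding Linf_def by auto
  note fF = L2D[OF fourier_in_L2[OF f]] and pF = L2D[OF fourier_in_L2[OF p]]
  show int: "integrable \<mu>d (\<lambda>\<xi>. (cmod (fourier \<mu> \<mu>d f \<xi>))\<^sup>2 * (cmod (fourier \<mu> \<mu>d p \<xi>))\<^sup>2)"
  proof (rule Bochner_Integration.integrable_bound)
    show "integrable \<mu>d (\<lambda>\<xi>. (cmod (fourier \<mu> \<mu>d f \<xi>))\<^sup>2 * C\<^sup>2)" using fF(2) by simp
    show "AE \<xi> in \<mu>d. norm ((cmod (fourier \<mu> \<mu>d f \<xi>))\<^sup>2 * (cmod (fourier \<mu> \<mu>d p \<xi>))\<^sup>2)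
        \<le> norm ((cmod (fourier \<mu> \<mu>d f \<xi>))\<^sup>2 * C\<^sup>2)"
      using C by eventually_elim (auto intro!: mult_left_mono power_mono simp: norm_mult)
  qed (use fF(1) pF(1) in measurable)
  then have "(\<integral>\<^sup>+\<xi>. ennreal ((cmod (fourier \<mu> \<mu>d f \<xi>))\<^sup>2 * (cmod (fourier \<mu> \<mu>d p \<xi>))\<^sup>2) \<partial>\<mu>d) < \<infinity>"
    by (simp add: integrable_iff_bounded norm_mult)
  then show "convolution \<mu> f (involution p) \<in> L2 \<mu>"
    unfolding L2_iff_nn_integral nn_integral_convolution[OF f p]
    using convolution_measurable[OF f p] by simp
qed

text \<open>Integrating the equal moduli over the group gives equal spectral integrals at every
  \<open>l\<close>. Injectivity returns equality of the moduli of the transforms, and the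
  convolution theorem then yields the Fourier half of the second property. The converse merely reads
  off its other half.\<close>

theorem phase_retrieval_reduction:
  assumes \<psi>: "\<And>l. \<psi> l \<in> L2 \<mu>" and inj: "spectral_injectivity \<mu> \<mu>d \<nu> \<psi>"
    and f: "f \<in> L2 \<mu>" and g: "g \<in> L2 \<mu>"
  shows "(\<forall>z. cmod (wavelet_transform \<mu> \<psi> f z) = cmod (wavelet_transform \<mu> \<psi> g z)) \<longleftrightarrow>
         (AE \<xi> in \<mu>d. cmod (fourier \<mu> \<mu>d f \<xi>) = cmod (fourier \<mu> \<mu>d g \<xi>)) \<and>
         (\<forall>l. (\<forall>x. cmod (convolution \<mu> f (involution (\<psi> l)) x) =
                     cmod (convolution \<mu> g (involution (\<psi> l)) x)) \<and>
              (AE \<xi> in \<mu>d.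
                 cmod (fourier \<mu> \<mu>d (convolution \<mu> f (involution (\<psi> l))) \<xi>) =
                 cmod (fourier \<mu> \<mu>d (convolution \<mu> g (involution (\<psi> l))) \<xi>)))"
    (is "?A \<longleftrightarrow> ?B \<and> ?C")
proof
  assume "?B \<and> ?C"
  then have "\<forall>l x. cmod (convolution \<mu> f (involution (\<psi> l)) x) = cmod (convolution \<mu> g (involution (\<psi> l)) x)"
    by simp
  then show ?A by (auto simp: wavelet_transform_def)
next
  assume ?A
  then have eq: "cmod (convolution \<mu> f (involution (\<psi> l)) x) = cmod (convolution \<mu> g (involution (\<psi> l)) x)" for l x
    unfolding wavelet_transform_def by (drule_tac x = "(x, l)" in spec) simp
  have bdd: "fourier \<mu> \<mu>d (\<psi> l) \<in> Linf \<mu>d" for l using inj unfolding spectral_injectivity_def by simp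
  define F G where "F \<xi> = complex_of_real ((cmod (fourier \<mu> \<mu>d f \<xi>))\<^sup>2)"
    and "G \<xi> = complex_of_real ((cmod (fourier \<mu> \<mu>d g \<xi>))\<^sup>2)" for \<xi>
  have FG: "integrable \<mu>d F" "integrable \<mu>d G" unfolding F_def G_def
    using L2D(2)[OF fourier_in_L2[OF f]] L2D(2)[OF fourier_in_L2[OF g]] by (auto intro!: integrable_of_real simp del: of_real_power)
  have "spectral_map \<mu> \<mu>d \<psi> F l = spectral_map \<mu> \<mu>d \<psi> G l" for l
  proof -
    \<comment> \<open>The integral is finite by \<open>convolution_Linf\<close>, so it can be
      recovered from an extended integral that involves only the moduli of the convolution.\<close>
    have *: "(LINT \<xi>|\<mu>d. (cmod (fourier \<mu> \<mu>d h \<xi>))\<^sup>2 * (cmod (fourier \<mu> \<mu>d (\<psi> l) \<xi>))\<^sup>2)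
        = enn2real (\<integral>\<^sup>+x. ennreal ((cmod (convolution \<mu> h (involution (\<psi> l)) x))\<^sup>2) \<partial>\<mu>)"
      if h: "h \<in> L2 \<mu>" for h
      unfolding nn_integral_convolution[OF h \<psi>]
      using convolution_Linf(2)[OF h \<psi> bdd] by (intro integral_eq_nn_integral) auto
    have "(LINT \<xi>|\<mu>d. (cmod (fourier \<mu> \<mu>d f \<xi>))\<^sup>2 * (cmod (fourier \<mu> \<mu>d (\<psi> l) \<xi>))\<^sup>2)
        = (LINT \<xi>|\<mu>d. (cmod (fourier \<mu> \<mu>d g \<xi>))\<^sup>2 * (cmod (fourier \<mu> \<mu>d (\<psi> l) \<xi>))\<^sup>2)"
      unfolding *[OF f] *[OF g] eq ..
    then show ?thesis
      unfolding spectral_map_def F_def G_def of_real_mult[symmetric] integral_complex_of_real by simp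
  qed
  then have "AE \<xi> in \<mu>d. F \<xi> = G \<xi>"
    using inj FG unfolding spectral_injectivity_def by simp
  then have fg: "AE \<xi> in \<mu>d. cmod (fourier \<mu> \<mu>d f \<xi>) = cmod (fourier \<mu> \<mu>d g \<xi>)"
    by eventually_elim (simp add: F_def G_def del: of_real_power)
  have "AE \<xi> in \<mu>d. cmod (fourier \<mu> \<mu>d (convolution \<mu> f (involution (\<psi> l))) \<xi>) =
                 cmod (fourier \<mu> \<mu>d (convolution \<mu> g (involution (\<psi> l))) \<xi>)" for l
    using fg fourier_convolution[OF f \<psi> convolution_Linf(1)[OF f \<psi> bdd], of l]
      fourier_convolution[OF g \<psi> convolution_Linf(1)[OF g \<psi> bdd], of l]
    by eventually_elim (simp add: norm_mult)
  then show "?B \<and> ?C" using fg eq by simp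
qed

end

lemma sigma_finite_radon_measure:
  fixes \<nu> :: "'l::t2_space measure"
  assumes "sigma_compact_space (euclidean :: 'l topology)" "radon_measure \<nu>"
  shows "sigma_finite_measure \<nu>"
proof
  have s: "sets \<nu> = sets borel" using assms(2) unfolding radon_measure_def by (rule conjunct1)
  obtain \<K> :: "'l set set" where K: "countable \<K>" "\<forall>K\<in>\<K>. compact K" "\<Union>\<K> = UNIV"
    using assms(1) by (auto simp: sigma_compact_space_def)
  show "\<exists>A. countable A \<and> A \<subseteq> sets \<nu> \<and> \<Union> A = space \<nu> \<and> (\<forall>a\<in>A. emeasure \<nu> a \<noteq> \<infinity>)"
  proof (intro exI[of _ \<K>] conjI ballI)
    show "\<K> \<subseteq> sets \<nu>" using K(2) compact_imp_closed by (auto simp: s intro!: borel_closed)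
    show "\<Union>\<K> = space \<nu>" using K(3) sets_eq_imp_space_eq[OF s] by simp
    fix K assume "K \<in> \<K>"
    then have "compact K" using K(2) by simp
    from radon_measure_compact_finite[OF assms(2) this compact_imp_closed[OF this]]
    show "emeasure \<nu> K \<noteq> \<infinity>" by simp
  qed (rule K(1))
qed

section \<open>Families over a measured parameter space: Calderon condition, isometry and
  inversion\<close>

locale wavelet_family = plancherel_pair \<mu> \<mu>d
  for \<mu> :: "'a::{topological_ab_group_add,t2_space,second_countable_topology} measure"
    and \<mu>d :: "'a dual measure" +
  fixes \<nu> :: "'l::topological_space measure" and \<psi> :: "'l \<Rightarrow> 'a \<Rightarrow> complex"
  assumes sets_nu [measurable_cong]: "sets \<nu> = sets borel"
    and sigma_finite_nu: "sigma_finite_measure \<nu>"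
    and psi_L2: "\<psi> l \<in> L2 \<mu>"
    and weakly_measurable: "weakly_borel_measurable \<mu> \<psi>"
begin

sublocale nu: sigma_finite_measure \<nu> by (rule sigma_finite_nu)
sublocale nu_mud: pair_sigma_finite \<nu> \<mu>d ..
sublocale mu_nu: pair_sigma_finite \<mu> \<nu> ..

lemma wavelet_transform_lin:
  assumes "f \<in> L2 \<mu>" "g \<in> L2 \<mu>"
  shows "wavelet_transform \<mu> \<psi> (\<lambda>x. a * f x + b * g x)
    = (\<lambda>z. a * wavelet_transform \<mu> \<psi> f z + b * wavelet_transform \<mu> \<psi> g z)"
proof
  fix z :: "'a \<times> 'l"
  obtain x l where z: "z = (x, l)" by force
  note T = translation_L2[OF psi_L2, of x l]
  have "l2_inner \<mu> (\<lambda>x. a * f x + b * g x) (translation x (\<psi> l))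
    = a * l2_inner \<mu> f (translation x (\<psi> l)) + b * l2_inner \<mu> g (translation x (\<psi> l))"
    using integrable_L2_mult(1)[OF assms(1) T] integrable_L2_mult(1)[OF assms(2) T]
    by (simp add: l2_inner_def distrib_right mult.assoc)
  then show "wavelet_transform \<mu> \<psi> (\<lambda>x. a * f x + b * g x) z
    = a * wavelet_transform \<mu> \<psi> f z + b * wavelet_transform \<mu> \<psi> g z"
    by (simp add: z wavelet_transform_eq_inner)
qed

context
  fixes \<Phi> :: "'l \<Rightarrow> 'a dual \<Rightarrow> complex"
  assumes Phi_measurable [measurable]: "(\<lambda>p. \<Phi> (fst p) (snd p)) \<in> borel_measurable (\<nu> \<Otimes>\<^sub>M \<mu>d)"
    and Phi_eq: "\<And>l. AE \<xi> in \<mu>d. \<Phi> l \<xi> = fourier \<mu> \<mu>d (\<psi> l) \<xi>"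
begin

lemma Phi_measurable_snd [measurable]: "\<Phi> l \<in> borel_measurable \<mu>d"
proof -
  have "l \<in> space \<nu>" using sets_eq_imp_space_eq[OF sets_nu] by simp
  from measurable_compose[OF measurable_Pair1'[OF this] Phi_measurable] show ?thesis by simp
qed

text \<open>The convolution does not show joint measurability in \<open>(x, l)\<close>, because
  \<open>\<psi>\<close> is measurable only weakly in \<open>l\<close>. On the Fourier side the
  transform is a parameter integral of a function measurable in all three variables.\<close>

lemma wavelet_transform_measurable_aux:
  assumes f: "f \<in> L2 \<mu>"
  shows "wavelet_transform \<mu> \<psi> f \<in> borel_measurable (\<mu> \<Otimes>\<^sub>M \<nu>)"
proof -
  note [measurable] = L2D(1)[OF fourier_in_L2[OF f]] L2D(1)[OF fourier_in_L2[OF psi_L2]]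
  have "wavelet_transform \<mu> \<psi> f
      = (\<lambda>p. LINT \<xi>|\<mu>d. fourier \<mu> \<mu>d f \<xi> * cnj (\<Phi> (snd p) \<xi>) * char_eval \<xi> (fst p))"
  proof
    fix p
    have "wavelet_transform \<mu> \<psi> f p = (LINT \<xi>|\<mu>d. fourier \<mu> \<mu>d f \<xi> * cnj (fourier \<mu> \<mu>d (\<psi> (snd p)) \<xi>) * char_eval \<xi> (fst p))"
      using convolution_eq_inverse_fourier[OF f psi_L2]
      by (simp add: wavelet_transform_def case_prod_beta')
    also have "\<dots> = (LINT \<xi>|\<mu>d. fourier \<mu> \<mu>d f \<xi> * cnj (\<Phi> (snd p) \<xi>) * char_eval \<xi> (fst p))"
      by (rule integral_cong_AE) (use Phi_eq[of "snd p"] in \<open>auto elim!: eventually_mono\<close>)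
    finally show "wavelet_transform \<mu> \<psi> f p
        = (LINT \<xi>|\<mu>d. fourier \<mu> \<mu>d f \<xi> * cnj (\<Phi> (snd p) \<xi>) * char_eval \<xi> (fst p))" .
  qed
  moreover have "(\<lambda>p. LINT \<xi>|\<mu>d. fourier \<mu> \<mu>d f \<xi> * cnj (\<Phi> (snd p) \<xi>) * char_eval \<xi> (fst p))
      \<in> borel_measurable (\<mu> \<Otimes>\<^sub>M \<nu>)"
  proof (rule mud.borel_measurable_lebesgue_integral)
    have [measurable]: "(\<lambda>q. char_eval (snd q) (fst (fst q))) \<in> borel_measurable ((\<mu> \<Otimes>\<^sub>M \<nu>) \<Otimes>\<^sub>M \<mu>d)"
      using measurable_compose[OF _ char_eval_pair_measurable, of "\<lambda>q. (snd q, fst (fst q))" "(\<mu> \<Otimes>\<^sub>M \<nu>) \<Otimes>\<^sub>M \<mu>d"]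
      by simp
    have [measurable]: "(\<lambda>q. \<Phi> (snd (fst q)) (snd q)) \<in> borel_measurable ((\<mu> \<Otimes>\<^sub>M \<nu>) \<Otimes>\<^sub>M \<mu>d)"
      using measurable_compose[OF _ Phi_measurable, of "\<lambda>q. (snd (fst q), snd q)" "(\<mu> \<Otimes>\<^sub>M \<nu>) \<Otimes>\<^sub>M \<mu>d"]
      by simp
    have "(\<lambda>q. fourier \<mu> \<mu>d f (snd q) * cnj (\<Phi> (snd (fst q)) (snd q)) * char_eval (snd q) (fst (fst q)))
        \<in> borel_measurable ((\<mu> \<Otimes>\<^sub>M \<nu>) \<Otimes>\<^sub>M \<mu>d)" by measurable
    then show "(\<lambda>(p, \<xi>). fourier \<mu> \<mu>d f \<xi> * cnj (\<Phi> (snd p) \<xi>) * char_eval \<xi> (fst p))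
        \<in> borel_measurable ((\<mu> \<Otimes>\<^sub>M \<nu>) \<Otimes>\<^sub>M \<mu>d)"
      by (simp add: case_prod_beta')
  qed
  ultimately show ?thesis by (simp only:)
qed

lemma calderon_measurable [measurable]:
  "(\<lambda>\<xi>. \<integral>\<^sup>+l. ennreal ((cmod (\<Phi> l \<xi>))\<^sup>2) \<partial>\<nu>) \<in> borel_measurable \<mu>d"
proof (rule nu.borel_measurable_nn_integral)
  have [measurable]: "(\<lambda>q. \<Phi> (snd q) (fst q)) \<in> borel_measurable (\<mu>d \<Otimes>\<^sub>M \<nu>)"
    using measurable_compose[OF _ Phi_measurable, of "\<lambda>q. (snd q, fst q)" "\<mu>d \<Otimes>\<^sub>M \<nu>"] by simp
  have "(\<lambda>q. ennreal ((cmod (\<Phi> (snd q) (fst q)))\<^sup>2)) \<in> borel_measurable (\<mu>d \<Otimes>\<^sub>M \<nu>)" by measurable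
  then show "(\<lambda>(\<xi>, l). ennreal ((cmod (\<Phi> l \<xi>))\<^sup>2)) \<in> borel_measurable (\<mu>d \<Otimes>\<^sub>M \<nu>)"
    by (simp add: case_prod_beta')
qed

text \<open>Tonelli isolates a fixed \<open>l\<close>, where the convolution identity applies, and
  then exchanges the integrals over \<open>l\<close> and \<open>\<xi>\<close>. As an identity in
  [0, infinity] it is available before square-integrability of the wavelet transform is
  known.\<close>

lemma nn_integral_wavelet_transform:
  assumes f: "f \<in> L2 \<mu>"
  shows "(\<integral>\<^sup>+z. ennreal ((cmod (wavelet_transform \<mu> \<psi> f z))\<^sup>2) \<partial>(\<mu> \<Otimes>\<^sub>M \<nu>))
    = (\<integral>\<^sup>+\<xi>. ennreal ((cmod (fourier \<mu> \<mu>d f \<xi>))\<^sup>2) * (\<integral>\<^sup>+l. ennreal ((cmod (\<Phi> l \<xi>))\<^sup>2) \<partial>\<nu>) \<partial>\<mu>d)"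
proof -
  note [measurable] = wavelet_transform_measurable_aux[OF f] L2D(1)[OF fourier_in_L2[OF f]]
  have "(\<integral>\<^sup>+z. ennreal ((cmod (wavelet_transform \<mu> \<psi> f z))\<^sup>2) \<partial>(\<mu> \<Otimes>\<^sub>M \<nu>))
      = (\<integral>\<^sup>+l. \<integral>\<^sup>+x. ennreal ((cmod (wavelet_transform \<mu> \<psi> f (x, l)))\<^sup>2) \<partial>\<mu> \<partial>\<nu>)"
    by (rule mu_nu.nn_integral_snd[symmetric]) measurable
  also have "\<dots> = (\<integral>\<^sup>+l. \<integral>\<^sup>+\<xi>. ennreal ((cmod (fourier \<mu> \<mu>d f \<xi>))\<^sup>2) * ennreal ((cmod (\<Phi> l \<xi>))\<^sup>2) \<partial>\<mu>d \<partial>\<nu>)"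
  proof (intro nn_integral_cong)
    fix l
    have "(\<integral>\<^sup>+x. ennreal ((cmod (wavelet_transform \<mu> \<psi> f (x, l)))\<^sup>2) \<partial>\<mu>)
        = (\<integral>\<^sup>+\<xi>. ennreal ((cmod (fourier \<mu> \<mu>d f \<xi>))\<^sup>2 * (cmod (fourier \<mu> \<mu>d (\<psi> l) \<xi>))\<^sup>2) \<partial>\<mu>d)"
      using nn_integral_convolution[OF f psi_L2, of l] by (simp add: wavelet_transform_def)
    also have "\<dots> = (\<integral>\<^sup>+\<xi>. ennreal ((cmod (fourier \<mu> \<mu>d f \<xi>))\<^sup>2) * ennreal ((cmod (\<Phi> l \<xi>))\<^sup>2) \<partial>\<mu>d)"
      by (rule nn_integral_cong_AE) (use Phi_eq[of l] in \<open>auto elim!: eventually_mono simp: ennreal_mult\<close>)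
    finally show "(\<integral>\<^sup>+x. ennreal ((cmod (wavelet_transform \<mu> \<psi> f (x, l)))\<^sup>2) \<partial>\<mu>)
        = (\<integral>\<^sup>+\<xi>. ennreal ((cmod (fourier \<mu> \<mu>d f \<xi>))\<^sup>2) * ennreal ((cmod (\<Phi> l \<xi>))\<^sup>2) \<partial>\<mu>d)" .
  qed
  also have "\<dots> = (\<integral>\<^sup>+\<xi>. \<integral>\<^sup>+l. ennreal ((cmod (fourier \<mu> \<mu>d f \<xi>))\<^sup>2) * ennreal ((cmod (\<Phi> l \<xi>))\<^sup>2) \<partial>\<nu> \<partial>\<mu>d)"
  proof (rule nu_mud.Fubini'[symmetric])
    have "(\<lambda>p. ennreal ((cmod (fourier \<mu> \<mu>d f (snd p)))\<^sup>2) * ennreal ((cmod (\<Phi> (fst p) (snd p)))\<^sup>2))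
        \<in> borel_measurable (\<nu> \<Otimes>\<^sub>M \<mu>d)" by measurable
    then show "(\<lambda>(l, \<xi>). ennreal ((cmod (fourier \<mu> \<mu>d f \<xi>))\<^sup>2) * ennreal ((cmod (\<Phi> l \<xi>))\<^sup>2))
        \<in> borel_measurable (\<nu> \<Otimes>\<^sub>M \<mu>d)" by (simp add: case_prod_beta')
  qed
  also have "\<dots> = (\<integral>\<^sup>+\<xi>. ennreal ((cmod (fourier \<mu> \<mu>d f \<xi>))\<^sup>2) * (\<integral>\<^sup>+l. ennreal ((cmod (\<Phi> l \<xi>))\<^sup>2) \<partial>\<nu>) \<partial>\<mu>d)"
  proof (intro nn_integral_cong nn_integral_cmult)
    fix \<xi>
    have "(\<lambda>l. \<Phi> l \<xi>) \<in> borel_measurable \<nu>"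
      using measurable_compose[OF measurable_Pair2'[of \<xi> \<mu>d \<nu>] Phi_measurable] by simp
    then show "(\<lambda>l. ennreal ((cmod (\<Phi> l \<xi>))\<^sup>2)) \<in> borel_measurable \<nu>" by measurable
  qed
  finally show ?thesis .
qed

lemma isometry_of_calderon:
  assumes "AE \<xi> in \<mu>d. (\<integral>\<^sup>+l. ennreal ((cmod (\<Phi> l \<xi>))\<^sup>2) \<partial>\<nu>) = 1"
  shows "wavelet_isometry \<mu> \<nu> \<psi>"
  unfolding wavelet_isometry_def
proof (intro ballI conjI)
  fix f assume f: "f \<in> L2 \<mu>"
  have "(\<integral>\<^sup>+z. ennreal ((cmod (wavelet_transform \<mu> \<psi> f z))\<^sup>2) \<partial>(\<mu> \<Otimes>\<^sub>M \<nu>))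
      = (\<integral>\<^sup>+\<xi>. ennreal ((cmod (fourier \<mu> \<mu>d f \<xi>))\<^sup>2) \<partial>\<mu>d)"
    unfolding nn_integral_wavelet_transform[OF f]
    by (rule nn_integral_cong_AE) (use assms in \<open>auto elim!: eventually_mono\<close>)
  also have "\<dots> = (\<integral>\<^sup>+x. ennreal ((cmod (f x))\<^sup>2) \<partial>\<mu>)"
    by (simp add: nn_integral_L2[OF fourier_in_L2[OF f]] nn_integral_L2[OF f] l2_norm_fourier[OF f])
  finally have eq: "(\<integral>\<^sup>+z. ennreal ((cmod (wavelet_transform \<mu> \<psi> f z))\<^sup>2) \<partial>(\<mu> \<Otimes>\<^sub>M \<nu>))
      = (\<integral>\<^sup>+x. ennreal ((cmod (f x))\<^sup>2) \<partial>\<mu>)" .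
  show W: "wavelet_transform \<mu> \<psi> f \<in> L2 (\<mu> \<Otimes>\<^sub>M \<nu>)"
    using f wavelet_transform_measurable_aux[OF f] unfolding L2_iff_nn_integral eq by simp
  show "l2_norm (\<mu> \<Otimes>\<^sub>M \<nu>) (wavelet_transform \<mu> \<psi> f) = l2_norm \<mu> f"
    by (rule l2_norm_eqI[OF W f eq])
qed

text \<open>Write \<open>C\<close> for the Calderon integral. An isometry gives
  \<open>\<langle>f\<^sup>\<wedge> \<surd>C, g\<^sup>\<wedge> \<surd>C\<rangle> = \<langle>f\<^sup>\<wedge>, g\<^sup>\<wedge>\<rangle>\<close>; for \<open>g\<close> a translate of \<open>f\<close> this says that
  \<open>\<bar>f\<^sup>\<wedge>\<bar>\<^sup>2 (C - 1)\<close> has vanishing inverse Fourier transform.\<close>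

lemma calderon_of_isometry:
  assumes iso: "wavelet_isometry \<mu> \<nu> \<psi>"
  shows "AE \<xi> in \<mu>d. (\<integral>\<^sup>+l. ennreal ((cmod (\<Phi> l \<xi>))\<^sup>2) \<partial>\<nu>) = 1"
proof -
  define C where "C \<xi> = (\<integral>\<^sup>+l. ennreal ((cmod (\<Phi> l \<xi>))\<^sup>2) \<partial>\<nu>)" for \<xi>
  have [measurable]: "C \<in> borel_measurable \<mu>d" unfolding C_def by (rule calderon_measurable)
  \<comment> \<open>With the square root of \<open>C\<close> as a multiplier, the isometry becomes
    equality of norms of functions linear in the transform of \<open>f\<close> up to null sets, so
    polarization applies.\<close>
  define S where "S \<xi> = complex_of_real (sqrt (enn2real (C \<xi>)))" for \<xi>
  have S [measurable]: "S \<in> borel_measurable \<mu>d" unfolding S_def by measurable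
  have Sf: "(\<lambda>\<xi>. fourier \<mu> \<mu>d f \<xi> * S \<xi>) \<in> L2 \<mu>d \<and> l2_norm \<mu>d (\<lambda>\<xi>. fourier \<mu> \<mu>d f \<xi> * S \<xi>) = l2_norm \<mu> f"
    if f: "f \<in> L2 \<mu>" for f
  proof -
    note [measurable] = L2D(1)[OF fourier_in_L2[OF f]]
    have W: "wavelet_transform \<mu> \<psi> f \<in> L2 (\<mu> \<Otimes>\<^sub>M \<nu>)"
      "l2_norm (\<mu> \<Otimes>\<^sub>M \<nu>) (wavelet_transform \<mu> \<psi> f) = l2_norm \<mu> f"
      using iso f unfolding wavelet_isometry_def by auto
    have int: "(\<integral>\<^sup>+\<xi>. ennreal ((cmod (fourier \<mu> \<mu>d f \<xi>))\<^sup>2) * C \<xi> \<partial>\<mu>d) = (\<integral>\<^sup>+x. ennreal ((cmod (f x))\<^sup>2) \<partial>\<mu>)"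
      unfolding C_def nn_integral_wavelet_transform[OF f, symmetric]
      by (simp add: nn_integral_L2[OF W(1)] nn_integral_L2[OF f] W(2))
    also have "\<dots> < \<infinity>" using f by (simp add: L2_iff_nn_integral)
    finally have "AE \<xi> in \<mu>d. ennreal ((cmod (fourier \<mu> \<mu>d f \<xi>))\<^sup>2) * C \<xi> \<noteq> \<infinity>"
      by (intro nn_integral_PInf_AE) auto
    \<comment> \<open>The weighted integral is finite, so the transform of \<open>f\<close> vanishes
      almost everywhere where \<open>C\<close> is infinite; the value 0 that \<open>enn2real\<close>
      assigns there does no harm.\<close>
    then have "AE \<xi> in \<mu>d. ennreal ((cmod (fourier \<mu> \<mu>d f \<xi> * S \<xi>))\<^sup>2)
        = ennreal ((cmod (fourier \<mu> \<mu>d f \<xi>))\<^sup>2) * C \<xi>"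
    proof eventually_elim
      case (elim \<xi>)
      show ?case
      proof (cases "fourier \<mu> \<mu>d f \<xi> = 0")
        case False
        then have "C \<xi> < \<infinity>" using elim by (auto simp: ennreal_mult_eq_top_iff less_top)
        then show ?thesis
          by (simp add: S_def norm_mult power_mult_distrib ennreal_mult)
      qed simp
    qed
    then have eq: "(\<integral>\<^sup>+\<xi>. ennreal ((cmod (fourier \<mu> \<mu>d f \<xi> * S \<xi>))\<^sup>2) \<partial>\<mu>d) = (\<integral>\<^sup>+x. ennreal ((cmod (f x))\<^sup>2) \<partial>\<mu>)"
      unfolding int[symmetric] by (rule nn_integral_cong_AE)
    have "(\<lambda>\<xi>. fourier \<mu> \<mu>d f \<xi> * S \<xi>) \<in> L2 \<mu>d"
      using f unfolding L2_iff_nn_integral eq by simp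
    then show ?thesis using l2_norm_eqI[OF _ f eq] by simp
  qed
  have inner: "l2_inner \<mu>d (\<lambda>\<xi>. fourier \<mu> \<mu>d f \<xi> * S \<xi>) (\<lambda>\<xi>. fourier \<mu> \<mu>d g \<xi> * S \<xi>)
      = l2_inner \<mu>d (fourier \<mu> \<mu>d f) (fourier \<mu> \<mu>d g)" if f: "f \<in> L2 \<mu>" and g: "g \<in> L2 \<mu>" for f g
  proof (rule l2_inner_eqI)
    fix a b
    have fg: "(\<lambda>x. a * f x + b * g x) \<in> L2 \<mu>" using f g by auto
    note lin = is_fourier_L2_lin[OF is_fourier_L2_fourier[OF f] is_fourier_L2_fourier[OF g] f g, of a b]
    \<comment> \<open>Since \<open>fourier\<close> picks representatives, its linearity holds only
      almost everywhere.\<close>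
    have AE: "AE \<xi> in \<mu>d. fourier \<mu> \<mu>d (\<lambda>x. a * f x + b * g x) \<xi> = a * fourier \<mu> \<mu>d f \<xi> + b * fourier \<mu> \<mu>d g \<xi>"
      by (rule is_fourier_L2_unique[OF is_fourier_L2_fourier[OF fg] lin fg])
    have "l2_norm \<mu>d (\<lambda>\<xi>. a * (fourier \<mu> \<mu>d f \<xi> * S \<xi>) + b * (fourier \<mu> \<mu>d g \<xi> * S \<xi>))
        = l2_norm \<mu>d (\<lambda>\<xi>. fourier \<mu> \<mu>d (\<lambda>x. a * f x + b * g x) \<xi> * S \<xi>)"
    proof (rule l2_norm_cong_AE)
      show "AE \<xi> in \<mu>d. cmod (a * (fourier \<mu> \<mu>d f \<xi> * S \<xi>) + b * (fourier \<mu> \<mu>d g \<xi> * S \<xi>))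
          = cmod (fourier \<mu> \<mu>d (\<lambda>x. a * f x + b * g x) \<xi> * S \<xi>)"
        using AE by eventually_elim (simp add: algebra_simps)
    qed (use L2D(1)[OF fourier_in_L2[OF f]] L2D(1)[OF fourier_in_L2[OF g]] L2D(1)[OF fourier_in_L2[OF fg]] in measurable)
    also have "\<dots> = l2_norm \<mu> (\<lambda>x. a * f x + b * g x)" using Sf[OF fg] by simp
    also have "\<dots> = l2_norm \<mu>d (\<lambda>\<xi>. a * fourier \<mu> \<mu>d f \<xi> + b * fourier \<mu> \<mu>d g \<xi>)"
      by (rule is_fourier_L2_norm[OF lin fg, symmetric])
    finally show "l2_norm \<mu>d (\<lambda>\<xi>. a * (fourier \<mu> \<mu>d f \<xi> * S \<xi>) + b * (fourier \<mu> \<mu>d g \<xi> * S \<xi>))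
        = l2_norm \<mu>d (\<lambda>\<xi>. a * fourier \<mu> \<mu>d f \<xi> + b * fourier \<mu> \<mu>d g \<xi>)" .
  qed (use Sf f g in auto)
  obtain \<V> :: "'a set set" where V: "countable \<V>"
    "\<And>V. V \<in> \<V> \<Longrightarrow> open V \<and> emeasure \<mu> V < \<infinity>"
    "\<And>x U. open U \<Longrightarrow> x \<in> U \<Longrightarrow> \<exists>V\<in>\<V>. x \<in> V \<and> V \<subseteq> U"
    by (rule finite_measure_basis) (rule that)
  have "AE \<xi> in \<mu>d. fourier_L1 \<mu> (indicator V) \<xi> = 0 \<or> C \<xi> = 1" if "V \<in> \<V>" for V
  proof -
    define p where "p = (indicator V :: 'a \<Rightarrow> complex)"
    have p: "integrable \<mu> p" "p \<in> L2 \<mu>" unfolding p_def using V(2)[OF that] by (auto intro!: indicator_L1_L2)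
    define F where "F = fourier \<mu> \<mu>d p"
    have F: "F \<in> L2 \<mu>d" unfolding F_def using p by auto
    note [measurable] = L2D(1)[OF F]
    have FS: "(\<lambda>\<xi>. F \<xi> * S \<xi>) \<in> L2 \<mu>d" unfolding F_def using Sf[OF p(2)] by simp
    \<comment> \<open>\<open>K\<close> equals
      \<open>(cmod (F \<xi>))\<^sup>2 * (enn2real (C \<xi>) - 1)\<close>; written as a difference of
      products of \<open>L2\<close> functions, it is visibly integrable.\<close>
    define K where "K \<xi> = F \<xi> * S \<xi> * cnj (F \<xi> * S \<xi>) - F \<xi> * cnj (F \<xi>)" for \<xi>
    have K: "integrable \<mu>d K" unfolding K_def
      using integrable_L2_mult(1)[OF FS FS] integrable_L2_mult(1)[OF F F] by simp
    have "(LINT \<xi>|\<mu>d. K \<xi> * char_eval \<xi> x) = 0" for x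
    proof -
      define q where "q = translation x p"
      have q: "q \<in> L2 \<mu>" unfolding q_def by (rule translation_L2[OF p(2)])
      define G where "G \<xi> = cnj (char_eval \<xi> x) * F \<xi>" for \<xi>
      have G [measurable]: "G \<in> borel_measurable \<mu>d" unfolding G_def by measurable
      have FG: "AE \<xi> in \<mu>d. fourier \<mu> \<mu>d q \<xi> = G \<xi>"
        unfolding F_def q_def G_def
        by (rule is_fourier_L2_unique[OF is_fourier_L2_fourier[OF translation_L2[OF p(2)]]
              is_fourier_L2_translation[OF is_fourier_L2_fourier[OF p(2)] p(2)] translation_L2[OF p(2)]])
      note [measurable] = L2D(1)[OF fourier_in_L2[OF q]]
      have 1: "l2_inner \<mu>d (\<lambda>\<xi>. F \<xi> * S \<xi>) (\<lambda>\<xi>. fourier \<mu> \<mu>d q \<xi> * S \<xi>)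
          = (LINT \<xi>|\<mu>d. F \<xi> * S \<xi> * cnj (F \<xi> * S \<xi>) * char_eval \<xi> x)"
        unfolding l2_inner_def
        by (rule integral_cong_AE) (use FG in \<open>auto elim!: eventually_mono simp: G_def mult_ac\<close>)
      have 2: "l2_inner \<mu>d F (fourier \<mu> \<mu>d q) = (LINT \<xi>|\<mu>d. F \<xi> * cnj (F \<xi>) * char_eval \<xi> x)"
        unfolding l2_inner_def
        by (rule integral_cong_AE) (use FG in \<open>auto elim!: eventually_mono simp: G_def mult_ac\<close>)
      have "integrable \<mu>d (\<lambda>\<xi>. F \<xi> * S \<xi> * cnj (F \<xi> * S \<xi>) * char_eval \<xi> x)"
        by (rule integrable_mult_bounded[OF integrable_L2_mult(1)[OF FS FS], where B = 1]) auto
      moreover have "integrable \<mu>d (\<lambda>\<xi>. F \<xi> * cnj (F \<xi>) * char_eval \<xi> x)"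
        by (rule integrable_mult_bounded[OF integrable_L2_mult(1)[OF F F], where B = 1]) auto
      ultimately have "(LINT \<xi>|\<mu>d. K \<xi> * char_eval \<xi> x)
          = l2_inner \<mu>d (\<lambda>\<xi>. F \<xi> * S \<xi>) (\<lambda>\<xi>. fourier \<mu> \<mu>d q \<xi> * S \<xi>) - l2_inner \<mu>d F (fourier \<mu> \<mu>d q)"
        unfolding 1 2 K_def left_diff_distrib by (rule Bochner_Integration.integral_diff)
      also have "\<dots> = 0" using inner[OF p(2) q] by (simp add: F_def)
      finally show ?thesis .
    qed
    then have "AE \<xi> in \<mu>d. K \<xi> = 0" by (rule inverse_fourier_unique[OF sets_mud K])
    moreover have "AE \<xi> in \<mu>d. F \<xi> = fourier_L1 \<mu> p \<xi>"
      unfolding F_def by (rule is_fourier_L2_unique[OF is_fourier_L2_fourier[OF p(2)] is_fourier_L2_L1[OF p] p(2)])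
    ultimately show ?thesis
    proof eventually_elim
      case (elim \<xi>)
      show ?case
      proof (cases "F \<xi> = 0")
        case True
        then show ?thesis using elim(2) by (simp add: p_def)
      next
        case False
        have "F \<xi> * cnj (F \<xi>) * (S \<xi> * cnj (S \<xi>) - 1) = 0"
          using elim(1) by (simp add: K_def algebra_simps)
        then have "S \<xi> * cnj (S \<xi>) = 1" using False by simp
        then have "complex_of_real (enn2real (C \<xi>)) = 1"
          unfolding S_def by (simp flip: of_real_mult)
        then have "enn2real (C \<xi>) = 1" by simp
        \<comment> \<open>Since \<open>enn2real\<close> sends infinity to 0, the value 1 rules out
          an infinite \<open>C \<xi>\<close>.\<close>
        then have "C \<xi> = 1" by (metis enn2real_top ennreal_1 ennreal_enn2real less_top zero_neq_one)
        then show ?thesis by simp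
      qed
    qed
  qed
  then have "AE \<xi> in \<mu>d. \<forall>V\<in>\<V>. fourier_L1 \<mu> (indicator V) \<xi> = 0 \<or> C \<xi> = 1"
    by (intro AE_ball_countable[OF V(1), THEN iffD2] ballI)
  then show ?thesis
  proof eventually_elim
    case (elim \<xi>)
    obtain V where "V \<in> \<V>" "fourier_L1 \<mu> (indicator V) \<xi> \<noteq> 0"
      using fourier_indicator_nonzero[OF V, of \<xi>] by auto
    with bspec[OF elim \<open>V \<in> \<V>\<close>] show ?case by (simp add: C_def)
  qed
qed

end

lemma Phi_exists:
  obtains \<Phi> where "(\<lambda>p. \<Phi> (fst p) (snd p)) \<in> borel_measurable (\<nu> \<Otimes>\<^sub>M \<mu>d)"
    "\<And>l. AE \<xi> in \<mu>d. \<Phi> l \<xi> = fourier \<mu> \<mu>d (\<psi> l) \<xi>"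
  by (rule jointly_measurable_fourier[OF sets_nu psi_L2 weakly_measurable]) (rule that)

lemma wavelet_transform_measurable:
  assumes "f \<in> L2 \<mu>"
  shows "wavelet_transform \<mu> \<psi> f \<in> borel_measurable (\<mu> \<Otimes>\<^sub>M \<nu>)"
proof -
  obtain \<Phi> where "(\<lambda>p. \<Phi> (fst p) (snd p)) \<in> borel_measurable (\<nu> \<Otimes>\<^sub>M \<mu>d)"
    "\<And>l. AE \<xi> in \<mu>d. \<Phi> l \<xi> = fourier \<mu> \<mu>d (\<psi> l) \<xi>"
    by (rule Phi_exists) (rule that)
  then show ?thesis by (rule wavelet_transform_measurable_aux[OF _ _ assms])
qed

text \<open>Both implications hold for any admissible \<open>\<Phi>\<close>: one uses the
  representative contained in the condition, the other the one built by measurable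
  selection.\<close>

theorem calderon_iff_isometry: "calderon_condition \<mu> \<mu>d \<nu> \<psi> \<longleftrightarrow> wavelet_isometry \<mu> \<nu> \<psi>"
proof
  assume "calderon_condition \<mu> \<mu>d \<nu> \<psi>"
  then obtain \<Phi> where \<Phi>: "(\<lambda>(l, \<xi>). \<Phi> l \<xi>) \<in> borel_measurable (\<nu> \<Otimes>\<^sub>M \<mu>d)"
    "\<forall>l. AE \<xi> in \<mu>d. \<Phi> l \<xi> = fourier \<mu> \<mu>d (\<psi> l) \<xi>"
    "AE \<xi> in \<mu>d. (\<integral>\<^sup>+ l. ennreal ((cmod (\<Phi> l \<xi>))\<^sup>2) \<partial>\<nu>) = 1"
    unfolding calderon_condition_def by (elim exE conjE)
  show "wavelet_isometry \<mu> \<nu> \<psi>"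
    by (rule isometry_of_calderon[OF \<Phi>(1)[unfolded case_prod_beta'] spec[OF \<Phi>(2)] \<Phi>(3)])
next
  assume iso: "wavelet_isometry \<mu> \<nu> \<psi>"
  obtain \<Phi> where \<Phi>: "(\<lambda>p. \<Phi> (fst p) (snd p)) \<in> borel_measurable (\<nu> \<Otimes>\<^sub>M \<mu>d)"
    "\<And>l. AE \<xi> in \<mu>d. \<Phi> l \<xi> = fourier \<mu> \<mu>d (\<psi> l) \<xi>"
    by (rule Phi_exists) (rule that)
  show "calderon_condition \<mu> \<mu>d \<nu> \<psi>"
    unfolding calderon_condition_def case_prod_beta'
    by (intro exI[of _ \<Phi>] conjI allI \<Phi> calderon_of_isometry[OF \<Phi> iso])
qed

text \<open>The polarized isometry expresses the inner product over the product space, and Fubini's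
  theorem slices it in \<open>l\<close>, because the product of two \<open>L2\<close> functions is
  integrable.\<close>

lemma weak_inversion_of_isometry:
  assumes iso: "wavelet_isometry \<mu> \<nu> \<psi>" and f: "f \<in> L2 \<mu>"
  shows "weak_inversion_formula \<mu> \<nu> \<psi> f"
  unfolding weak_inversion_formula_def
proof (intro conjI ballI)
  have W: "wavelet_transform \<mu> \<psi> h \<in> L2 (\<mu> \<Otimes>\<^sub>M \<nu>)"
    "l2_norm (\<mu> \<Otimes>\<^sub>M \<nu>) (wavelet_transform \<mu> \<psi> h) = l2_norm \<mu> h" if "h \<in> L2 \<mu>" for h
    using iso that unfolding wavelet_isometry_def by auto
  note [measurable] = wavelet_transform_measurable
  have "(\<integral>\<^sup>+l. \<integral>\<^sup>+x. ennreal ((cmod (wavelet_transform \<mu> \<psi> f (x, l)))\<^sup>2) \<partial>\<mu> \<partial>\<nu>)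
      = (\<integral>\<^sup>+z. ennreal ((cmod (wavelet_transform \<mu> \<psi> f z))\<^sup>2) \<partial>(\<mu> \<Otimes>\<^sub>M \<nu>))"
    by (rule mu_nu.nn_integral_snd) (use f in measurable)
  also have "\<dots> < \<infinity>" using W(1)[OF f] by (simp add: L2_iff_nn_integral)
  finally have fin: "(\<integral>\<^sup>+l. \<integral>\<^sup>+x. ennreal ((cmod (wavelet_transform \<mu> \<psi> f (x, l)))\<^sup>2) \<partial>\<mu> \<partial>\<nu>) < \<infinity>" .
  \<comment> \<open>A finite iterated integral has a finite inner integral for almost every
    \<open>l\<close>; this is the first clause of the inversion formula.\<close>
  have "AE l in \<nu>. (\<integral>\<^sup>+x. ennreal ((cmod (wavelet_transform \<mu> \<psi> f (x, l)))\<^sup>2) \<partial>\<mu>) \<noteq> \<infinity>"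
  proof (rule nn_integral_PInf_AE)
    show "(\<lambda>l. \<integral>\<^sup>+x. ennreal ((cmod (wavelet_transform \<mu> \<psi> f (x, l)))\<^sup>2) \<partial>\<mu>) \<in> borel_measurable \<nu>"
      by (rule mu.borel_measurable_nn_integral) (use f in measurable)
  qed (use fin in simp)
  then show "AE l in \<nu>. convolution \<mu> f (involution (\<psi> l)) \<in> L2 \<mu>"
    by eventually_elim
       (simp add: L2_iff_nn_integral wavelet_transform_def less_top convolution_measurable[OF f psi_L2])
  fix g assume g: "g \<in> L2 \<mu>"
  define P where "P = (\<lambda>x l. wavelet_transform \<mu> \<psi> f (x, l) * cnj (wavelet_transform \<mu> \<psi> g (x, l)))"
  have P: "integrable (\<mu> \<Otimes>\<^sub>M \<nu>) (case_prod P)"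
    using integrable_L2_mult(1)[OF W(1)[OF f] W(1)[OF g]] by (simp add: P_def case_prod_beta')
  have conv: "l2_inner \<mu> (convolution \<mu> f (involution (\<psi> l))) (convolution \<mu> g (involution (\<psi> l)))
      = (LINT x|\<mu>. P x l)" for l
    by (simp add: P_def l2_inner_def wavelet_transform_def)
  show "integrable \<nu> (\<lambda>l. l2_inner \<mu> (convolution \<mu> f (involution (\<psi> l))) (convolution \<mu> g (involution (\<psi> l))))"
    unfolding conv by (rule mu_nu.integrable_snd[OF P])
  have "l2_inner \<mu> f g = l2_inner (\<mu> \<Otimes>\<^sub>M \<nu>) (wavelet_transform \<mu> \<psi> f) (wavelet_transform \<mu> \<psi> g)"
  proof (rule l2_inner_eqI[OF f g W(1)[OF f] W(1)[OF g]])
    fix a b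
    have "(\<lambda>x. a * f x + b * g x) \<in> L2 \<mu>" using f g by auto
    from W(2)[OF this] show "l2_norm \<mu> (\<lambda>x. a * f x + b * g x)
        = l2_norm (\<mu> \<Otimes>\<^sub>M \<nu>) (\<lambda>z. a * wavelet_transform \<mu> \<psi> f z + b * wavelet_transform \<mu> \<psi> g z)"
      by (simp add: wavelet_transform_lin[OF f g])
  qed
  also have "\<dots> = (LINT l|\<nu>. LINT x|\<mu>. P x l)"
    unfolding mu_nu.integral_snd[OF P] by (simp add: l2_inner_def P_def case_prod_beta')
  finally show "l2_inner \<mu> f g = (LINT l|\<nu>. l2_inner \<mu> (convolution \<mu> f (involution (\<psi> l))) (convolution \<mu> g (involution (\<psi> l))))"
    unfolding conv .
qed

text \<open>The case \<open>g = f\<close> of the formula is the norm identity. Its first clause is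
  essential: for a slice outside \<open>L2\<close> the Bochner inner product would be 0, while the
  extended integral of the squared modulus is infinite.\<close>

lemma isometry_of_weak_inversion:
  assumes inv: "\<And>f. f \<in> L2 \<mu> \<Longrightarrow> weak_inversion_formula \<mu> \<nu> \<psi> f"
  shows "wavelet_isometry \<mu> \<nu> \<psi>"
  unfolding wavelet_isometry_def
proof (intro ballI conjI)
  fix f assume f: "f \<in> L2 \<mu>"
  define c where "c = (\<lambda>l. convolution \<mu> f (involution (\<psi> l)))"
  have AE: "AE l in \<nu>. c l \<in> L2 \<mu>" and int: "integrable \<nu> (\<lambda>l. l2_inner \<mu> (c l) (c l))"
    and eq: "l2_inner \<mu> f f = (LINT l|\<nu>. l2_inner \<mu> (c l) (c l))"
    using inv[OF f] f unfolding weak_inversion_formula_def c_def by auto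
  have int': "integrable \<nu> (\<lambda>l. (l2_norm \<mu> (c l))\<^sup>2)"
    using integrable_Re[OF int] by (simp add: l2_inner_self del: of_real_power)
  have eq': "(l2_norm \<mu> f)\<^sup>2 = (LINT l|\<nu>. (l2_norm \<mu> (c l))\<^sup>2)"
    using eq unfolding l2_inner_self integral_complex_of_real of_real_eq_iff .
  note Wm = wavelet_transform_measurable[OF f]
  have "(\<integral>\<^sup>+z. ennreal ((cmod (wavelet_transform \<mu> \<psi> f z))\<^sup>2) \<partial>(\<mu> \<Otimes>\<^sub>M \<nu>))
      = (\<integral>\<^sup>+l. \<integral>\<^sup>+x. ennreal ((cmod (wavelet_transform \<mu> \<psi> f (x, l)))\<^sup>2) \<partial>\<mu> \<partial>\<nu>)"
    by (rule mu_nu.nn_integral_snd[symmetric]) (use Wm in measurable)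
  also have "\<dots> = (\<integral>\<^sup>+l. ennreal ((l2_norm \<mu> (c l))\<^sup>2) \<partial>\<nu>)"
    by (rule nn_integral_cong_AE, use AE in eventually_elim)
       (simp add: nn_integral_L2[symmetric] wavelet_transform_def c_def)
  also have "\<dots> = ennreal (LINT l|\<nu>. (l2_norm \<mu> (c l))\<^sup>2)"
    by (rule nn_integral_eq_integral[OF int']) simp
  also have "\<dots> = (\<integral>\<^sup>+x. ennreal ((cmod (f x))\<^sup>2) \<partial>\<mu>)"
    unfolding eq'[symmetric] nn_integral_L2[OF f] ..
  finally have nn: "(\<integral>\<^sup>+z. ennreal ((cmod (wavelet_transform \<mu> \<psi> f z))\<^sup>2) \<partial>(\<mu> \<Otimes>\<^sub>M \<nu>))
      = (\<integral>\<^sup>+x. ennreal ((cmod (f x))\<^sup>2) \<partial>\<mu>)" .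
  show W: "wavelet_transform \<mu> \<psi> f \<in> L2 (\<mu> \<Otimes>\<^sub>M \<nu>)"
    using f Wm unfolding L2_iff_nn_integral nn by simp
  show "l2_norm (\<mu> \<Otimes>\<^sub>M \<nu>) (wavelet_transform \<mu> \<psi> f) = l2_norm \<mu> f"
    by (rule l2_norm_eqI[OF W f nn])
qed

end

theorem theorem2p2:
  fixes \<mu> :: "'a::{topological_ab_group_add,t2_space,second_countable_topology} measure"
    and \<mu>d :: "'a dual measure"
    and \<nu> :: "'l::t2_space measure"
    and \<psi> :: "'l \<Rightarrow> 'a \<Rightarrow> complex"
  assumes "locally_compact_space (euclidean :: 'a topology)"
    and "haar_measure \<mu>"
    and "haar_measure \<mu>d"
    and "plancherel_normalized \<mu> \<mu>d"
    and "locally_compact_space (euclidean :: 'l topology)"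
    and "sigma_compact_space (euclidean :: 'l topology)"
    and "radon_measure \<nu>"
    and "\<forall>l. \<psi> l \<in> L2 \<mu>"
    and "weakly_borel_measurable \<mu> \<psi>"
  shows
    "(calderon_condition \<mu> \<mu>d \<nu> \<psi> \<longleftrightarrow> wavelet_isometry \<mu> \<nu> \<psi>) \<and>
     (wavelet_isometry \<mu> \<nu> \<psi> \<longleftrightarrow> (\<forall>f\<in>L2 \<mu>. weak_inversion_formula \<mu> \<nu> \<psi> f)) \<and>
     (spectral_injectivity \<mu> \<mu>d \<nu> \<psi> \<longrightarrow>
       (\<forall>f\<in>L2 \<mu>. \<forall>g\<in>L2 \<mu>.
         (\<forall>z. cmod (wavelet_transform \<mu> \<psi> f z) = cmod (wavelet_transform \<mu> \<psi> g z)) \<longleftrightarrow>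
         (AE \<xi> in \<mu>d. cmod (fourier \<mu> \<mu>d f \<xi>) = cmod (fourier \<mu> \<mu>d g \<xi>)) \<and>
         (\<forall>l. (\<forall>x. cmod (convolution \<mu> f (involution (\<psi> l)) x) =
                     cmod (convolution \<mu> g (involution (\<psi> l)) x)) \<and>
              (AE \<xi> in \<mu>d.
                 cmod (fourier \<mu> \<mu>d (convolution \<mu> f (involution (\<psi> l))) \<xi>) =
                 cmod (fourier \<mu> \<mu>d (convolution \<mu> g (involution (\<psi> l))) \<xi>)))))"
proof -
  interpret wavelet_family \<mu> \<mu>d \<nu> \<psi>
  proof (intro wavelet_family.intro wavelet_family_axioms.intro plancherel_pair.intro)
    show "sets \<nu> = sets borel" using assms(7) unfolding radon_measure_def by (rule conjunct1)
    show "sigma_finite_measure \<nu>" by (rule sigma_finite_radon_measure[OF assms(6,7)])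
    show "\<psi> l \<in> L2 \<mu>" for l using assms(8) by (rule spec)
  qed (fact assms)+
  have "wavelet_isometry \<mu> \<nu> \<psi> \<longleftrightarrow> (\<forall>f\<in>L2 \<mu>. weak_inversion_formula \<mu> \<nu> \<psi> f)"
    using weak_inversion_of_isometry isometry_of_weak_inversion by auto
  then show ?thesis
    by (intro conjI impI ballI calderon_iff_isometry phase_retrieval_reduction psi_L2)
qed

end
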